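(* Let $k$ be a field, let $R$ be a noetherian Hopf $k$-algebra with comultiplication $\Delta$, counit $\epsilon$ and antipode $S$, and let $T=R[x;\sigma,\delta]$ be an Ore extension of $R$, where $\sigma$ is a $k$-algebra automorphism of $R$ and $\delta$ is a $k$-linear $\sigma$-derivation of $R$. Suppose that $R\otimes_k R$ is a domain. Then $T$ has a Hopf algebra structure extending that of $R$ (i.e. one for which $R$ is a Hopf subalgebra) if and only if, after a change of the variable $x$ (with the corresponding change of $\sigma$ and $\delta$; the new data are again denoted $x,\sigma,\delta$), the following hold: (1) there exist a grouplike element $\beta$ of $R$ and an element $w=\sum w_1\otimes w_2\in R\otimes_k R$ such that $$\Delta(x)=\beta^{-1}\otimes x+x\otimes 1+w,\qquad S(x)=-\beta\Bigl(x+\sum w_1S(w_2)\Bigr),\qquad \beta\sum w_1S(w_2)=\sum S(w_1)w_2;$$ (2) there is a character $\chi:R\to k$ such that for all $r\in R$ $$\sigma(r)=\sum\chi(r_1)r_2=\sum\beta^{-1}r_1\beta\,\chi(r_2)=\bigl(\mathrm{ad}(\beta^{-1})\circ\tau^r_\chi\bigr)(r),$$ that is, $\sigma$ is the left winding automorphism $\tau^l_\chi$, and is also the composition of the corresponding right winding automorphism $\tau^r_\chi$ with conjugation by $\beta$; (3) the $\sigma$-derivation $\delta$ satisfies, for all $r\in R$, $$\Delta(\delta(r))-\sum\delta(r_1)\otimes r_2-\sum\beta^{-1}r_1\otimes\delta(r_2)-w\,\Delta(r)+\Delta(\sigma(r))\,w=0,$$ and $$w\otimes 1+(\Delta\otimes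 I)(w)=\beta^{-1}\otimes w+(I\otimes\Delta)(w).$$
   Context: A $\sigma$-derivation $\delta$ of $R$ is a $k$-linear map with $\delta(ab)=\sigma(a)\delta(b)+\delta(a)b$. The Ore (skew polynomial) extension $R[x;\sigma,\delta]$ is the $k$-algebra generated by $R$ and $x$ with relations $xr=\sigma(r)x+\delta(r)$ for $r\in R$; it is a free left $R$-module with basis $\{x^i: i\ge 0\}$. A "change of the variable $x$" means replacing $x$ by an element $x'\in T$ such that $T=R[x';\sigma',\delta']$ for some automorphism $\sigma'$ and $\sigma'$-derivation $\delta'$ of $R$. Sweedler notation: $\Delta(r)=\sum r_1\otimes r_2$ for $r\in R$; and for a general element $w\in R\otimes_k R$ we write $w=\sum w_1\otimes w_2$ as a sum of pure tensors. $I$ is the identity map. A grouplike element is a $\beta\in R$ with $\Delta(\beta)=\beta\otimes\beta$, $\epsilon(\beta)=1$. A character is a $k$-algebra homomorphism $R\to k$. The winding automorphisms are $\tau^l_\chi(r)=\sum\chi(r_1)r_2$ and $\tau^r_\chi(r)=\sum r_1\chi(r_2)$, and $\mathrm{ad}(\beta^{-1})(r)=\beta^{-1}r\beta$. Domain means a (not necessarily commutative) nonzero ring without zero divisors. In the "only if" direction, $\Delta(x)$ and $S(x)$ in (1) are the values of the comultiplication and antipode of the given Hopf structure on $T$. In the "if" direction, (1) prescribes these values, the conditions on $\beta,w,\chi,\sigma,\delta$ are the hypotheses, and the conclusion is that $T$ admits a Hopf algebra structure with $R$ as a Hopf subalgebra.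
   Formalization: In the "if" direction the Hopf structure on T has the prescribed Δ(x), but the formula for S(x) in (1) is asserted only when ε(x)=0; otherwise it fails, e.g. R=k, T=k[x], β=1, w=c(1⊗1) with c≠0 forces S(x)=-x-2c. *)

theory Defs
  imports "HOL-Computational_Algebra.Polynomial"
begin

section \<open>Algebras over a field\<close>

text \<open>The carrier of a \<open>k\<close>-algebra is a type of class \<^class>\<open>ring_1\<close> (not necessarily commutative,
  \<open>0 \<noteq> 1\<close>); the action of the field is an explicit parameter \<open>s\<close>.\<close>

locale k_algebra = vector_space s
  for s :: "'k::field \<Rightarrow> 'a::ring_1 \<Rightarrow> 'a" +
  assumes scale_mult_left: "s c a * b = s c (a * b)"
    and scale_mult_right: "a * s c b = s c (a * b)"

definition algebra_hom ::
  "('k::field \<Rightarrow> 'a::ring_1 \<Rightarrow> 'a) \<Rightarrow> ('k \<Rightarrow> 'b::ring_1 \<Rightarrow> 'b) \<Rightarrow> ('a \<Rightarrow> 'b) \<Rightarrow> bool"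
  where "algebra_hom sA sB f \<longleftrightarrow>
    Vector_Spaces.linear sA sB f \<and> (\<forall>a b. f (a * b) = f a * f b) \<and> f 1 = 1"

abbreviation character :: "('k::field \<Rightarrow> 'a::ring_1 \<Rightarrow> 'a) \<Rightarrow> ('a \<Rightarrow> 'k) \<Rightarrow> bool"
  where "character s \<chi> \<equiv> algebra_hom s (*) \<chi>"

definition algebra_aut :: "('k::field \<Rightarrow> 'a::ring_1 \<Rightarrow> 'a) \<Rightarrow> ('a \<Rightarrow> 'a) \<Rightarrow> bool"
  where "algebra_aut s \<sigma> \<longleftrightarrow> algebra_hom s s \<sigma> \<and> bij \<sigma>"

definition skew_derivation ::
  "('k::field \<Rightarrow> 'a::ring_1 \<Rightarrow> 'a) \<Rightarrow> ('a \<Rightarrow> 'a) \<Rightarrow> ('a \<Rightarrow> 'a) \<Rightarrow> bool"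
  where "skew_derivation s \<sigma> \<delta> \<longleftrightarrow>
    Vector_Spaces.linear s s \<delta> \<and> (\<forall>a b. \<delta> (a * b) = \<sigma> a * \<delta> b + \<delta> a * b)"

text \<open>Two-sided inverse of a unit of a noncommutative ring; unspecified if \<open>a\<close> is not a unit.\<close>

definition ring_inv :: "'a::ring_1 \<Rightarrow> 'a"
  where "ring_inv a = (THE b. a * b = 1 \<and> b * a = 1)"

definition left_ideal :: "'a::ring_1 set \<Rightarrow> bool"
  where "left_ideal I \<longleftrightarrow> 0 \<in> I \<and> (\<forall>a\<in>I. \<forall>b\<in>I. a + b \<in> I) \<and> (\<forall>r. \<forall>a\<in>I. r * a \<in> I)"

definition right_ideal :: "'a::ring_1 set \<Rightarrow> bool"
  where "right_ideal I \<longleftrightarrow> 0 \<in> I \<and> (\<forall>a\<in>I. \<forall>b\<in>I. a + b \<in> I) \<and> (\<forall>r. \<forall>a\<in>I. a * r \<in> I)"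

definition noetherian :: "'a::ring_1 itself \<Rightarrow> bool"
  where "noetherian _ \<longleftrightarrow>
    (\<forall>I :: nat \<Rightarrow> 'a set. (\<forall>n. left_ideal (I n)) \<and> incseq I \<longrightarrow> (\<exists>N. \<forall>n\<ge>N. I n = I N)) \<and>
    (\<forall>I :: nat \<Rightarrow> 'a set. (\<forall>n. right_ideal (I n)) \<and> incseq I \<longrightarrow> (\<exists>N. \<forall>n\<ge>N. I n = I N))"


section \<open>Tensor powers over the field\<close>

text \<open>\<open>A \<otimes> A\<close> is presented by generators and relations: a list \<open>[(a\<^sub>1, b\<^sub>1), \<dots>, (a\<^sub>n, b\<^sub>n)]\<close> is the formal
  sum of its entries, and two formal sums are identified by the least congruence containing the
  (multi)linearity relations. The relation that makes \<open>(0, b)\<close> the empty sum turns the resulting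
  commutative monoid into a group, with \<open>(- a, b)\<close> as the inverse of \<open>(a, b)\<close>.\<close>

inductive formal_cong :: "('x list \<Rightarrow> 'x list \<Rightarrow> bool) \<Rightarrow> 'x list \<Rightarrow> 'x list \<Rightarrow> bool"
  for rel where
  base: "rel u v \<Longrightarrow> formal_cong rel u v"
| refl: "formal_cong rel u u"
| sym: "formal_cong rel u v \<Longrightarrow> formal_cong rel v u"
| trans: "formal_cong rel u v \<Longrightarrow> formal_cong rel v w \<Longrightarrow> formal_cong rel u w"
| comm: "formal_cong rel (u @ v) (v @ u)"
| add: "formal_cong rel u u' \<Longrightarrow> formal_cong rel v v' \<Longrightarrow> formal_cong rel (u @ v) (u' @ v')"

inductive bilinear_rel ::
  "('k::field \<Rightarrow> 'a::ring_1 \<Rightarrow> 'a) \<Rightarrow> ('a \<times> 'a) list \<Rightarrow> ('a \<times> 'a) list \<Rightarrow> bool"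
  for s where
  "bilinear_rel s [(a + a', b)] [(a, b), (a', b)]"
| "bilinear_rel s [(a, b + b')] [(a, b), (a, b')]"
| "bilinear_rel s [(s c a, b)] [(a, s c b)]"
| "bilinear_rel s [(0, b)] []"

inductive trilinear_rel ::
  "('k::field \<Rightarrow> 'a::ring_1 \<Rightarrow> 'a) \<Rightarrow> ('a \<times> 'a \<times> 'a) list \<Rightarrow> ('a \<times> 'a \<times> 'a) list \<Rightarrow> bool"
  for s where
  "trilinear_rel s [(a + a', b, c)] [(a, b, c), (a', b, c)]"
| "trilinear_rel s [(a, b + b', c)] [(a, b, c), (a, b', c)]"
| "trilinear_rel s [(a, b, c + c')] [(a, b, c), (a, b, c')]"
| "trilinear_rel s [(s k a, b, c)] [(a, s k b, c)]"
| "trilinear_rel s [(a, s k b, c)] [(a, b, s k c)]"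
| "trilinear_rel s [(0, b, c)] []"

type_synonym 'a tensor2 = "('a \<times> 'a) list set"
type_synonym 'a tensor3 = "('a \<times> 'a \<times> 'a) list set"

text \<open>\<open>tens s [(a\<^sub>1, b\<^sub>1), \<dots>, (a\<^sub>n, b\<^sub>n)]\<close> is the element \<open>\<Sum>\<^sub>i a\<^sub>i \<otimes> b\<^sub>i\<close> of \<open>A \<otimes> A\<close>.\<close>

definition tens :: "('k::field \<Rightarrow> 'a::ring_1 \<Rightarrow> 'a) \<Rightarrow> ('a \<times> 'a) list \<Rightarrow> 'a tensor2"
  where "tens s u = {v. formal_cong (bilinear_rel s) u v}"

definition tens3 :: "('k::field \<Rightarrow> 'a::ring_1 \<Rightarrow> 'a) \<Rightarrow> ('a \<times> 'a \<times> 'a) list \<Rightarrow> 'a tensor3"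
  where "tens3 s u = {v. formal_cong (trilinear_rel s) u v}"

definition tensors :: "('k::field \<Rightarrow> 'a::ring_1 \<Rightarrow> 'a) \<Rightarrow> 'a tensor2 set"
  where "tensors s = range (tens s)"

text \<open>Sweedler notation: \<open>sw w\<close> is an arbitrarily chosen decomposition of \<open>w \<in> A \<otimes> A\<close> into pure
  tensors. It is only used inside expressions that are bilinear in the pair, hence independent of
  the choice (see \<open>sum_sw_tens\<close> and \<open>tensor_mult_tens\<close> below).\<close>

definition sw :: "'a tensor2 \<Rightarrow> ('a \<times> 'a) list"
  where "sw w = (SOME u. u \<in> w)"

definition lmult :: "('a \<times> 'a) list \<Rightarrow> ('a \<times> 'a) list \<Rightarrow> ('a::ring_1 \<times> 'a) list"
  where "lmult u v = [(a * c, b * d). (a, b) \<leftarrow> u, (c, d) \<leftarrow> v]"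

definition lneg :: "('a \<times> 'a) list \<Rightarrow> ('a::ring_1 \<times> 'a) list"
  where "lneg u = [(- a, b). (a, b) \<leftarrow> u]"

definition tensor_mult ::
  "('k::field \<Rightarrow> 'a::ring_1 \<Rightarrow> 'a) \<Rightarrow> 'a tensor2 \<Rightarrow> 'a tensor2 \<Rightarrow> 'a tensor2"
  where "tensor_mult s U V = tens s (lmult (sw U) (sw V))"

definition tensor_square_domain :: "('k::field \<Rightarrow> 'a::ring_1 \<Rightarrow> 'a) \<Rightarrow> bool"
  where "tensor_square_domain s \<longleftrightarrow>
    tens s [(1, 1)] \<noteq> tens s [] \<and>
    (\<forall>U\<in>tensors s. \<forall>V\<in>tensors s. tensor_mult s U V = tens s [] \<longrightarrow> U = tens s [] \<or> V = tens s [])"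

lemma tens_eq_iff: "tens s u = tens s v \<longleftrightarrow> formal_cong (bilinear_rel s) u v"
  unfolding tens_def
  by (auto intro: formal_cong.intros(2-4))

lemma tens3_eq_iff: "tens3 s u = tens3 s v \<longleftrightarrow> formal_cong (trilinear_rel s) u v"
  unfolding tens3_def
  by (auto intro: formal_cong.intros(2-4))

lemma sw_tens_cong: "formal_cong (bilinear_rel s) u (sw (tens s u))"
proof -
  have "u \<in> tens s u"
    by (simp add: tens_def formal_cong.refl)
  then have "sw (tens s u) \<in> tens s u"
    unfolding sw_def by (rule someI)
  then show ?thesis
    by (simp add: tens_def)
qed

lemma tens_sw: "w \<in> tensors s \<Longrightarrow> tens s (sw w) = w"
  unfolding tensors_def by (metis imageE sw_tens_cong tens_eq_iff)

lemma formal_cong_sum: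
  fixes \<phi> :: "'a::ring_1 \<Rightarrow> 'a \<Rightarrow> 'v::ab_group_add"
  assumes "formal_cong (bilinear_rel s) u v"
    and "\<And>a a' b. \<phi> (a + a') b = \<phi> a b + \<phi> a' b"
    and "\<And>a b b'. \<phi> a (b + b') = \<phi> a b + \<phi> a b'"
    and "\<And>c a b. \<phi> (s c a) b = \<phi> a (s c b)"
  shows "(\<Sum>(a, b)\<leftarrow>u. \<phi> a b) = (\<Sum>(a, b)\<leftarrow>v. \<phi> a b)"
  using assms(1)
proof induction
  case (base u v)
  have zero: "\<phi> 0 b = 0" for b
    using assms(2)[of 0 0 b] by simp
  from base show ?case
    by cases (simp_all add: assms zero)
qed (simp_all add: add.commute)

lemma sum_sw_tens:
  fixes \<phi> :: "'a::ring_1 \<Rightarrow> 'a \<Rightarrow> 'v::ab_group_add"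
  assumes "\<And>a a' b. \<phi> (a + a') b = \<phi> a b + \<phi> a' b"
    and "\<And>a b b'. \<phi> a (b + b') = \<phi> a b + \<phi> a b'"
    and "\<And>c a b. \<phi> (s c a) b = \<phi> a (s c b)"
  shows "(\<Sum>(a, b)\<leftarrow>sw (tens s u). \<phi> a b) = (\<Sum>(a, b)\<leftarrow>u. \<phi> a b)"
  using formal_cong_sum[OF sw_tens_cong, of \<phi> s u] assms by simp

lemma lmult_simps: "lmult [] v = []" "lmult (p # u) v = map (\<lambda>q. (fst p * fst q, snd p * snd q)) v @ lmult u v"
  by (auto simp: lmult_def split: prod.splits intro!: map_cong)

lemma formal_cong_map:
  assumes "formal_cong r u v" "\<And>u v. r u v \<Longrightarrow> formal_cong r' (concat (map f u)) (concat (map f v))"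
  shows "formal_cong r' (concat (map f u)) (concat (map f v))"
  using assms(1) by induction (auto intro: formal_cong.intros assms(2))

lemma (in k_algebra) lmult_cong_left:
  assumes "formal_cong (bilinear_rel s) u u'"
  shows "formal_cong (bilinear_rel s) (lmult u v) (lmult u' v)"
proof (induction v)
  case Nil
  have "lmult u [] = []" for u :: "('a \<times> 'a) list" by (simp add: lmult_def)
  then show ?case by (simp add: formal_cong.refl)
next
  case (Cons q v)
  have *: "formal_cong (bilinear_rel s) (lmult u (q # v)) (lmult u [q] @ lmult u v)" for u
  proof (induction u)
    case Nil show ?case by (simp add: lmult_simps formal_cong.refl)
  next
    case (Cons p u)
    let ?f = "\<lambda>q. (fst p * fst q, snd p * snd q)"
    have 1: "formal_cong (bilinear_rel s) ([?f q] @ map ?f v @ lmult u (q#v)) ([?f q] @ map ?f v @ lmult u [q] @ lmult u v)"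
      by (intro formal_cong.add formal_cong.refl Cons)
    have 2: "formal_cong (bilinear_rel s) ([?f q] @ map ?f v @ lmult u [q] @ lmult u v) ([?f q] @ (lmult u [q] @ map ?f v) @ lmult u v)"
      using formal_cong.add[OF formal_cong.refl formal_cong.add[OF formal_cong.comm formal_cong.refl],
          of "bilinear_rel s" "[?f q]" "map ?f v" "lmult u [q]" "lmult u v"] by simp
    show ?case using formal_cong.trans[OF 1 2] by (simp add: lmult_simps)
  qed
  have "formal_cong (bilinear_rel s) (lmult u [q]) (lmult u' [q])"
  proof -
    have l: "lmult u [q] = concat (map (\<lambda>p. [(fst p * fst q, snd p * snd q)]) u)" for u
      unfolding lmult_def by (induction u) (auto simp: split_beta)
    show ?thesis unfolding l
    proof (rule formal_cong_map[OF assms])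
      fix u v assume "bilinear_rel s u v"
      then show "formal_cong (bilinear_rel s) (concat (map (\<lambda>p. [(fst p * fst q, snd p * snd q)]) u))
        (concat (map (\<lambda>p. [(fst p * fst q, snd p * snd q)]) v))"
        by cases (auto simp: distrib_right scale_mult_left intro: formal_cong.base bilinear_rel.intros)
    qed
  qed
  then have "formal_cong (bilinear_rel s) (lmult u [q] @ lmult u v) (lmult u' [q] @ lmult u' v)"
    by (intro formal_cong.add Cons)
  then show ?case using * by (meson formal_cong.trans formal_cong.sym)
qed

lemma (in k_algebra) lmult_cong_right:
  assumes "formal_cong (bilinear_rel s) v v'"
  shows "formal_cong (bilinear_rel s) (lmult u v) (lmult u v')"
proof (induction u)
  case Nil then show ?case by (simp add: lmult_simps formal_cong.refl)
next
  case (Cons p u)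
  have l: "map (\<lambda>q. (fst p * fst q, snd p * snd q)) v = concat (map (\<lambda>q. [(fst p * fst q, snd p * snd q)]) v)" for v by simp
  have "formal_cong (bilinear_rel s) (map (\<lambda>q. (fst p * fst q, snd p * snd q)) v) (map (\<lambda>q. (fst p * fst q, snd p * snd q)) v')"
    unfolding l
  proof (rule formal_cong_map[OF assms])
      fix u v assume "bilinear_rel s u v"
      then show "formal_cong (bilinear_rel s) (concat (map (\<lambda>q. [(fst p * fst q, snd p * snd q)]) u))
        (concat (map (\<lambda>q. [(fst p * fst q, snd p * snd q)]) v))"
        by cases (auto simp: distrib_left scale_mult_right intro: formal_cong.base bilinear_rel.intros)
  qed
  then show ?case unfolding lmult_simps by (intro formal_cong.add Cons)
qed

lemma (in k_algebra) tensor_mult_tens: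
  "tensor_mult s (tens s u) (tens s v) = tens s (lmult u v)"
  unfolding tensor_mult_def tens_eq_iff
  by (meson formal_cong.sym formal_cong.trans lmult_cong_left lmult_cong_right sw_tens_cong)


section \<open>Hopf algebras\<close>

locale hopf_algebra = k_algebra s
  for s :: "'k::field \<Rightarrow> 'a::ring_1 \<Rightarrow> 'a"
    and \<Delta> :: "'a \<Rightarrow> 'a tensor2"
    and \<epsilon> :: "'a \<Rightarrow> 'k"
    and S :: "'a \<Rightarrow> 'a" +
  assumes comult_closed: "\<Delta> a \<in> tensors s"
    and comult_add: "\<Delta> (a + b) = tens s (sw (\<Delta> a) @ sw (\<Delta> b))"
    and comult_scale: "\<Delta> (s c a) = tens s [(s c p, q). (p, q) \<leftarrow> sw (\<Delta> a)]"
    and comult_mult: "\<Delta> (a * b) = tensor_mult s (\<Delta> a) (\<Delta> b)"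
    and comult_one: "\<Delta> 1 = tens s [(1, 1)]"
    and counit_hom: "algebra_hom s (*) \<epsilon>"
    and coassoc: "tens3 s [(p, q, b). (a, b) \<leftarrow> sw (\<Delta> r), (p, q) \<leftarrow> sw (\<Delta> a)]
      = tens3 s [(a, p, q). (a, b) \<leftarrow> sw (\<Delta> r), (p, q) \<leftarrow> sw (\<Delta> b)]"
    and counit_left: "(\<Sum>(a, b)\<leftarrow>sw (\<Delta> r). s (\<epsilon> a) b) = r"
    and counit_right: "(\<Sum>(a, b)\<leftarrow>sw (\<Delta> r). s (\<epsilon> b) a) = r"
    and antipode_linear: "Vector_Spaces.linear s s S"
    and antipode_left: "(\<Sum>(a, b)\<leftarrow>sw (\<Delta> r). S a * b) = s (\<epsilon> r) 1"
    and antipode_right: "(\<Sum>(a, b)\<leftarrow>sw (\<Delta> r). a * S b) = s (\<epsilon> r) 1"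

definition grouplike ::
  "('k::field \<Rightarrow> 'a::ring_1 \<Rightarrow> 'a) \<Rightarrow> ('a \<Rightarrow> 'a tensor2) \<Rightarrow> ('a \<Rightarrow> 'k) \<Rightarrow> 'a \<Rightarrow> bool"
  where "grouplike s \<Delta> \<epsilon> g \<longleftrightarrow> \<Delta> g = tens s [(g, g)] \<and> \<epsilon> g = 1"

text \<open>\<open>\<iota>\<close> identifies the Hopf algebra \<open>(sR, \<Delta>, \<epsilon>, S)\<close> with a Hopf subalgebra of
  \<open>(sT, \<Delta>T, \<epsilon>T, ST)\<close>; that \<open>\<iota>\<close> is an injective algebra homomorphism is part of
  \<open>ore_extension\<close> below.\<close>

definition hopf_extends where
  "hopf_extends \<iota> \<Delta> \<epsilon> S sT \<Delta>T \<epsilon>T ST \<longleftrightarrow>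
    hopf_algebra sT \<Delta>T \<epsilon>T ST \<and>
    (\<forall>r. \<Delta>T (\<iota> r) = tens sT (map (map_prod \<iota> \<iota>) (sw (\<Delta> r))) \<and>
         \<epsilon>T (\<iota> r) = \<epsilon> r \<and>
         ST (\<iota> r) = \<iota> (S r))"


section \<open>Ore extensions\<close>

text \<open>\<open>T = R[x; \<sigma>, \<delta>]\<close>, with \<open>R\<close> embedded in \<open>T\<close> by \<open>\<iota>\<close>. The last clause says that \<open>T\<close> is free as a
  left \<open>R\<close>-module on the powers of \<open>x\<close>; the type \<open>'r poly\<close> only serves as the type of finitely
  supported coefficient sequences, its multiplication plays no role.\<close>

definition ore_extension ::
  "('k::field \<Rightarrow> 'r::ring_1 \<Rightarrow> 'r) \<Rightarrow> ('k \<Rightarrow> 't::ring_1 \<Rightarrow> 't) \<Rightarrow> ('r \<Rightarrow> 't) \<Rightarrow>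
    't \<Rightarrow> ('r \<Rightarrow> 'r) \<Rightarrow> ('r \<Rightarrow> 'r) \<Rightarrow> bool"
  where "ore_extension sR sT \<iota> x \<sigma> \<delta> \<longleftrightarrow>
    k_algebra sT \<and> algebra_hom sR sT \<iota> \<and> inj \<iota> \<and>
    algebra_aut sR \<sigma> \<and> skew_derivation sR \<sigma> \<delta> \<and>
    (\<forall>r. x * \<iota> r = \<iota> (\<sigma> r) * x + \<iota> (\<delta> r)) \<and>
    (\<forall>t. \<exists>!p :: 'r poly. t = (\<Sum>i\<le>degree p. \<iota> (poly.coeff p i) * x ^ i))"

text \<open>The conditions on \<open>\<beta>\<close>, \<open>w\<close>, \<open>\<chi>\<close>, \<open>\<sigma>\<close>, \<open>\<delta>\<close> that only involve \<open>R\<close>.\<close>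

definition hopf_ore_data ::
  "('k::field \<Rightarrow> 'r::ring_1 \<Rightarrow> 'r) \<Rightarrow> ('r \<Rightarrow> 'r tensor2) \<Rightarrow> ('r \<Rightarrow> 'k) \<Rightarrow> ('r \<Rightarrow> 'r) \<Rightarrow>
    ('r \<Rightarrow> 'r) \<Rightarrow> ('r \<Rightarrow> 'r) \<Rightarrow> 'r \<Rightarrow> 'r tensor2 \<Rightarrow> ('r \<Rightarrow> 'k) \<Rightarrow> bool"
  where "hopf_ore_data s \<Delta> \<epsilon> S \<sigma> \<delta> \<beta> w \<chi> \<longleftrightarrow>
    grouplike s \<Delta> \<epsilon> \<beta> \<and> w \<in> tensors s \<and>
    \<beta> * (\<Sum>(a, b)\<leftarrow>sw w. a * S b) = (\<Sum>(a, b)\<leftarrow>sw w. S a * b) \<and>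
    character s \<chi> \<and>
    (\<forall>r. \<sigma> r = (\<Sum>(a, b)\<leftarrow>sw (\<Delta> r). s (\<chi> a) b)) \<and>
    (\<forall>r. \<sigma> r = (\<Sum>(a, b)\<leftarrow>sw (\<Delta> r). s (\<chi> b) (ring_inv \<beta> * a * \<beta>))) \<and>
    (\<forall>r. tens s
        (sw (\<Delta> (\<delta> r))
         @ lneg [(\<delta> a, b). (a, b) \<leftarrow> sw (\<Delta> r)]
         @ lneg [(ring_inv \<beta> * a, \<delta> b). (a, b) \<leftarrow> sw (\<Delta> r)]
         @ lneg (lmult (sw w) (sw (\<Delta> r)))
         @ lmult (sw (\<Delta> (\<sigma> r))) (sw w)) = tens s []) \<and>
    tens3 s ([(a, b, 1). (a, b) \<leftarrow> sw w]
         @ [(p, q, b). (a, b) \<leftarrow> sw w, (p, q) \<leftarrow> sw (\<Delta> a)])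
      = tens3 s ([(ring_inv \<beta>, a, b). (a, b) \<leftarrow> sw w]
         @ [(a, p, q). (a, b) \<leftarrow> sw w, (p, q) \<leftarrow> sw (\<Delta> b)])"

text \<open>The elements \<open>\<beta>\<^sup>-\<^sup>1 \<otimes> x + x \<otimes> 1 + w\<close> of \<open>T \<otimes> T\<close> and \<open>- \<beta> (x + \<Sum> w\<^sub>1 S(w\<^sub>2))\<close> of \<open>T\<close>.\<close>

definition ore_comult where
  "ore_comult sT \<iota> x \<beta> w =
    tens sT ([(\<iota> (ring_inv \<beta>), x), (x, 1)] @ map (map_prod \<iota> \<iota>) (sw w))"

definition ore_antipode where
  "ore_antipode \<iota> S x \<beta> w = - \<iota> \<beta> * (x + \<iota> (\<Sum>(a, b)\<leftarrow>sw w. a * S b))"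

end

theory Submission
  imports Defs "HOL-Library.Poly_Mapping"
begin

text \<open>Write \<open>\<Delta>(x)\<close> as a sum of terms \<open>w\<^sub>i\<^sub>j (x\<^sup>i \<otimes> x\<^sup>j)\<close> with \<open>w\<^sub>i\<^sub>j \<in> R \<otimes> R\<close>. As \<open>R \<otimes> R\<close> is a domain,
  leading coefficients in \<open>T \<otimes> T\<close> multiply up to a twist by \<open>\<sigma>\<close>, and coassociativity bounds both
  degrees by 1, so \<open>\<Delta>(x) = w + a (1 \<otimes> x) + b (x \<otimes> 1) + c (x \<otimes> x)\<close>. Normalise \<open>\<epsilon>(x) = 0\<close>. Contracting
  the coassociativity law with the functional that applies \<open>\<epsilon>\<close> to the coefficient of \<open>x\<close> gives relations
  between \<open>a, b, c, w\<close>. If \<open>c \<noteq> 0\<close>, they produce an element \<open>y = \<gamma> x + p\<close>, \<open>\<gamma> \<noteq> 0\<close>, with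
  \<open>\<gamma> \<Delta>(y) = c (y \<otimes> y)\<close>, and the antipode makes \<open>y\<close> left invertible, which is impossible in degree 1.
  If \<open>c = 0\<close>, then \<open>a' = (I \<otimes> \<epsilon>)(a)\<close> and \<open>b' = (\<epsilon> \<otimes> I)(b)\<close> are units, \<open>\<beta> = a'\<^sup>-\<^sup>1 b'\<close> is grouplike, and
  \<open>b'\<^sup>-\<^sup>1 x\<close> is the new variable; its data are read off by comparing coefficients.

  Conversely, the universal property of \<open>T\<close> extends \<open>\<Delta>\<close>, \<open>\<epsilon>\<close> and \<open>S\<close> from \<open>R\<close>, with
  \<open>\<epsilon>(x) = - (\<epsilon> \<otimes> \<epsilon>)(w)\<close>, and each Hopf axiom holds on a subalgebra that contains \<open>R\<close> and \<open>x\<close>.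
  Identities in triple tensor products are tested by applying linear functionals to the first factor.\<close>

section \<open>The ring of additive endomorphisms\<close>

text \<open>The functional \<open>f\<^sub>1\<close> (apply \<epsilon> to the coefficient of x)
  vanishes on R, so contracting \<Delta>(x) with it removes one x and leaves an element p + q x,
  whose coproduct is known again. This is why coassociativity closes up into finitely many relations
  between four coefficients in R \<otimes> R. The domain hypothesis is also used inside R, which
  embeds by a \<mapsto> a \<otimes> 1: it makes left inverses two-sided and degrees in T additive.
  In the converse the antipode is the obstacle. The right antipode axiom at x determines S(x); that
  S then respects the Ore relation, and that the left axiom holds too, has to be extracted from the
  conditions. The latter rests on \<kappa> \<beta> = \<kappa> with \<kappa> = (\<epsilon> \<otimes>
  \<epsilon>)(w). The conditions do not force \<kappa> = 0: for \<sigma> = I, \<delta> = 0, \<beta>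
  = 1 and w = \<kappa> (1 \<otimes> 1) they hold, but \<epsilon>(x) = -\<kappa> and S(x) = -x -
  2\<kappa>, whereas the prescribed value is -x - \<kappa>. Hence the formula for S(x) is tied to
  \<epsilon>(x) = 0 in that direction.\<close>

typedef (overloaded) 'm endo = "{f :: 'm::ab_group_add \<Rightarrow> 'm. \<forall>x y. f (x + y) = f x + f y}"
  morphisms app Endo
  by (rule exI[of _ "\<lambda>x. 0"]) simp

setup_lifting type_definition_endo

lemma app_add: "app f (x + y) = app f x + app f y"
  using app[of f] by simp

lemma app_zero: "app f 0 = 0"
  using app_add[of f 0 0] by simp

instantiation endo :: (ab_group_add) ring
begin
lift_definition zero_endo :: "'a endo" is "\<lambda>x. 0" by simp
lift_definition plus_endo :: "'a endo \<Rightarrow> 'a endo \<Rightarrow> 'a endo" is "\<lambda>f g x. f x + g x"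
  by (simp add: algebra_simps)
lift_definition minus_endo :: "'a endo \<Rightarrow> 'a endo \<Rightarrow> 'a endo" is "\<lambda>f g x. f x - g x"
  by (simp add: algebra_simps)
lift_definition uminus_endo :: "'a endo \<Rightarrow> 'a endo" is "\<lambda>f x. - f x"
  by (simp add: algebra_simps)
lift_definition times_endo :: "'a endo \<Rightarrow> 'a endo \<Rightarrow> 'a endo" is "\<lambda>f g x. f (g x)"
  by simp
instance
  by (standard; transfer; simp add: fun_eq_iff algebra_simps)
end

lemmas app_simps = zero_endo.rep_eq plus_endo.rep_eq minus_endo.rep_eq uminus_endo.rep_eq times_endo.rep_eq

lemma app_sum: "app f (\<Sum>i\<in>I. x i) = (\<Sum>i\<in>I. app f (x i))"
  by (induction I rule: infinite_finite_induct) (simp_all add: app_zero app_add)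

section \<open>A faithful model of the tensor square\<close>

definition bilin :: "('k::field \<Rightarrow> 'a::ring_1 \<Rightarrow> 'a) \<Rightarrow> ('a \<Rightarrow> 'a \<Rightarrow> 'v::ab_group_add) \<Rightarrow> bool"
  where "bilin s \<phi> \<longleftrightarrow> (\<forall>a a' b. \<phi> (a + a') b = \<phi> a b + \<phi> a' b) \<and>
    (\<forall>a b b'. \<phi> a (b + b') = \<phi> a b + \<phi> a b') \<and> (\<forall>c a b. \<phi> (s c a) b = \<phi> a (s c b))"

lemma bilinI:
  assumes "\<And>a a' b. \<phi> (a + a') b = \<phi> a b + \<phi> a' b"
    and "\<And>a b b'. \<phi> a (b + b') = \<phi> a b + \<phi> a b'"
    and "\<And>c a b. \<phi> (s c a) b = \<phi> a (s c b)"
  shows "bilin s \<phi>"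
  using assms by (simp add: bilin_def)

lemma bilinD:
  assumes "bilin s \<phi>"
  shows "\<phi> (a + a') b = \<phi> a b + \<phi> a' b" "\<phi> a (b + b') = \<phi> a b + \<phi> a b'" "\<phi> (s c a) b = \<phi> a (s c b)"
  using assms by (simp_all add: bilin_def)

lemma bilin_zero_right: "bilin s \<phi> \<Longrightarrow> \<phi> a 0 = 0"
  using bilinD(2)[of s \<phi> a 0 0] by simp

lemma bilin_zero_left: "bilin s \<phi> \<Longrightarrow> \<phi> 0 b = 0"
  using bilinD(1)[of s \<phi> 0 0 b] by simp

lemma bilin_sum_left: "bilin s \<phi> \<Longrightarrow> \<phi> (\<Sum>i\<in>I. f i) b = (\<Sum>i\<in>I. \<phi> (f i) b)"
  by (induction I rule: infinite_finite_induct) (simp_all add: bilin_zero_left, simp add: bilin_def)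

context k_algebra
begin

lemmas scale_distrib = scale_left_distrib scale_right_distrib
lemmas scale_mult = scale_mult_left scale_mult_right

text \<open>Extending the empty set yields one arbitrary but fixed basis. Only first tensor factors
  are ever expanded in it.\<close>

definition crd :: "'a \<Rightarrow> 'a \<Rightarrow> 'k"
  where "crd a q = representation (extend_basis {}) a q"

lemma extend_basis_empty: "independent (extend_basis {})" "span (extend_basis {}) = UNIV"
  using independent_extend_basis[of "{}"] span_extend_basis[of "{}"] by (auto simp: independent_empty)

lemma crd_add: "crd (a + b) q = crd a q + crd b q"
  unfolding crd_def by (subst representation_add) (auto simp: extend_basis_empty)

lemma crd_scale: "crd (s c a) q = c * crd a q"
  unfolding crd_def by (subst representation_scale) (auto simp: extend_basis_empty)

lemma finite_crd: "finite {q. crd a q \<noteq> 0}"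
  unfolding crd_def by (rule finite_representation)

lemma crd_expand: "(\<Sum>q | crd a q \<noteq> 0. s (crd a q) q) = a"
  unfolding crd_def by (rule sum_nonzero_representation_eq) (auto simp: extend_basis_empty)

lemma linear_crd: "Vector_Spaces.linear s (*) (\<lambda>a. crd a q)"
  unfolding crd_def by (rule linear_representation) (auto simp: extend_basis_empty)

text \<open>Choosing a basis of the first factor makes A \<otimes> A a direct sum of copies of A;
  this is the family that represents a \<otimes> b.\<close>

definition crdt :: "'a \<Rightarrow> 'a \<Rightarrow> 'a \<Rightarrow>\<^sub>0 'a"
  where "crdt a b = Abs_poly_mapping (\<lambda>q. s (crd a q) b)"

lemma lookup_crdt: "Poly_Mapping.lookup (crdt a b) q = s (crd a q) b"
proof -
  have "finite {q. s (crd a q) b \<noteq> 0}"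
    by (rule finite_subset[OF _ finite_crd[of a]]) auto
  then show ?thesis by (simp add: crdt_def)
qed

lemma crdt_bilin:
  "crdt (a + a') b = crdt a b + crdt a' b"
  "crdt a (b + b') = crdt a b + crdt a b'"
  "crdt (s c a) b = crdt a (s c b)"
  by (simp_all add: poly_mapping_eq_iff fun_eq_iff lookup_crdt lookup_add crd_add crd_scale
      scale_distrib mult.commute)

text \<open>Balancedness moves the coordinates of a back to the first argument, where they
  reassemble a. The sum may run over a smaller set than the support of a, because coordinates times
  b can vanish.\<close>

lemma sum_keys_crdt:
  assumes "bilin s \<phi>"
  shows "(\<Sum>p\<in>Poly_Mapping.keys (crdt a b). \<phi> p (Poly_Mapping.lookup (crdt a b) p)) = \<phi> a b"
proof -
  have "(\<Sum>p\<in>Poly_Mapping.keys (crdt a b). \<phi> p (Poly_Mapping.lookup (crdt a b) p)) = (\<Sum>p | crd a p \<noteq> 0. \<phi> p (Poly_Mapping.lookup (crdt a b) p))"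
    by (rule sum.mono_neutral_left)
      (auto simp: finite_crd in_keys_iff lookup_crdt bilin_zero_right[OF assms])
  also have "\<dots> = (\<Sum>p | crd a p \<noteq> 0. \<phi> (s (crd a p) p) b)"
    using assms by (intro sum.cong) (auto simp: lookup_crdt bilin_def)
  also have "\<dots> = \<phi> (\<Sum>p | crd a p \<noteq> 0. s (crd a p) p) b"
    by (simp add: bilin_sum_left[OF assms])
  finally show ?thesis by (simp add: crd_expand)
qed

definition contract :: "('a \<Rightarrow> 'a \<Rightarrow> 'v::ab_group_add) \<Rightarrow> ('a \<Rightarrow>\<^sub>0 'a) \<Rightarrow> 'v"
  where "contract \<phi> m = (\<Sum>p\<in>Poly_Mapping.keys m. \<phi> p (Poly_Mapping.lookup m p))"

lemma contract_crdt: "bilin s \<phi> \<Longrightarrow> contract \<phi> (crdt a b) = \<phi> a b"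
  by (simp add: contract_def sum_keys_crdt)

lemma contract_add: "bilin s \<phi> \<Longrightarrow> contract \<phi> (m + n) = contract \<phi> m + contract \<phi> n"
  unfolding contract_def
  by (rule setsum_keys_plus_distrib) (simp_all add: bilin_zero_right bilinD)

lemma bilin_pure_aux: "bilin s (\<lambda>p y. crdt (a * p) (b * y))"
  by (rule bilinI) (simp_all add: crdt_bilin distrib_left scale_mult_right)

text \<open>The pure tensor \<open>a \<otimes> b\<close>, acting by left multiplication on \<open>A \<otimes> A\<close>, where \<open>p \<otimes> y\<close> with \<open>p\<close> in
  a fixed basis is \<open>single p y\<close>. Basing the model on endomorphisms makes its multiplication a class
  operation, although the tensor product depends on \<open>s\<close>.\<close>

definition pure :: "'a \<Rightarrow> 'a \<Rightarrow> ('a \<Rightarrow>\<^sub>0 'a) endo"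
  where "pure a b = Endo (contract (\<lambda>p y. crdt (a * p) (b * y)))"

lemma app_pure: "app (pure a b) = contract (\<lambda>p y. crdt (a * p) (b * y))"
  unfolding pure_def by (rule Endo_inverse) (simp add: contract_add bilin_pure_aux)

lemma pure_eqI: "(\<And>m. app U m = app V m) \<Longrightarrow> U = V"
  by (metis app_inject ext)

lemma pure_add_left: "pure (a + a') b = pure a b + pure a' b"
  by (rule pure_eqI)
    (simp add: app_pure app_simps contract_def distrib_right crdt_bilin sum.distrib)

lemma pure_add_right: "pure a (b + b') = pure a b + pure a b'"
  by (rule pure_eqI)
    (simp add: app_pure app_simps contract_def distrib_right crdt_bilin sum.distrib)

lemmas pure_add = pure_add_left pure_add_right

lemma pure_scale: "pure (s c a) b = pure a (s c b)"
  by (rule pure_eqI) (simp add: app_pure contract_def scale_mult_left crdt_bilin)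

lemma pure_mult: "pure a b * pure c d = pure (a * c) (b * d)"
proof (rule pure_eqI)
  fix m
  have "app (pure a b) (crdt p y) = crdt (a * p) (b * y)" for p y
    unfolding app_pure by (rule contract_crdt[OF bilin_pure_aux])
  then show "app (pure a b * pure c d) m = app (pure (a * c) (b * d)) m"
    by (simp add: app_simps app_pure[of c d] app_pure[of "a * c"] contract_def app_sum mult.assoc)
qed

lemma bilin_pure: "bilin s pure"
  by (rule bilinI) (simp_all add: pure_add pure_scale)

lemma pure_zero [simp]: "pure 0 b = 0" "pure a 0 = 0"
  using bilin_zero_left[OF bilin_pure] bilin_zero_right[OF bilin_pure] by auto

lemma pure_minus_left: "pure (- a) b = - pure a b"
  using pure_add_left[of "- a" a b] by (simp add: eq_neg_iff_add_eq_0)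

text \<open>A left multiplication is recovered from its value at 1 \<otimes> 1, so this is the
  linear map on A \<otimes> A induced by a bilinear \<phi>.\<close>

definition lift :: "('a \<Rightarrow> 'a \<Rightarrow> 'v::ab_group_add) \<Rightarrow> ('a \<Rightarrow>\<^sub>0 'a) endo \<Rightarrow> 'v"
  where "lift \<phi> U = contract \<phi> (app U (crdt 1 1))"

lemma lift_pure: "bilin s \<phi> \<Longrightarrow> lift \<phi> (pure a b) = \<phi> a b"
  by (simp add: lift_def app_pure contract_crdt bilin_pure_aux)

lemma lift_add: "bilin s \<phi> \<Longrightarrow> lift \<phi> (U + V) = lift \<phi> U + lift \<phi> V"
  by (simp add: lift_def app_simps contract_add)

lemma lift_zero [simp]: "lift \<phi> 0 = 0"
  by (simp add: lift_def app_simps contract_def)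

lemma lift_sum: "bilin s \<phi> \<Longrightarrow> lift \<phi> (\<Sum>i\<in>I. U i) = (\<Sum>i\<in>I. lift \<phi> (U i))"
  by (induction I rule: infinite_finite_induct) (simp_all add: lift_add)

definition total :: "('a \<times> 'a) list \<Rightarrow> ('a \<Rightarrow>\<^sub>0 'a) endo"
  where "total u = (\<Sum>(a, b)\<leftarrow>u. pure a b)"

lemma total_simps [simp]: "total [] = 0" "total (p # u) = pure (fst p) (snd p) + total u"
  "total (u @ v) = total u + total v"
  by (simp_all add: total_def split_beta)

lemma lift_total: "bilin s \<phi> \<Longrightarrow> lift \<phi> (total u) = (\<Sum>(a, b)\<leftarrow>u. \<phi> a b)"
  by (induction u) (auto simp: lift_add lift_pure)

lemma total_lmult: "total (lmult u v) = total u * total v"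
proof (induction u)
  case (Cons p u)
  have "total (map (\<lambda>q. (fst p * fst q, snd p * snd q)) v) = pure (fst p) (snd p) * total v"
    by (induction v) (simp_all add: pure_mult distrib_left)
  with Cons show ?case by (simp add: lmult_simps distrib_right)
qed (simp add: lmult_simps)

lemma total_lneg: "total (lneg u) = - total u"
  unfolding lneg_def by (induction u) (auto simp: pure_minus_left)

lemma total_cong: "formal_cong (bilinear_rel s) u v \<Longrightarrow> total u = total v"
  unfolding total_def
  by (erule formal_cong_sum) (simp_all add: pure_add pure_scale)

end

section \<open>Formal sums are separated by functionals on the first factor\<close>

declare formal_cong.trans [trans]

lemma formal_cong_snoc_swap: "formal_cong r (u @ v @ w) (v @ u @ w)"
  using formal_cong.add[OF formal_cong.comm formal_cong.refl, of r u v w] by simp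

lemma formal_cong_concat_append:
  "formal_cong r (concat (map f ps) @ concat (map g ps)) (concat (map (\<lambda>p. f p @ g p) ps))"
proof (induction ps)
  case (Cons p ps)
  have "formal_cong r (f p @ concat (map f ps) @ g p @ concat (map g ps))
     (f p @ g p @ concat (map f ps) @ concat (map g ps))"
    by (intro formal_cong.add formal_cong.refl formal_cong_snoc_swap)
  also have "formal_cong r \<dots> (f p @ g p @ concat (map (\<lambda>p. f p @ g p) ps))"
    by (intro formal_cong.add formal_cong.refl Cons)
  finally show ?case by simp
qed (simp add: formal_cong.refl)

lemma formal_cong_concat:
  assumes "\<And>p. p \<in> set ps \<Longrightarrow> formal_cong r (f p) (g p)"
  shows "formal_cong r (concat (map f ps)) (concat (map g ps))"
  using assms by (induction ps) (auto intro: formal_cong.refl formal_cong.add)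

text \<open>Linear functionals applied to the first factor separate formal sums: grouping a formal sum
  along a basis of the first factor, the coefficient at each basis element is such a slice.\<close>

locale slicing = k_algebra s for s :: "'k::field \<Rightarrow> 'a::ring_1 \<Rightarrow> 'a" +
  fixes rel :: "('a \<times> 'y) list \<Rightarrow> ('a \<times> 'y) list \<Rightarrow> bool" and sc :: "'k \<Rightarrow> 'y \<Rightarrow> 'y"
  assumes rel_add: "formal_cong rel [(a + a', y)] [(a, y), (a', y)]"
    and rel_scale: "formal_cong rel [(s c a, y)] [(a, sc c y)]"
    and rel_zero: "formal_cong rel [(0, y)] []"
begin

lemma expand_aux: "formal_cong rel [(\<Sum>p\<leftarrow>ps. s (f p) p, y)] (map (\<lambda>p. (p, sc (f p) y)) ps)"
proof (induction ps)
  case (Cons p ps)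
  have "formal_cong rel [(s (f p) p + (\<Sum>p\<leftarrow>ps. s (f p) p), y)] ([(s (f p) p, y)] @ [(\<Sum>p\<leftarrow>ps. s (f p) p, y)])"
    using rel_add by simp
  also have "formal_cong rel \<dots> ([(p, sc (f p) y)] @ map (\<lambda>p. (p, sc (f p) y)) ps)"
    by (intro formal_cong.add rel_scale Cons)
  finally show ?case by simp
qed (simp add: rel_zero)

lemma expand_single:
  assumes "{q. crd a q \<noteq> 0} \<subseteq> set ps" "distinct ps"
  shows "formal_cong rel [(a, y)] (map (\<lambda>p. (p, sc (crd a p) y)) ps)"
proof -
  have "(\<Sum>p\<leftarrow>ps. s (crd a p) p) = (\<Sum>p\<in>set ps. s (crd a p) p)"
    using assms(2) by (simp add: sum_list_distinct_conv_sum_set)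
  also have "\<dots> = (\<Sum>q | crd a q \<noteq> 0. s (crd a q) q)"
    using assms(1) by (intro sum.mono_neutral_right) auto
  finally show ?thesis using expand_aux[where f = "crd a" and ps = ps and y = y] by (simp add: crd_expand)
qed

definition slice :: "'a \<Rightarrow> ('a \<times> 'y) list \<Rightarrow> 'y list"
  where "slice p u = map (\<lambda>(a, y). sc (crd a p) y) u"

lemma expand_list:
  assumes "(\<Union>a\<in>fst ` set u. {q. crd a q \<noteq> 0}) \<subseteq> set ps" "distinct ps"
  shows "formal_cong rel u (concat (map (\<lambda>p. map (Pair p) (slice p u)) ps))"
  using assms(1)
proof (induction u)
  case Nil
  have "concat (map (\<lambda>p. map (Pair p) (slice p [])) ps) = []" by (simp add: slice_def)
  then show ?case by (simp only: formal_cong.refl)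
next
  case (Cons z u)
  obtain a y where z: "z = (a, y)" by force
  have "formal_cong rel ([(a, y)] @ u)
      (map (\<lambda>p. (p, sc (crd a p) y)) ps @ concat (map (\<lambda>p. map (Pair p) (slice p u)) ps))"
    using Cons z by (intro formal_cong.add expand_single assms) auto
  also have "map (\<lambda>p. (p, sc (crd a p) y)) ps = concat (map (\<lambda>p. [(p, sc (crd a p) y)]) ps)"
    by simp
  also have "formal_cong rel (\<dots> @ concat (map (\<lambda>p. map (Pair p) (slice p u)) ps))
      (concat (map (\<lambda>p. [(p, sc (crd a p) y)] @ map (Pair p) (slice p u)) ps))"
    by (rule formal_cong_concat_append)
  finally show ?case by (simp add: slice_def z)
qed

lemma cong_if_slices:
  assumes "\<And>p. formal_cong rel (map (Pair p) (slice p u)) (map (Pair p) (slice p v))"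
  shows "formal_cong rel u v"
proof -
  \<comment> \<open>Both sums must be expanded along the same list of basis elements, so the
    supports are joined.\<close>
  have "finite (\<Union>a\<in>fst ` set (u @ v). {q. crd a q \<noteq> 0})"
    using finite_crd by auto
  from finite_distinct_list[OF this]
  obtain ps where ps: "set ps = (\<Union>a\<in>fst ` set (u @ v). {q. crd a q \<noteq> 0})" "distinct ps"
    by (elim exE conjE)
  have sub: "(\<Union>a\<in>fst ` set w. {q. crd a q \<noteq> 0}) \<subseteq> set ps" if "set w \<subseteq> set (u @ v)" for w
    unfolding ps(1) using that by blast
  define E where "E w = concat (map (\<lambda>p. map (Pair p) (slice p w)) ps)" for w
  have u: "formal_cong rel u (E u)" and v: "formal_cong rel v (E v)"
    unfolding E_def by (rule expand_list[OF sub ps(2)], simp)+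
  have "formal_cong rel (E u) (E v)"
    unfolding E_def by (intro formal_cong_concat assms)
  then show ?thesis
    using u v by (meson formal_cong.trans formal_cong.sym)
qed

end

context k_algebra
begin

lemma slicing2: "slicing s (bilinear_rel s) s"
proof
  show "formal_cong (bilinear_rel s) [(a + a', y)] [(a, y), (a', y)]" for a a' y
    by (rule formal_cong.base, rule bilinear_rel.intros(1))
  show "formal_cong (bilinear_rel s) [(s c a, y)] [(a, s c y)]" for c a y
    by (rule formal_cong.base, rule bilinear_rel.intros(3))
  show "formal_cong (bilinear_rel s) [(0, y)] []" for y
    by (rule formal_cong.base, rule bilinear_rel.intros(4))
qed

lemma cong2_pair_sum_list: "formal_cong (bilinear_rel s) (map (Pair p) ys) [(p, sum_list ys)]"
proof (induction ys)
  case Nil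
  \<comment> \<open>Only a zero in the first entry is a generating relation; a zero in the second is
    reached by moving the scalar 0 across.\<close>
  have "formal_cong (bilinear_rel s) [(p, s 0 0)] [(s 0 p, 0)]"
    by (intro formal_cong.sym[OF formal_cong.base] bilinear_rel.intros)
  also have "formal_cong (bilinear_rel s) \<dots> []"
    by (intro formal_cong.base) (use bilinear_rel.intros(4)[of s 0] in simp)
  finally show ?case by (simp add: formal_cong.sym)
next
  case (Cons y ys)
  have "formal_cong (bilinear_rel s) ([(p, y)] @ map (Pair p) ys) ([(p, y)] @ [(p, sum_list ys)])"
    by (intro formal_cong.add formal_cong.refl Cons)
  also have "formal_cong (bilinear_rel s) \<dots> [(p, y + sum_list ys)]"
    by simp (rule formal_cong.sym, rule formal_cong.base, rule bilinear_rel.intros(2))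
  finally show ?case by simp
qed

lemma linearD:
  assumes "Vector_Spaces.linear s t f"
  shows "f (a + b) = f a + f b" "f (s c a) = t c (f a)"
  using assms by (simp_all add: Vector_Spaces.linear_def module_hom_def module_hom_axioms_def)

lemma bilin_slice:
  assumes "Vector_Spaces.linear s (*) f"
  shows "bilin s (\<lambda>a b. s (f a) b)"
  by (rule bilinI) (simp_all add: linearD[OF assms] scale_distrib mult.commute)

lemma cong2_if_slices:
  assumes "\<And>f. Vector_Spaces.linear s (*) f \<Longrightarrow> (\<Sum>(a, b)\<leftarrow>u. s (f a) b) = (\<Sum>(a, b)\<leftarrow>v. s (f a) b)"
  shows "formal_cong (bilinear_rel s) u v"
proof -
  interpret slicing s "bilinear_rel s" s by (rule slicing2)
  show ?thesis
  proof (rule cong_if_slices)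
    fix p
    have "sum_list (slice p u) = sum_list (slice p v)"
      using assms[OF linear_crd[of p]] by (simp add: slice_def split_beta)
    then show "formal_cong (bilinear_rel s) (map (Pair p) (slice p u)) (map (Pair p) (slice p v))"
      using cong2_pair_sum_list[of p "slice p u"] cong2_pair_sum_list[of p "slice p v"]
      by (metis formal_cong.sym formal_cong.trans)
  qed
qed

text \<open>Faithfulness of the model: every slice of a formal sum is a \<open>lift\<close> of its
  \<open>total\<close>, and slices separate formal sums.\<close>

lemma tens_eq_iff_total: "tens s u = tens s v \<longleftrightarrow> total u = total v"
proof
  assume eq: "total u = total v"
  have "formal_cong (bilinear_rel s) u v"
  proof (rule cong2_if_slices)
    fix f :: "'a \<Rightarrow> 'k" assume "Vector_Spaces.linear s (*) f"
    from bilin_slice[OF this] show "(\<Sum>(a, b)\<leftarrow>u. s (f a) b) = (\<Sum>(a, b)\<leftarrow>v. s (f a) b)"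
      using eq by (metis lift_total)
  qed
  then show "tens s u = tens s v" by (simp add: tens_eq_iff)
qed (simp add: tens_eq_iff total_cong)

lemma slicing3: "slicing s (trilinear_rel s) (\<lambda>c (a, b). (s c a, b))"
proof
  show "formal_cong (trilinear_rel s) [(a + a', y)] [(a, y), (a', y)]" for a a' and y :: "'a \<times> 'a"
    by (cases y, simp, rule formal_cong.base, rule trilinear_rel.intros(1))
  show "formal_cong (trilinear_rel s) [(s c a, y)] [(a, case y of (a, b) \<Rightarrow> (s c a, b))]"
    for c a and y :: "'a \<times> 'a"
    by (cases y, simp, rule formal_cong.base, rule trilinear_rel.intros(4))
  show "formal_cong (trilinear_rel s) [(0, y)] []" for y :: "'a \<times> 'a"
    by (cases y, simp, rule formal_cong.base, rule trilinear_rel.intros(6))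
qed

lemma cong3_pair:
  assumes "formal_cong (bilinear_rel s) u v"
  shows "formal_cong (trilinear_rel s) (map (Pair p) u) (map (Pair p) v)"
proof -
  have "formal_cong (trilinear_rel s) [(p, 0, b)] []" for b
  proof -
    have "formal_cong (trilinear_rel s) [(p, s 0 0, b)] [(s 0 p, 0, b)]"
      by (intro formal_cong.sym[OF formal_cong.base] trilinear_rel.intros)
    also have "formal_cong (trilinear_rel s) \<dots> []"
      by (intro formal_cong.base) (use trilinear_rel.intros(6)[of s] in simp)
    finally show ?thesis by simp
  qed
  note zero = this
  have "formal_cong (trilinear_rel s) (concat (map (\<lambda>y. [(p, y)]) u)) (concat (map (\<lambda>y. [(p, y)]) v))"
  proof (rule formal_cong_map[OF assms])
    fix u v assume "bilinear_rel s u v"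
    then show "formal_cong (trilinear_rel s) (concat (map (\<lambda>y. [(p, y)]) u)) (concat (map (\<lambda>y. [(p, y)]) v))"
    proof cases
      case (1 a a' b)
      show ?thesis unfolding 1 by simp (rule formal_cong.base, rule trilinear_rel.intros(2))
    next
      case (2 a b b')
      show ?thesis unfolding 2 by simp (rule formal_cong.base, rule trilinear_rel.intros(3))
    next
      case (3 c a b)
      show ?thesis unfolding 3 by simp (rule formal_cong.base, rule trilinear_rel.intros(5))
    next
      case (4 b)
      show ?thesis unfolding 4 by (simp add: zero)
    qed
  qed
  then show ?thesis by simp
qed

lemma sum_trilinear:
  fixes \<phi> :: "'a \<Rightarrow> 'a \<Rightarrow> 'a \<Rightarrow> 'v::ab_group_add"
  assumes "formal_cong (trilinear_rel s) u v"
    and "\<And>a a' b c. \<phi> (a + a') b c = \<phi> a b c + \<phi> a' b c"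
    and "\<And>a b b' c. \<phi> a (b + b') c = \<phi> a b c + \<phi> a b' c"
    and "\<And>a b c c'. \<phi> a b (c + c') = \<phi> a b c + \<phi> a b c'"
    and "\<And>k a b c. \<phi> (s k a) b c = \<phi> a (s k b) c"
    and "\<And>k a b c. \<phi> a (s k b) c = \<phi> a b (s k c)"
  shows "(\<Sum>(a, b, c)\<leftarrow>u. \<phi> a b c) = (\<Sum>(a, b, c)\<leftarrow>v. \<phi> a b c)"
  using assms(1)
proof induction
  case (base u v)
  have zero: "\<phi> 0 b c = 0" for b c
    using assms(2)[of 0 0 b c] by simp
  from base show ?case
    by cases (simp_all add: assms zero)
qed (simp_all add: add.commute)

text \<open>A slice of a triple tensor lies in the tensor square, where the faithful model is
  available. All identities in three factors are handled in this form.\<close>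

lemma tens3_eq_iff_slices:
  "tens3 s u = tens3 s v \<longleftrightarrow> (\<forall>f. Vector_Spaces.linear s (*) f \<longrightarrow>
    (\<Sum>(a, b, c)\<leftarrow>u. pure (s (f a) b) c) = (\<Sum>(a, b, c)\<leftarrow>v. pure (s (f a) b) c))" (is "_ \<longleftrightarrow> ?R")
proof
  assume "tens3 s u = tens3 s v"
  then have *: "formal_cong (trilinear_rel s) u v" by (simp add: tens3_eq_iff)
  show ?R
    by (intro allI impI sum_trilinear[OF *])
      (simp_all add: linearD scale_distrib pure_add
        pure_scale mult.commute)
next
  assume R: ?R
  interpret slicing s "trilinear_rel s" "\<lambda>c (a, b). (s c a, b)" by (rule slicing3)
  have "formal_cong (trilinear_rel s) u v"
  proof (rule cong_if_slices)
    fix p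
    have "total (slice p u) = (\<Sum>(a, b, c)\<leftarrow>u. pure (s (crd a p) b) c)" for u
      by (induction u) (auto simp: slice_def)
    then have "total (slice p u) = total (slice p v)"
      using R linear_crd[of p] by auto
    then show "formal_cong (trilinear_rel s) (map (Pair p) (slice p u)) (map (Pair p) (slice p v))"
      by (intro cong3_pair) (simp add: tens_eq_iff_total[symmetric] tens_eq_iff)
  qed
  then show "tens3 s u = tens3 s v" by (simp add: tens3_eq_iff)
qed

end

section \<open>Ore extensions\<close>

lemma additive_zero:
  fixes f :: "'a::ab_group_add \<Rightarrow> 'b::ab_group_add"
  assumes "\<And>a b. f (a + b) = f a + f b"
  shows "f 0 = 0"
  using assms[of 0 0] by simp

lemma additive_funpow:
  fixes Y :: "'b::ab_group_add \<Rightarrow> 'b"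
  shows "(\<And>a b. Y (a + b) = Y a + Y b) \<Longrightarrow> (Y ^^ i) (a + b) = (Y ^^ i) a + (Y ^^ i) b"
  by (induction i) auto

definition poly_val :: "('r::ring_1 \<Rightarrow> 't::ring_1) \<Rightarrow> 't \<Rightarrow> 'r poly \<Rightarrow> 't"
  where "poly_val \<iota> x p = (\<Sum>i\<le>degree p. \<iota> (poly.coeff p i) * x ^ i)"

locale ore =
  fixes sR :: "'k::field \<Rightarrow> 'r::ring_1 \<Rightarrow> 'r" and sT :: "'k \<Rightarrow> 't::ring_1 \<Rightarrow> 't"
    and \<iota> :: "'r \<Rightarrow> 't" and x :: 't and \<sigma> \<delta> :: "'r \<Rightarrow> 'r"
  assumes ore_ext: "ore_extension sR sT \<iota> x \<sigma> \<delta>"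
    and alg: "k_algebra sR"
begin

sublocale R: k_algebra sR by (rule alg)
sublocale T: k_algebra sT using ore_ext by (simp add: ore_extension_def)

lemma linear_iota: "Vector_Spaces.linear sR sT \<iota>"
  using ore_ext by (simp add: ore_extension_def algebra_hom_def)

lemma linear_sigma: "Vector_Spaces.linear sR sR \<sigma>"
  using ore_ext by (simp add: ore_extension_def algebra_hom_def algebra_aut_def)

lemma linear_delta: "Vector_Spaces.linear sR sR \<delta>"
  using ore_ext by (simp add: ore_extension_def skew_derivation_def)

lemma iota_add: "\<iota> (a + b) = \<iota> a + \<iota> b" and iota_scale: "\<iota> (sR c a) = sT c (\<iota> a)"
  using R.linearD[OF linear_iota] by auto

lemma iota_mult: "\<iota> (a * b) = \<iota> a * \<iota> b" and iota_one [simp]: "\<iota> 1 = 1"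
  using ore_ext by (simp_all add: ore_extension_def algebra_hom_def)

lemma iota_eq_iff [simp]: "\<iota> a = \<iota> b \<longleftrightarrow> a = b"
  using ore_ext by (auto simp: ore_extension_def inj_def)

lemma iota_zero [simp]: "\<iota> 0 = 0"
  using iota_add[of 0 0] by simp

lemma iota_minus: "\<iota> (- a) = - \<iota> a"
  using iota_add[of "- a" a] by (simp add: eq_neg_iff_add_eq_0)

lemma iota_diff: "\<iota> (a - b) = \<iota> a - \<iota> b"
  using iota_add[of a "- b"] by (simp add: iota_minus)

lemma sigma_add: "\<sigma> (a + b) = \<sigma> a + \<sigma> b" and sigma_scale: "\<sigma> (sR c a) = sR c (\<sigma> a)"
  using R.linearD[OF linear_sigma] by auto

lemma sigma_mult: "\<sigma> (a * b) = \<sigma> a * \<sigma> b" and sigma_one [simp]: "\<sigma> 1 = 1"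
  using ore_ext by (simp_all add: ore_extension_def algebra_hom_def algebra_aut_def)

lemma sigma_zero [simp]: "\<sigma> 0 = 0"
  using sigma_add[of 0 0] by simp

lemma bij_sigma: "bij \<sigma>"
  using ore_ext by (simp add: ore_extension_def algebra_aut_def)

lemma delta_add: "\<delta> (a + b) = \<delta> a + \<delta> b" and delta_scale: "\<delta> (sR c a) = sR c (\<delta> a)"
  using R.linearD[OF linear_delta] by auto

lemma delta_zero [simp]: "\<delta> 0 = 0"
  using delta_add[of 0 0] by simp

lemma delta_mult: "\<delta> (a * b) = \<sigma> a * \<delta> b + \<delta> a * b"
  using ore_ext by (simp add: ore_extension_def skew_derivation_def)

lemma x_iota: "x * \<iota> r = \<iota> (\<sigma> r) * x + \<iota> (\<delta> r)"
  using ore_ext by (simp add: ore_extension_def)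

abbreviation val where "val \<equiv> poly_val \<iota>"

lemma val_upto: "degree p \<le> N \<Longrightarrow> val y p = (\<Sum>i\<le>N. \<iota> (poly.coeff p i) * y ^ i)"
  unfolding poly_val_def by (rule sum.mono_neutral_left) (auto simp: coeff_eq_0)

lemma val_add: "val y (p + q) = val y p + val y q"
proof -
  let ?N = "max (degree p) (degree q)"
  have "degree (p + q) \<le> ?N" by (rule degree_add_le) auto
  then show ?thesis
    by (simp add: val_upto[of _ ?N] iota_add distrib_right sum.distrib)
qed

lemma val_zero [simp]: "val y 0 = 0"
  by (simp add: poly_val_def)

lemma val_minus: "val y (- p) = - val y p"
  by (simp add: poly_val_def iota_minus sum_negf)

lemma val_diff: "val y (p - q) = val y p - val y q"
  using val_add[of y p "- q"] by (simp add: val_minus)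

lemma val_left: "val y (map_poly ((*) r) p) = \<iota> r * val y p"
proof -
  have "degree (map_poly ((*) r) p) \<le> degree p"
    by (rule degree_le) (simp add: coeff_map_poly coeff_eq_0)
  then show ?thesis
    by (simp add: val_upto coeff_map_poly iota_mult sum_distrib_left mult.assoc poly_val_def[of _ _ p])
qed

lemma val_monom: "val y (monom r n) = \<iota> r * y ^ n"
proof -
  have "val y (monom r n) = (\<Sum>i\<le>n. \<iota> (poly.coeff (monom r n) i) * y ^ i)"
    by (rule val_upto) (rule degree_monom_le)
  also have "\<dots> = (\<Sum>i\<in>{n}. \<iota> (poly.coeff (monom r n) i) * y ^ i)"
    by (rule sum.mono_neutral_right) auto
  finally show ?thesis by simp
qed

lemma val_pCons: "val y (pCons a p) = \<iota> a + val y p * y"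
proof -
  have "val y (pCons a p) = (\<Sum>i\<le>Suc (degree p). \<iota> (poly.coeff (pCons a p) i) * y ^ i)"
    by (rule val_upto) (rule degree_pCons_le)
  also have "\<dots> = \<iota> a + (\<Sum>i\<le>degree p. \<iota> (poly.coeff p i) * y ^ Suc i)"
    by (subst sum.atMost_Suc_shift) simp
  finally show ?thesis
    by (simp add: poly_val_def sum_distrib_right mult.assoc power_commutes)
qed

lemma val_unique: "\<exists>!p. t = val x p"
  using ore_ext by (simp add: ore_extension_def poly_val_def)

definition coords :: "'t \<Rightarrow> 'r poly"
  where "coords t = (THE p. t = val x p)"

definition cf :: "nat \<Rightarrow> 't \<Rightarrow> 'r"
  where "cf i t = poly.coeff (coords t) i"

lemma val_coords: "val x (coords t) = t"
  using theI'[OF val_unique[of t]] by (simp add: coords_def)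

lemma coords_val: "coords (val x p) = p"
  using val_unique[of "val x p"] val_coords[of "val x p"] by metis

lemma coords_add: "coords (t + u) = coords t + coords u"
  using coords_val[of "coords t + coords u"] by (simp add: val_add val_coords)

lemma cf_add: "cf i (t + u) = cf i t + cf i u"
  by (simp add: cf_def coords_add)

lemma cf_zero [simp]: "cf i 0 = 0"
  using cf_add[of i 0 0] by simp

lemma cf_sum: "cf i (\<Sum>j\<in>J. f j) = (\<Sum>j\<in>J. cf i (f j))"
  by (induction J rule: infinite_finite_induct) (simp_all add: cf_add)

lemma cf_left: "cf i (\<iota> r * t) = r * cf i t"
proof -
  have "coords (\<iota> r * t) = map_poly ((*) r) (coords t)"
    using coords_val[of "map_poly ((*) r) (coords t)"] by (simp add: val_left val_coords)
  then show ?thesis by (simp add: cf_def coeff_map_poly)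
qed

lemma scale_eq_mult: "sT c t = \<iota> (sR c 1) * t"
  by (simp add: iota_scale T.scale_mult_left)

lemma cf_scale: "cf i (sT c t) = sR c (cf i t)"
  by (simp add: scale_eq_mult cf_left R.scale_mult_left)

lemma cf_monom: "cf i (\<iota> r * x ^ n) = (if i = n then r else 0)"
  using coords_val[of "monom r n"] by (simp add: cf_def val_monom)

lemma cf_iota: "cf i (\<iota> r) = (if i = 0 then r else 0)"
  using cf_monom[of i r 0] by simp

lemma cf_x_power: "cf i (x ^ n) = (if i = n then 1 else 0)"
  using cf_monom[of i 1 n] by simp

lemma cf_x: "cf i x = (if i = 1 then 1 else 0)"
  using cf_x_power[of i 1] by simp

lemma cf_bounded: "\<exists>n. \<forall>i>n. cf i t = 0"
  by (rule exI[of _ "degree (coords t)"]) (simp add: cf_def coeff_eq_0)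

lemma cf_expand:
  assumes "\<forall>i>n. cf i t = 0"
  shows "t = (\<Sum>i\<le>n. \<iota> (cf i t) * x ^ i)"
proof -
  have "degree (coords t) \<le> n"
    using assms by (intro degree_le) (simp add: cf_def)
  from val_upto[OF this, of x] show ?thesis by (simp add: val_coords cf_def)
qed

lemma cf_eqI: "(\<And>i. cf i t = cf i u) \<Longrightarrow> t = u"
  by (metis val_coords cf_def poly_eqI)

lemma ore_induct [case_names monom add]:
  assumes "\<And>r n. P (\<iota> r * x ^ n)" "\<And>t u. P t \<Longrightarrow> P u \<Longrightarrow> P (t + u)"
  shows "P t"
proof -
  obtain n where n: "\<forall>i>n. cf i t = 0" using cf_bounded by blast
  have "P (\<Sum>i\<le>m. \<iota> (cf i t) * x ^ i)" for m
    by (induction m) (use assms(1)[of _ 0] in \<open>simp_all add: assms del: power_Suc\<close>)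
  then show ?thesis by (subst cf_expand[OF n])
qed

lemma ore_induct_alg [case_names iota x add mult]:
  assumes "\<And>r. P (\<iota> r)" "P x" "\<And>t u. P t \<Longrightarrow> P u \<Longrightarrow> P (t + u)" "\<And>t u. P t \<Longrightarrow> P u \<Longrightarrow> P (t * u)"
  shows "P t"
proof (induction t rule: ore_induct)
  case (monom r n)
  have "P (x ^ n)"
    by (induction n) (use assms(1)[of 1] assms in auto)
  then show ?case by (intro assms)
qed (rule assms)

lemma cf_x_left: "cf j (x * t) = (if j = 0 then 0 else \<sigma> (cf (j - 1) t)) + \<delta> (cf j t)"
proof (induction t rule: ore_induct)
  case (monom r n)
  have "x * (\<iota> r * x ^ n) = \<iota> (\<sigma> r) * x ^ Suc n + \<iota> (\<delta> r) * x ^ n"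
    unfolding mult.assoc[symmetric] x_iota by (simp add: algebra_simps)
  then show ?case by (auto simp: cf_add cf_monom simp del: power_Suc)
qed (auto simp: distrib_left cf_add sigma_add delta_add)

text \<open>The coefficient a may be 0, so n is only an upper bound for the degree. This keeps the
  product rule free of case distinctions.\<close>

definition leads :: "nat \<Rightarrow> 't \<Rightarrow> 'r \<Rightarrow> bool"
  where "leads n t a \<longleftrightarrow> (\<forall>i>n. cf i t = 0) \<and> cf n t = a"

text \<open>Each multiplication by x on the left raises the degree by one and applies \<sigma> to
  the leading coefficient; \<delta> contributes only below it.\<close>

lemma leads_x_power: "leads m u b \<Longrightarrow> leads (n + m) (x ^ n * u) ((\<sigma> ^^ n) b)"
  by (induction n) (auto simp: leads_def mult.assoc cf_x_left)

lemma leads_mult: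
  assumes "leads n t a" "leads m u b"
  shows "leads (n + m) (t * u) (a * (\<sigma> ^^ n) b)"
proof -
  have t: "t = (\<Sum>i\<le>n. \<iota> (cf i t) * x ^ i)"
    using assms(1) by (intro cf_expand) (simp add: leads_def)
  have l: "leads (i + m) (x ^ i * u) ((\<sigma> ^^ i) b)" for i
    using assms(2) by (rule leads_x_power)
  have *: "cf j (t * u) = (\<Sum>i\<le>n. cf i t * cf j (x ^ i * u))" for j
    by (subst t) (simp add: sum_distrib_right cf_sum mult.assoc cf_left)
  have "cf j (t * u) = 0" if "j > n + m" for j
    unfolding * using that l by (intro sum.neutral) (auto simp: leads_def)
  moreover have "cf (n + m) (t * u) = (\<Sum>i\<in>{n}. cf i t * cf (n + m) (x ^ i * u))"
    unfolding * using l by (intro sum.mono_neutral_right) (auto simp: leads_def)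
  ultimately show ?thesis
    using l[of n] assms(1) by (simp add: leads_def)
qed

lemma leads_iota: "leads 0 (\<iota> r) r"
  by (simp add: leads_def cf_iota)

lemma sigma_power_zero [simp]: "(\<sigma> ^^ n) 0 = 0"
  by (induction n) auto

lemma sigma_power_eq_iff [simp]: "(\<sigma> ^^ n) a = (\<sigma> ^^ n) b \<longleftrightarrow> a = b"
  using bij_sigma by (induction n) (auto simp: bij_def inj_def)

text \<open>The operator \<open>Y\<close> stands for right multiplication by the image of \<open>x\<close>; keeping it
  abstract covers anti-homomorphisms as well.\<close>

definition ext :: "('r \<Rightarrow> 'b::ab_group_add) \<Rightarrow> ('b \<Rightarrow> 'b) \<Rightarrow> 't \<Rightarrow> 'b"
  where "ext f Y t = (\<Sum>i\<le>degree (coords t). (Y ^^ i) (f (cf i t)))"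

context
  fixes f :: "'r \<Rightarrow> 'b::ab_group_add" and Y :: "'b \<Rightarrow> 'b"
  assumes f_add: "\<And>a b. f (a + b) = f a + f b" and Y_add: "\<And>a b. Y (a + b) = Y a + Y b"
begin

lemma ext_zero_term: "(Y ^^ i) (f 0) = 0"
  using additive_zero[OF f_add] additive_zero[of "Y ^^ i", OF additive_funpow[OF Y_add]] by simp

lemma ext_upto: "\<forall>i>N. cf i t = 0 \<Longrightarrow> ext f Y t = (\<Sum>i\<le>N. (Y ^^ i) (f (cf i t)))"
  unfolding ext_def
  by (rule sum.mono_neutral_left)
    (auto intro!: degree_le simp: ext_zero_term cf_def coeff_eq_0)

lemma ext_add: "ext f Y (t + u) = ext f Y t + ext f Y u"
proof -
  obtain n m where n: "\<forall>i>n. cf i t = 0" and m: "\<forall>i>m. cf i u = 0" using cf_bounded by metis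
  let ?N = "max n m"
  have "\<forall>i>?N. cf i t = 0" "\<forall>i>?N. cf i u = 0" "\<forall>i>?N. cf i (t + u) = 0"
    using n m by (auto simp: cf_add)
  then show ?thesis
    by (simp add: ext_upto[of ?N] cf_add f_add additive_funpow[OF Y_add] sum.distrib del: max_less_iff_conj)
qed

lemma ext_monom: "ext f Y (\<iota> r * x ^ n) = (Y ^^ n) (f r)"
proof -
  have "ext f Y (\<iota> r * x ^ n) = (\<Sum>i\<le>n. (Y ^^ i) (f (cf i (\<iota> r * x ^ n))))"
    by (rule ext_upto) (simp add: cf_monom)
  also have "\<dots> = (\<Sum>i\<in>{n}. (Y ^^ i) (f (cf i (\<iota> r * x ^ n))))"
    by (intro sum.mono_neutral_right) (auto simp: ext_zero_term cf_monom split: if_splits)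
  finally show ?thesis by (simp add: cf_monom)
qed

lemma ext_iota: "ext f Y (\<iota> r) = f r"
  using ext_monom[of r 0] by simp

lemma ext_scale:
  assumes "\<And>c r. f (sR c r) = s c (f r)" "\<And>c z. Y (s c z) = s c (Y z)"
    "\<And>c y z. s c (y + z) = s c y + s c z"
  shows "ext f Y (sT c t) = s c (ext f Y t)"
proof -
  have "(Y ^^ n) (s c z) = s c ((Y ^^ n) z)" for n z
    by (induction n) (simp_all add: assms)
  then have "ext f Y (sT c (\<iota> r * x ^ n)) = s c (ext f Y (\<iota> r * x ^ n))" for r n
    using ext_monom[of "sR c r" n] by (simp add: ext_monom iota_scale T.scale_mult_left assms)
  then show ?thesis
    by (induction t rule: ore_induct) (simp_all add: T.scale_right_distrib ext_add assms)
qed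

text \<open>Universal property of the Ore extension, reduced to left multiplication by \<iota>(r)
  and by x. The product m is the ordinary one for \<Delta> and \<epsilon> and the opposite one for
  S. The weak unit condition on \<open>f 1\<close> is deliberate: in the tensor model
  \<open>pure 1 1\<close> acts as a unit only on actual tensors.\<close>

lemma ext_mult:
  fixes m :: "'b \<Rightarrow> 'b \<Rightarrow> 'b" and y :: 'b
  assumes Y: "\<And>z. Y z = m z y"
    and m_add: "\<And>a b c. m (a + b) c = m a c + m b c" "\<And>a b c. m a (b + c) = m a b + m a c"
    and m_assoc: "\<And>a b c. m (m a b) c = m a (m b c)"
    and f_mult: "\<And>a b. f (a * b) = m (f a) (f b)" and f_one: "m (f 1) y = y"
    and comm: "\<And>r. m y (f r) = m (f (\<sigma> r)) y + f (\<delta> r)"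
  shows "ext f Y (t * u) = m (ext f Y t) (ext f Y u)"
proof -
  have pull: "(Y ^^ n) (m a b) = m a ((Y ^^ n) b)" for n a b
    by (induction n) (simp_all add: Y m_assoc)
  have left: "ext f Y (\<iota> r * u) = m (f r) (ext f Y u)" for r u
  proof (induction u rule: ore_induct)
    case (monom q n)
    show ?case
      using ext_monom[of "r * q" n] by (simp add: ext_monom iota_mult mult.assoc f_mult pull)
  qed (simp add: distrib_left ext_add m_add)
  have x_left: "ext f Y (x * u) = m y (ext f Y u)" for u
  proof (induction u rule: ore_induct)
    case (monom r n)
    have "x * (\<iota> r * x ^ n) = \<iota> (\<sigma> r) * x ^ Suc n + \<iota> (\<delta> r) * x ^ n"
      unfolding mult.assoc[symmetric] x_iota by (simp add: algebra_simps)
    then have "ext f Y (x * (\<iota> r * x ^ n)) = (Y ^^ n) (Y (f (\<sigma> r)) + f (\<delta> r))"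
      by (simp only: ext_add ext_monom additive_funpow[OF Y_add] funpow_Suc_right o_apply)
    moreover have "Y (f (\<sigma> r)) + f (\<delta> r) = m y (f r)" by (simp add: Y comm)
    ultimately show ?case by (simp only: pull ext_monom)
  qed (simp add: distrib_left ext_add m_add)
  have x: "ext f Y x = y"
    using ext_monom[of 1 1] by (simp add: Y f_one)
  have "\<forall>u. ext f Y (t * u) = m (ext f Y t) (ext f Y u)"
    by (induction t rule: ore_induct_alg)
      (simp_all add: left x_left x ext_iota distrib_right ext_add m_add mult.assoc m_assoc)
  then show ?thesis by blast
qed

lemma ext_x: "ext f Y x = Y (f 1)"
  using ext_monom[of 1 1] by simp

end

text \<open>The new \<sigma> and \<delta> are forced: expand (u x + p) r by the old relation and
  substitute x = v (X - p) for the new variable X.\<close>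

lemma change_of_variable:
  fixes u v p :: 'r
  assumes uv: "u * v = 1" and vu: "v * u = 1"
  shows "ore_extension sR sT \<iota> (\<iota> u * x + \<iota> p) (\<lambda>r. u * \<sigma> r * v)
    (\<lambda>r. u * \<delta> r + p * r - u * \<sigma> r * v * p)"
proof -
  let ?X = "\<iota> u * x + \<iota> p" and ?\<sigma> = "\<lambda>r. u * \<sigma> r * v"
  let ?\<delta> = "\<lambda>r. u * \<delta> r + p * r - u * \<sigma> r * v * p"
  have cancel: "v * (u * a) = a" "u * (v * a) = a" for a
    using uv vu by (simp_all add: mult.assoc[symmetric])
  have icancel: "\<iota> v * (\<iota> u * t) = t" "\<iota> u * (\<iota> v * t) = t" for t
    using uv vu by (simp_all add: mult.assoc[symmetric] iota_mult[symmetric])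
  have lin: "Vector_Spaces.linear sR sR ?\<sigma>" "Vector_Spaces.linear sR sR ?\<delta>"
    by (simp_all add: Vector_Spaces.linear_def module_hom_def module_hom_axioms_def sigma_add
        sigma_scale delta_add delta_scale R.scale_mult
        R.scale_right_diff_distrib R.scale_right_distrib
        R.vector_space_axioms R.module_axioms algebra_simps)
  have "?\<sigma> a = ?\<sigma> b \<Longrightarrow> a = b" for a b
  proof -
    assume "?\<sigma> a = ?\<sigma> b"
    then have "v * (u * \<sigma> a * v) * u = v * (u * \<sigma> b * v) * u" by simp
    then have "\<sigma> a = \<sigma> b" by (simp add: mult.assoc cancel vu)
    then show "a = b" using bij_sigma by (auto simp: bij_def inj_def)
  qed
  moreover have "\<exists>a. b = ?\<sigma> a" for b
  proof -
    obtain a where "\<sigma> a = v * b * u" using bij_sigma by (metis bij_pointE)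
    then have "b = ?\<sigma> a" by (simp add: mult.assoc cancel uv)
    then show ?thesis by blast
  qed
  ultimately have aut: "algebra_aut sR ?\<sigma>"
    using lin by (auto simp: algebra_aut_def algebra_hom_def sigma_mult mult.assoc cancel uv bij_def inj_def surj_def)
  have der: "skew_derivation sR ?\<sigma> ?\<delta>"
    using lin(2) by (simp add: skew_derivation_def delta_mult sigma_mult mult.assoc cancel algebra_simps)
  have comm: "?X * \<iota> r = \<iota> (?\<sigma> r) * ?X + \<iota> (?\<delta> r)" for r
    by (simp add: distrib_left distrib_right mult.assoc x_iota iota_mult iota_add iota_diff icancel)
  \<comment> \<open>The left R-span of the powers of X is stable under left multiplication by X;
    together with x = v X - v p this puts every power of x into it.\<close>
  have spanX: "\<exists>q. ?X * val ?X p = val ?X q" for p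
  proof (induction p)
    case (pCons a p)
    then obtain q where q: "?X * val ?X p = val ?X q" by blast
    have "?X * val ?X (pCons a p) = \<iota> (?\<sigma> a) * ?X ^ 1 + \<iota> (?\<delta> a) + (?X * val ?X p) * ?X"
      unfolding val_pCons distrib_left[of ?X] comm by (simp only: mult.assoc power_one_right)
    also have "\<dots> = val ?X (monom (?\<sigma> a) 1 + pCons (?\<delta> a) q)"
      unfolding val_add val_pCons val_monom q by (simp only: add.assoc)
    finally show ?case by blast
  qed (auto intro: exI[of _ 0])
  have span: "\<exists>q. t = val ?X q" for t
  proof (induction t rule: ore_induct)
    case (monom r n)
    have "\<exists>q. x ^ n = val ?X q"
    proof (induction n)
      case 0
      show ?case using val_monom[of ?X 1 0] by (intro exI[of _ "monom 1 0"]) simp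
    next
      case (Suc n)
      then obtain q where q: "x ^ n = val ?X q" by blast
      obtain q' where q': "?X * val ?X q = val ?X q'" using spanX by blast
      have "x ^ Suc n = \<iota> v * (?X * x ^ n) - \<iota> (v * p) * x ^ n"
        by (simp add: algebra_simps icancel iota_mult)
      also have "\<dots> = val ?X (map_poly ((*) v) q' - map_poly ((*) (v * p)) q)"
        unfolding val_diff val_left q'[symmetric] q[symmetric] ..
      finally show ?case by blast
    qed
    then show ?case by (metis val_left)
  next
    case (add t u)
    then show ?case by (metis val_add)
  qed
  \<comment> \<open>A right inverse of the leading coefficient suffices, since uniqueness only has
    to cancel c in an equation q c = 0.\<close>
  have lead: "\<exists>c d. c * d = 1 \<and> leads n (?X ^ n) c" for n
  proof (induction n)
    case 0
    show ?case using leads_iota[of 1] by (intro exI[of _ 1]) simp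
  next
    case (Suc n)
    then obtain c d where "c * d = 1" "leads n (?X ^ n) c" by blast
    moreover have "leads 1 ?X u" by (auto simp: leads_def cf_add cf_left cf_x cf_iota)
    ultimately have "leads (Suc n) (?X ^ Suc n) (u * \<sigma> c)" "(u * \<sigma> c) * (\<sigma> d * v) = 1"
      using leads_mult[of 1 ?X u n "?X ^ n" c] by (simp_all add: mult.assoc sigma_mult[symmetric])
        (metis cancel(2) mult.assoc mult_1 sigma_mult sigma_one uv)
    then show ?case by blast
  qed
  have inj: "q = 0" if "val ?X q = 0" for q
  proof (rule ccontr)
    assume "q \<noteq> 0"
    define n where "n = degree q"
    obtain c d where c: "c * d = 1" "leads n (?X ^ n) c" using lead by blast
    have "cf n (val ?X q) = (\<Sum>i\<le>n. poly.coeff q i * cf n (?X ^ i))"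
      by (simp add: poly_val_def n_def cf_sum cf_left)
    also have "\<dots> = (\<Sum>i\<in>{n}. poly.coeff q i * cf n (?X ^ i))"
    proof (rule sum.mono_neutral_right)
      show "\<forall>i\<in>{..n} - {n}. poly.coeff q i * cf n (?X ^ i) = 0"
      proof
        fix i assume i: "i \<in> {..n} - {n}"
        obtain c where "leads i (?X ^ i) c" using lead by blast
        with i show "poly.coeff q i * cf n (?X ^ i) = 0" by (auto simp: leads_def)
      qed
    qed auto
    finally have "poly.coeff q n * c = 0" using c that by (simp add: leads_def)
    then have "poly.coeff q n * (c * d) = 0" by (simp add: mult.assoc[symmetric])
    with c \<open>q \<noteq> 0\<close> show False by (simp add: n_def)
  qed
  have "\<exists>!q. t = val ?X q" for t
  proof -
    obtain q where "t = val ?X q" using span by blast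
    moreover have "q' = q" if "t = val ?X q'" for q'
      using inj[of "q' - q"] that calculation by (simp add: val_diff)
    ultimately show ?thesis by blast
  qed
  then show ?thesis
    unfolding ore_extension_def poly_val_def
    using ore_ext aut der comm by (simp add: ore_extension_def)
qed

end

section \<open>Hopf algebras in terms of the tensor model\<close>

definition trilin :: "('k::field \<Rightarrow> 'a::ring_1 \<Rightarrow> 'a) \<Rightarrow> ('a \<Rightarrow> 'a \<Rightarrow> 'a \<Rightarrow> 'v::ab_group_add) \<Rightarrow> bool"
  where "trilin s \<phi> \<longleftrightarrow> (\<forall>a a' b c. \<phi> (a + a') b c = \<phi> a b c + \<phi> a' b c) \<and>
    (\<forall>a b b' c. \<phi> a (b + b') c = \<phi> a b c + \<phi> a b' c) \<and>
    (\<forall>a b c c'. \<phi> a b (c + c') = \<phi> a b c + \<phi> a b c') \<and>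
    (\<forall>k a b c. \<phi> (s k a) b c = \<phi> a (s k b) c) \<and> (\<forall>k a b c. \<phi> a (s k b) c = \<phi> a b (s k c))"

lemma trilinI:
  assumes "\<And>a a' b c. \<phi> (a + a') b c = \<phi> a b c + \<phi> a' b c"
    and "\<And>a b b' c. \<phi> a (b + b') c = \<phi> a b c + \<phi> a b' c"
    and "\<And>a b c c'. \<phi> a b (c + c') = \<phi> a b c + \<phi> a b c'"
    and "\<And>k a b c. \<phi> (s k a) b c = \<phi> a (s k b) c"
    and "\<And>k a b c. \<phi> a (s k b) c = \<phi> a b (s k c)"
  shows "trilin s \<phi>"
  using assms by (simp add: trilin_def)

lemma trilinD:
  assumes "trilin s \<phi>"
  shows "\<phi> (a + a') b c = \<phi> a b c + \<phi> a' b c" "\<phi> a (b + b') c = \<phi> a b c + \<phi> a b' c"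
    "\<phi> a b (c + c') = \<phi> a b c + \<phi> a b c'" "\<phi> (s k a) b c = \<phi> a (s k b) c"
    "\<phi> a (s k b) c = \<phi> a b (s k c)"
  using assms by (simp_all add: trilin_def)

lemma trilin_bilin: "trilin s \<phi> \<Longrightarrow> bilin s (\<lambda>p q. \<phi> p q c)" "trilin s \<phi> \<Longrightarrow> bilin s (\<lambda>p q. \<phi> c p q)"
  by (rule bilinI; simp add: trilinD)+

lemma additive_sum:
  fixes F :: "'a::ab_group_add \<Rightarrow> 'b::ab_group_add"
  assumes "\<And>a b. F (a + b) = F a + F b"
  shows "F (\<Sum>i\<in>I. f i) = (\<Sum>i\<in>I. F (f i))"
  by (induction I rule: infinite_finite_induct) (simp_all add: assms additive_zero[OF assms])

context k_algebra
begin

text \<open>\<open>lift\<close> is literally a finite sum over coordinates, so it commutes with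
  additive maps, and with another \<open>lift\<close>, even when the integrand is not
  bilinear.\<close>

lemma lift_additive:
  assumes "\<And>a b. F (a + b) = F a + F b"
  shows "F (lift \<psi> U) = lift (\<lambda>a b. F (\<psi> a b)) U"
  unfolding lift_def contract_def by (rule additive_sum[OF assms])

lemma lift_swap:
  fixes s' :: "'k \<Rightarrow> 'b::ring_1 \<Rightarrow> 'b"
  assumes "k_algebra s'"
  shows "lift (\<lambda>a b. k_algebra.lift s' (\<lambda>c d. \<phi> a b c d) V) U =
    k_algebra.lift s' (\<lambda>c d. lift (\<lambda>a b. \<phi> a b c d) U) V"
  unfolding k_algebra.lift_def[OF assms] k_algebra.contract_def[OF assms] lift_def contract_def
  by (rule sum.swap)

lemma lift_fun_add: "lift (\<lambda>a b. \<phi> a b + \<psi> a b) U = lift \<phi> U + lift \<psi> U"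
  by (simp add: lift_def contract_def sum.distrib)

lemma lift_const_left:
  fixes c :: "'v::ring"
  shows "lift (\<lambda>a b. c * \<phi> a b) U = c * lift \<phi> U"
  unfolding lift_def contract_def by (rule sum_distrib_left[symmetric])

lemma lift_const_right:
  fixes c :: "'v::ring"
  shows "lift (\<lambda>a b. \<phi> a b * c) U = lift \<phi> U * c"
  unfolding lift_def contract_def by (rule sum_distrib_right[symmetric])

lemma linearI:
  assumes "vector_space t" "\<And>a b. f (a + b) = f a + f b" "\<And>c a. f (s c a) = t c (f a)"
  shows "Vector_Spaces.linear s t f"
  using assms vector_space_axioms
  by (simp add: Vector_Spaces.linear_def module_hom_def module_hom_axioms_def module_iff_vector_space)

lemma lift_pure_mult:
  assumes "bilin s \<phi>"
  shows "lift \<phi> (pure a b * V) = lift (\<lambda>c d. \<phi> (a * c) (b * d)) V"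
proof -
  have "contract \<phi> (\<Sum>i\<in>I. m i) = (\<Sum>i\<in>I. contract \<phi> (m i))" for I and m :: "'a \<Rightarrow> 'a \<Rightarrow>\<^sub>0 'a"
    by (rule additive_sum) (rule contract_add[OF assms])
  then show ?thesis
    by (simp add: lift_def app_simps app_pure) (simp add: contract_def[of _ "app V _"] contract_crdt[OF assms])
qed

text \<open>The actual tensors. The endomorphism type is larger, so closure under the operations has
  to be tracked.\<close>

definition carr :: "('a \<Rightarrow>\<^sub>0 'a) endo set"
  where "carr = range total"

lemma total_in_carr [simp]: "total u \<in> carr"
  by (simp add: carr_def)

lemma pure_in_carr [simp]: "pure a b \<in> carr"
  using total_in_carr[of "[(a, b)]"] by simp

lemma zero_in_carr [simp]: "0 \<in> carr"
  using total_in_carr[of "[]"] by simp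

lemma carr_add [simp]: "U \<in> carr \<Longrightarrow> V \<in> carr \<Longrightarrow> U + V \<in> carr"
  by (auto simp: carr_def total_simps(3)[symmetric] simp del: total_simps(3))

lemma carr_mult [simp]: "U \<in> carr \<Longrightarrow> V \<in> carr \<Longrightarrow> U * V \<in> carr"
  by (auto simp: carr_def total_lmult[symmetric])

lemma carr_minus [simp]: "U \<in> carr \<Longrightarrow> - U \<in> carr"
  by (auto simp: carr_def total_lneg[symmetric])

lemma carr_diff [simp]: "U \<in> carr \<Longrightarrow> V \<in> carr \<Longrightarrow> U - V \<in> carr"
  using carr_add[of U "- V"] by simp

lemma carr_sum: "(\<And>i. i \<in> I \<Longrightarrow> U i \<in> carr) \<Longrightarrow> (\<Sum>i\<in>I. U i) \<in> carr"
  by (induction I rule: infinite_finite_induct) auto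

lemma lift_in_carr: "(\<And>a b. \<phi> a b \<in> k_algebra.carr s') \<Longrightarrow> k_algebra s' \<Longrightarrow> lift \<phi> U \<in> k_algebra.carr s'"
  unfolding lift_def contract_def by (rule k_algebra.carr_sum) auto

lemma carr_induct [consumes 1, case_names zero add]:
  assumes "U \<in> carr" "P 0" "\<And>a b V. V \<in> carr \<Longrightarrow> P V \<Longrightarrow> P (pure a b + V)"
  shows "P U"
proof -
  have "P (total u)" for u
    by (induction u) (use assms in auto)
  then show ?thesis using assms(1) by (auto simp: carr_def)
qed

lemma carr_eqI:
  fixes F G :: "('a \<Rightarrow>\<^sub>0 'a) endo \<Rightarrow> 'v::ab_group_add"
  assumes "U \<in> carr" "\<And>a b. F (a + b) = F a + F b" "\<And>a b. G (a + b) = G a + G b"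
    and "\<And>a b. F (pure a b) = G (pure a b)"
  shows "F U = G U"
  using assms(1) by (induction rule: carr_induct) (simp_all add: assms(2-4) additive_zero[OF assms(2)] additive_zero[OF assms(3)])

lemma one_mult_carr [simp]: "U \<in> carr \<Longrightarrow> pure 1 1 * U = U" "U \<in> carr \<Longrightarrow> U * pure 1 1 = U"
  by (induction rule: carr_induct) (simp_all add: distrib_left distrib_right pure_mult)

lemma lift_pure_id: "U \<in> carr \<Longrightarrow> lift pure U = U"
  by (rule carr_eqI) (simp_all add: lift_add lift_pure bilin_pure)

text \<open>The endomorphism ring carries no scalar action; multiplication by
  \<open>pure (s k 1) 1\<close> on the left plays that part throughout.\<close>

lemma lift_pure_scale: "U \<in> carr \<Longrightarrow> lift (\<lambda>a b. pure (s k a) b) U = pure (s k 1) 1 * U"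
  using lift_const_left[of "pure (s k 1) 1" pure U] by (simp add: lift_pure_id pure_mult scale_mult_left)

lemma lift_mult:
  assumes "bilin s \<phi>" "U \<in> carr"
  shows "lift \<phi> (U * V) = lift (\<lambda>a b. lift (\<lambda>c d. \<phi> (a * c) (b * d)) V) U"
proof -
  let ?\<psi> = "\<lambda>a b. lift (\<lambda>c d. \<phi> (a * c) (b * d)) V"
  have *: "bilin s ?\<psi>"
    by (rule bilinI) (simp_all add: distrib_right bilinD[OF assms(1)] lift_fun_add scale_mult_left)
  show ?thesis
    by (rule carr_eqI[where F = "\<lambda>U. lift \<phi> (U * V)" and G = "lift ?\<psi>", OF assms(2)])
      (simp_all add: distrib_right lift_add assms * lift_pure lift_pure_mult)
qed

lemma lift_mult_hom:
  fixes \<phi> :: "'a \<Rightarrow> 'a \<Rightarrow> 'v::ring"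
  assumes "bilin s \<phi>" "\<And>a b c d. \<phi> (a * c) (b * d) = \<phi> a b * \<phi> c d" "U \<in> carr"
  shows "lift \<phi> (U * V) = lift \<phi> U * lift \<phi> V"
  by (simp add: lift_mult[OF assms(1,3)] assms(2) lift_const_left lift_const_right)

lemma lift_mult_pure:
  assumes "bilin s \<phi>" "U \<in> carr"
  shows "lift \<phi> (U * pure c d) = lift (\<lambda>a b. \<phi> (a * c) (b * d)) U"
proof -
  have "bilin s (\<lambda>c d. \<phi> (a * c) (b * d))" for a b
    by (rule bilinI) (simp_all add: distrib_left bilinD[OF assms(1)] scale_mult_right)
  then show ?thesis by (simp add: lift_mult[OF assms] lift_pure)
qed

lemma total_sw_tens: "total (sw (tens s u)) = total u"
  using total_cong[OF sw_tens_cong, of u] by simp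

lemma bilin_slice_pure:
  assumes "Vector_Spaces.linear s (*) f"
  shows "bilin s (\<lambda>p q. pure (s (f p) q) b)"
  by (rule bilinI) (simp_all add: linearD[OF assms] pure_add pure_scale scale_distrib mult.commute)

context
  fixes D :: "'a \<Rightarrow> ('a \<Rightarrow>\<^sub>0 'a) endo" and f :: "'a \<Rightarrow> 'k"
  assumes D_add: "\<And>a b. D (a + b) = D a + D b" and D_scale: "\<And>c a. D (s c a) = pure (s c 1) 1 * D a"
    and f: "Vector_Spaces.linear s (*) f"
begin

lemma bilin_slice_left: "bilin s (\<lambda>a b. lift (\<lambda>p q. pure (s (f p) q) b) (D a))"
proof (rule bilinI)
  show "lift (\<lambda>p q. pure (s (f p) q) b) (D (s c a)) = lift (\<lambda>p q. pure (s (f p) q) (s c b)) (D a)" for c a b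
    by (simp add: D_scale lift_pure_mult[OF bilin_slice_pure[OF f]] scale_mult_left linearD[OF f])
      (simp add: pure_scale[symmetric])
  show "lift (\<lambda>p q. pure (s (f p) q) b) (D (a + a')) =
      lift (\<lambda>p q. pure (s (f p) q) b) (D a) + lift (\<lambda>p q. pure (s (f p) q) b) (D a')" for a a' b
    by (simp only: D_add lift_add[OF bilin_slice_pure[OF f]])
qed (simp add: pure_add_right lift_fun_add)

lemma bilin_slice_right: "bilin s (\<lambda>a b. pure (s (f a) 1) 1 * D b)"
  by (rule bilinI) (simp_all add: linearD[OF f] pure_add_left scale_left_distrib D_add D_scale distrib_left
      distrib_right mult.assoc[symmetric] pure_mult scale_mult_left mult.commute)

text \<open>The slices of (\<Delta> \<otimes> I)(u) and (I \<otimes> \<Delta>)(u), carried over from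
  list comprehensions to the model.\<close>

lemma slice_coproduct_lists:
  assumes D_eq: "\<And>a. total (sw (\<Delta> a)) = D a"
  shows "(\<Sum>(a, b, c)\<leftarrow>concat (map (\<lambda>(a, b). map (\<lambda>(p, q). (p, q, b)) (sw (\<Delta> a))) u). pure (s (f a) b) c) =
      lift (\<lambda>a b. lift (\<lambda>p q. pure (s (f p) q) b) (D a)) (total u)"
    and "(\<Sum>(a, b, c)\<leftarrow>concat (map (\<lambda>(a, b). map (\<lambda>(p, q). (a, p, q)) (sw (\<Delta> b))) u). pure (s (f a) b) c) =
      lift (\<lambda>a b. pure (s (f a) 1) 1 * D b) (total u)"
proof -
  let ?l = "\<lambda>u. \<Sum>(a, b, c)\<leftarrow>u. pure (s (f a) b) c"
  have cc: "?l (concat (map g u)) = (\<Sum>p\<leftarrow>u. ?l (g p))" for g and u :: "('a \<times> 'a) list"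
    by (induction u) simp_all
  have "?l (map (\<lambda>(p, q). (p, q, b)) (sw (\<Delta> a))) = lift (\<lambda>p q. pure (s (f p) q) b) (D a)" for a b
    unfolding D_eq[symmetric] lift_total[OF bilin_slice_pure[OF f]] by (simp add: o_def case_prod_unfold)
  then show "?l (concat (map (\<lambda>(a, b). map (\<lambda>(p, q). (p, q, b)) (sw (\<Delta> a))) u)) =
      lift (\<lambda>a b. lift (\<lambda>p q. pure (s (f p) q) b) (D a)) (total u)"
    unfolding cc lift_total[OF bilin_slice_left] by (simp add: split_beta) (simp add: case_prod_unfold)
  have "?l (map (\<lambda>(p, q). (a, p, q)) v) = pure (s (f a) 1) 1 * total v" for a v
    by (induction v) (auto simp: distrib_left pure_mult scale_mult_left)
  then show "?l (concat (map (\<lambda>(a, b). map (\<lambda>(p, q). (a, p, q)) (sw (\<Delta> b))) u)) =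
      lift (\<lambda>a b. pure (s (f a) 1) 1 * D b) (total u)"
    unfolding cc lift_total[OF bilin_slice_right] by (simp add: split_beta) (simp add: case_prod_unfold D_eq)
qed

end

text \<open>The way back from a coproduct D in the model to one with values in classes of lists.
  Choosing a representing list is harmless because \<open>tens\<close> depends only on
  \<open>total\<close>; the second conclusion evaluates \<Delta> on any presentation.\<close>

lemma hopf_algebraI:
  fixes D :: "'a \<Rightarrow> ('a \<Rightarrow>\<^sub>0 'a) endo"
  assumes closed: "\<And>a. D a \<in> carr"
    and add: "\<And>a b. D (a + b) = D a + D b"
    and scale: "\<And>c a. D (s c a) = pure (s c 1) 1 * D a"
    and mult: "\<And>a b. D (a * b) = D a * D b"
    and one: "D 1 = pure 1 1"
    and counit_hom: "algebra_hom s (*) \<epsilon>"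
    and coassoc: "\<And>f r. Vector_Spaces.linear s (*) f \<Longrightarrow>
      lift (\<lambda>a b. lift (\<lambda>p q. pure (s (f p) q) b) (D a)) (D r) = lift (\<lambda>a b. pure (s (f a) 1) 1 * D b) (D r)"
    and counit_left: "\<And>r. lift (\<lambda>a b. s (\<epsilon> a) b) (D r) = r"
    and counit_right: "\<And>r. lift (\<lambda>a b. s (\<epsilon> b) a) (D r) = r"
    and S_linear: "Vector_Spaces.linear s s S"
    and antipode_left: "\<And>r. lift (\<lambda>a b. S a * b) (D r) = s (\<epsilon> r) 1"
    and antipode_right: "\<And>r. lift (\<lambda>a b. a * S b) (D r) = s (\<epsilon> r) 1"
  shows "\<exists>\<Delta>. hopf_algebra s \<Delta> \<epsilon> S \<and> (\<forall>r. \<forall>u. total u = D r \<longrightarrow> \<Delta> r = tens s u)"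
proof -
  define \<Delta> where "\<Delta> r = tens s (SOME u. total u = D r)" for r
  have total_D: "total (sw (\<Delta> r)) = D r" for r
    unfolding \<Delta>_def total_sw_tens using closed[of r] by (auto simp: carr_def intro: someI)
  have Delta_eq: "\<Delta> r = tens s u" if "total u = D r" for r u
    unfolding \<Delta>_def using that by (subst tens_eq_iff_total) (metis (mono_tags) someI)
  have sum_D: "(\<Sum>(a, b)\<leftarrow>sw (\<Delta> r). \<phi> a b) = lift \<phi> (D r)" if "bilin s \<phi>" for r and \<phi> :: "'a \<Rightarrow> 'a \<Rightarrow> 'v::ab_group_add"
    by (simp add: total_D[symmetric] lift_total that)
  note eps = linearD[OF conjunct1[OF counit_hom[unfolded algebra_hom_def]]]
  note S = linearD[OF S_linear]
  note simps = eps S scale_distrib distrib_left distrib_right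
    scale_mult mult.commute
  have "hopf_algebra s \<Delta> \<epsilon> S"
  proof (intro hopf_algebra.intro hopf_algebra_axioms.intro k_algebra_axioms)
    show "\<Delta> a \<in> tensors s" for a by (simp add: \<Delta>_def tensors_def)
    show "\<Delta> (a + b) = tens s (sw (\<Delta> a) @ sw (\<Delta> b))" for a b
      by (rule Delta_eq) (simp add: total_D add)
    have "total (map (\<lambda>(p, q). (s c p, q)) u) = pure (s c 1) 1 * total u" for c u
      by (induction u) (auto simp: distrib_left pure_mult scale_mult_left)
    then show "\<Delta> (s c a) = tens s (map (\<lambda>(p, q). (s c p, q)) (sw (\<Delta> a)))" for c a
      by (intro Delta_eq) (simp add: total_D scale)
    show "\<Delta> (a * b) = tensor_mult s (\<Delta> a) (\<Delta> b)" for a b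
      unfolding tensor_mult_def by (rule Delta_eq) (simp add: total_D mult total_lmult)
    show "\<Delta> 1 = tens s [(1, 1)]" by (rule Delta_eq) (simp add: one)
    show "algebra_hom s (*) \<epsilon>" by fact
    show "Vector_Spaces.linear s s S" by fact
    show "(\<Sum>(a, b)\<leftarrow>sw (\<Delta> r). s (\<epsilon> a) b) = r" for r
      by (subst sum_D) (auto intro!: bilinI simp: simps counit_left)
    show "(\<Sum>(a, b)\<leftarrow>sw (\<Delta> r). s (\<epsilon> b) a) = r" for r
      by (subst sum_D) (auto intro!: bilinI simp: simps counit_right)
    show "(\<Sum>(a, b)\<leftarrow>sw (\<Delta> r). S a * b) = s (\<epsilon> r) 1" for r
      by (subst sum_D) (auto intro!: bilinI simp: simps antipode_left)
    show "(\<Sum>(a, b)\<leftarrow>sw (\<Delta> r). a * S b) = s (\<epsilon> r) 1" for r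
      by (subst sum_D) (auto intro!: bilinI simp: simps antipode_right)
    show "tens3 s (concat (map (\<lambda>(a, b). map (\<lambda>(p, q). (p, q, b)) (sw (\<Delta> a))) (sw (\<Delta> r)))) =
        tens3 s (concat (map (\<lambda>(a, b). map (\<lambda>(p, q). (a, p, q)) (sw (\<Delta> b))) (sw (\<Delta> r))))" for r
    proof (subst tens3_eq_iff_slices, intro allI impI)
      fix f :: "'a \<Rightarrow> 'k" assume f: "Vector_Spaces.linear s (*) f"
      let ?l = "\<lambda>u. \<Sum>(a, b, c)\<leftarrow>u. pure (s (f a) b) c"
      show "?l (concat (map (\<lambda>(a, b). map (\<lambda>(p, q). (p, q, b)) (sw (\<Delta> a))) (sw (\<Delta> r)))) =
        ?l (concat (map (\<lambda>(a, b). map (\<lambda>(p, q). (a, p, q)) (sw (\<Delta> b))) (sw (\<Delta> r))))"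
        unfolding slice_coproduct_lists[where \<Delta> = \<Delta>, OF add scale f total_D] total_D by (rule coassoc[OF f])
    qed
  qed
  then show ?thesis using Delta_eq by blast
qed

end

section \<open>Sweedler calculus and convolution\<close>

context hopf_algebra
begin

definition D :: "'a \<Rightarrow> ('a \<Rightarrow>\<^sub>0 'a) endo"
  where "D r = total (sw (\<Delta> r))"

lemma D_carr [simp]: "D r \<in> carr"
  by (simp add: D_def)

lemma tens_sw_Delta: "tens s (sw (\<Delta> r)) = \<Delta> r"
  by (rule tens_sw) (rule comult_closed)

lemma Delta_eq_iff: "\<Delta> r = tens s u \<longleftrightarrow> D r = total u"
  by (metis D_def tens_eq_iff_total tens_sw_Delta)

lemma D_add: "D (a + b) = D a + D b"
  by (simp add: D_def comult_add total_sw_tens)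

lemma D_scale: "D (s c a) = pure (s c 1) 1 * D a"
proof -
  have "total (map (\<lambda>(p, q). (s c p, q)) u) = pure (s c 1) 1 * total u" for u
    by (induction u) (auto simp: distrib_left pure_mult scale_mult_left)
  then show ?thesis by (simp add: D_def comult_scale total_sw_tens)
qed

lemma D_mult: "D (a * b) = D a * D b"
  by (simp add: D_def comult_mult tensor_mult_def total_sw_tens total_lmult)

lemma D_one: "D 1 = pure 1 1"
  by (simp add: D_def comult_one total_sw_tens)

lemma D_minus: "D (- a) = - D a"
  using D_add[of a "- a"] D_add[of 0 0] by (simp add: eq_neg_iff_add_eq_0 add.commute)

lemma D_diff: "D (a - b) = D a - D b"
  using D_add[of a "- b"] by (simp add: D_minus)

lemma lift_D: "bilin s \<phi> \<Longrightarrow> lift \<phi> (D r) = (\<Sum>(a, b)\<leftarrow>sw (\<Delta> r). \<phi> a b)"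
  by (simp add: D_def lift_total)

lemma counit_linear: "Vector_Spaces.linear s (*) \<epsilon>"
  using counit_hom by (simp add: algebra_hom_def)

lemma counit_add: "\<epsilon> (a + b) = \<epsilon> a + \<epsilon> b" and counit_scale: "\<epsilon> (s c a) = c * \<epsilon> a"
  using linearD[OF counit_linear] by auto

lemma counit_mult: "\<epsilon> (a * b) = \<epsilon> a * \<epsilon> b" and counit_one [simp]: "\<epsilon> 1 = 1"
  using counit_hom by (simp_all add: algebra_hom_def)

lemma counit_zero [simp]: "\<epsilon> 0 = 0"
  by (rule additive_zero) (rule counit_add)

lemma counit_minus: "\<epsilon> (- a) = - \<epsilon> a"
  using counit_add[of a "- a"] by (simp add: eq_neg_iff_add_eq_0 add.commute)

lemma S_add: "S (a + b) = S a + S b" and S_scale: "S (s c a) = s c (S a)"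
  using linearD[OF antipode_linear] by auto

lemmas hopf_linear_simps = counit_add counit_scale S_add S_scale scale_distrib distrib_left distrib_right scale_mult

lemma counit_left': "lift (\<lambda>a b. s (\<epsilon> a) b) (D r) = r"
  by (subst lift_D) (auto intro!: bilinI simp: hopf_linear_simps counit_left mult.commute)

lemma counit_right': "lift (\<lambda>a b. s (\<epsilon> b) a) (D r) = r"
  by (subst lift_D) (auto intro!: bilinI simp: hopf_linear_simps counit_right mult.commute)

lemma antipode_left': "lift (\<lambda>a b. S a * b) (D r) = s (\<epsilon> r) 1"
  by (subst lift_D) (auto intro!: bilinI simp: hopf_linear_simps antipode_left)

lemma antipode_right': "lift (\<lambda>a b. a * S b) (D r) = s (\<epsilon> r) 1"
  by (subst lift_D) (auto intro!: bilinI simp: hopf_linear_simps antipode_right)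

text \<open>Coassociativity inside an arbitrary trilinear Sweedler expression, with values in any
  abelian group.\<close>

lemma coassoc_lift:
  fixes \<phi> :: "'a \<Rightarrow> 'a \<Rightarrow> 'a \<Rightarrow> 'v::ab_group_add"
  assumes "trilin s \<phi>"
  shows "lift (\<lambda>a b. lift (\<lambda>p q. \<phi> p q b) (D a)) (D r) = lift (\<lambda>a b. lift (\<lambda>p q. \<phi> a p q) (D b)) (D r)"
proof -
  note b = trilin_bilin[OF assms] and t = trilinD[OF assms]
  have b1: "bilin s (\<lambda>a b. lift (\<lambda>p q. \<phi> p q b) (D a))"
    by (rule bilinI)
      (simp_all add: D_add lift_add[OF b(1)] t lift_fun_add D_scale lift_pure_mult[OF b(1)] scale_mult_left)
  have b2: "bilin s (\<lambda>a b. lift (\<lambda>p q. \<phi> a p q) (D b))"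
    by (rule bilinI)
      (simp_all add: D_add lift_add[OF b(2)] t lift_fun_add D_scale lift_pure_mult[OF b(2)] scale_mult_left)
  let ?l = "\<lambda>u. \<Sum>(a, b, c)\<leftarrow>u. \<phi> a b c"
  have c: "?l (concat (map g u)) = (\<Sum>p\<leftarrow>u. ?l (g p))" for g and u :: "('a \<times> 'a) list"
    by (induction u) simp_all
  have "?l (concat (map (\<lambda>(a, b). map (\<lambda>(p, q). (p, q, b)) (sw (\<Delta> a))) (sw (\<Delta> r))))
      = ?l (concat (map (\<lambda>(a, b). map (\<lambda>(p, q). (a, p, q)) (sw (\<Delta> b))) (sw (\<Delta> r))))"
    using coassoc[of r] unfolding tens3_eq_iff by (rule sum_trilinear) (simp_all add: t)
  then show ?thesis
    unfolding c lift_D[OF b1] lift_D[OF b2] unfolding lift_D[OF b(1)] lift_D[OF b(2)]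
    by (simp add: case_prod_unfold o_def)
qed

lemma lift_counit_left:
  assumes "\<And>a b. F (a + b) = F a + F b"
  shows "lift (\<lambda>a b. F (s (\<epsilon> a) b)) (D r) = F r"
  using lift_additive[where F = F, OF assms, of "\<lambda>a b. s (\<epsilon> a) b" "D r"] by (simp add: counit_left')

lemma lift_counit_right:
  assumes "\<And>a b. F (a + b) = F a + F b"
  shows "lift (\<lambda>a b. F (s (\<epsilon> b) a)) (D r) = F r"
  using lift_additive[where F = F, OF assms, of "\<lambda>a b. s (\<epsilon> b) a" "D r"] by (simp add: counit_right')

text \<open>The hypothesis says that the convolution of h with the identity is b \<mapsto>
  \<epsilon>(b) z. Convolving with S, the inverse of the identity, on the right isolates h.\<close>

lemma conv_cancel_right:
  assumes h: "Vector_Spaces.linear s s h" and eq: "\<And>b. lift (\<lambda>p q. h p * q) (D b) = s (\<epsilon> b) z"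
  shows "h b = z * S b"
proof -
  note hl = linearD[OF h]
  have "h b = lift (\<lambda>p q. h (s (\<epsilon> q) p)) (D b)"
    by (rule lift_counit_right[symmetric]) (rule hl)
  also have "\<dots> = lift (\<lambda>p q. h p * lift (\<lambda>c d. c * S d) (D q)) (D b)"
    by (simp add: antipode_right' hl scale_mult_right)
  also have "\<dots> = lift (\<lambda>p q. lift (\<lambda>c d. h p * c * S d) (D q)) (D b)"
    by (simp add: lift_const_left mult.assoc)
  also have "\<dots> = lift (\<lambda>p q. lift (\<lambda>c d. h c * d * S q) (D p)) (D b)"
    by (rule coassoc_lift[symmetric]) (rule trilinI; simp add: hl hopf_linear_simps)
  also have "\<dots> = lift (\<lambda>p q. z * S (s (\<epsilon> p) q)) (D b)"
    by (simp add: lift_const_right eq S_scale scale_mult)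
  also have "\<dots> = z * S b"
    by (rule lift_counit_left) (simp add: S_add distrib_left)
  finally show ?thesis .
qed

text \<open>Here the convolution inverse of the algebra map j is j \<circ> S; allowing another
  target algebra serves the inclusion of R into T.\<close>

lemma conv_cancel_left:
  fixes F :: "'a \<Rightarrow> 'b::ring_1"
  assumes B: "k_algebra sB" and j: "Vector_Spaces.linear s sB j" "\<And>a b. j (a * b) = j a * j b" "j 1 = 1"
    and F: "Vector_Spaces.linear s sB F" and eq: "\<And>r. lift (\<lambda>p q. j p * F q) (D r) = sB (\<epsilon> r) y"
  shows "F r = j (S r) * y"
proof -
  interpret B: k_algebra sB by (rule B)
  note jl = linearD[OF j(1)] and Fl = linearD[OF F]
  have "F r = lift (\<lambda>p q. F (s (\<epsilon> p) q)) (D r)"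
    by (rule lift_counit_left[symmetric]) (rule Fl)
  also have "\<dots> = lift (\<lambda>p q. j (lift (\<lambda>c d. S c * d) (D p)) * F q) (D r)"
    by (simp add: antipode_left' Fl jl j B.scale_mult_left)
  also have "\<dots> = lift (\<lambda>p q. lift (\<lambda>c d. j (S c) * (j d * F q)) (D p)) (D r)"
    unfolding lift_additive[where F = j, OF jl(1)] by (simp add: lift_const_right j mult.assoc[symmetric])
  also have "\<dots> = lift (\<lambda>p q. lift (\<lambda>c d. j (S p) * (j c * F d)) (D q)) (D r)"
    by (rule coassoc_lift)
      (rule trilinI; simp add: jl Fl S_add S_scale distrib_left distrib_right B.scale_mult)
  also have "\<dots> = lift (\<lambda>p q. j (S (s (\<epsilon> q) p)) * y) (D r)"
    by (simp add: lift_const_left eq jl S_scale B.scale_mult)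
  also have "\<dots> = j (S r) * y"
    by (rule lift_counit_right) (simp add: S_add jl distrib_right)
  finally show ?thesis .
qed

text \<open>The left antipode axiom at a b is a double sum of S(a1 b1) a2 b2. The factor b2 and then
  a2 are cancelled by convolution.\<close>

lemma antipode_mult: "S (a * b) = S b * S a"
proof -
  have bil: "bilin s (\<lambda>a b. S a * b)"
    by (rule bilinI) (simp_all add: hopf_linear_simps)
  have S_left: "Vector_Spaces.linear s s (\<lambda>a. S (a * b))" for b
    by (rule linearI[OF vector_space_axioms]) (simp_all add: hopf_linear_simps)
  have 1: "lift (\<lambda>p q. lift (\<lambda>c d. S (c * p) * d) (D a) * q) (D b) = s (\<epsilon> b) (s (\<epsilon> a) 1)" for a b
  proof -
    have "s (\<epsilon> b) (s (\<epsilon> a) 1) = lift (\<lambda>a b. S a * b) (D a * D b)"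
      by (simp add: D_mult[symmetric] antipode_left' counit_mult mult.commute)
    also have "\<dots> = lift (\<lambda>c d. lift (\<lambda>p q. S (c * p) * (d * q)) (D b)) (D a)"
      by (rule lift_mult[OF bil]) simp
    also have "\<dots> = lift (\<lambda>p q. lift (\<lambda>c d. S (c * p) * (d * q)) (D a)) (D b)"
      by (rule lift_swap[OF k_algebra_axioms])
    finally show ?thesis by (simp add: lift_const_right mult.assoc[symmetric])
  qed
  have 2: "lift (\<lambda>c d. S (c * b) * d) (D a) = s (\<epsilon> a) 1 * S b" for a b
  proof (rule conv_cancel_right[OF _ 1])
    show "Vector_Spaces.linear s s (\<lambda>b. lift (\<lambda>c d. S (c * b) * d) (D a))"
    proof (rule linearI[OF vector_space_axioms])
      fix b b' c
      show "lift (\<lambda>c d. S (c * (b + b')) * d) (D a) = lift (\<lambda>c d. S (c * b) * d) (D a) + lift (\<lambda>c d. S (c * b') * d) (D a)"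
        unfolding lift_fun_add[symmetric] by (simp only: distrib_left distrib_right S_add)
      show "lift (\<lambda>p d. S (p * s c b) * d) (D a) = s c (lift (\<lambda>p d. S (p * b) * d) (D a))"
        unfolding lift_additive[where F = "s c", OF scale_right_distrib]
        by (simp only: scale_mult_right scale_mult_left S_scale)
    qed
  qed
  show ?thesis
    by (rule conv_cancel_right[OF S_left]) (simp add: 2 scale_mult_left)
qed

lemma antipode_one: "S 1 = 1"
  using antipode_left'[of 1] by (subst (asm) D_one, subst (asm) lift_pure)
    (auto intro!: bilinI simp: hopf_linear_simps)

end

section \<open>The tensor square of an Ore extension\<close>

context k_algebra
begin

lemma lift_slices_eq_0:
  assumes "U \<in> carr" "\<And>f. Vector_Spaces.linear s (*) f \<Longrightarrow> lift (\<lambda>a b. s (f a) b) U = 0"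
  shows "U = 0"
proof -
  obtain u where u: "U = total u" using assms(1) by (auto simp: carr_def)
  have "formal_cong (bilinear_rel s) u []"
  proof (rule cong2_if_slices)
    fix f :: "'a \<Rightarrow> 'k" assume f: "Vector_Spaces.linear s (*) f"
    show "(\<Sum>(a, b)\<leftarrow>u. s (f a) b) = (\<Sum>(a, b)\<leftarrow>[]. s (f a) b)"
      using assms(2)[OF f] by (simp add: u lift_total bilin_slice[OF f])
  qed
  then show ?thesis using total_cong[of u "[]"] by (simp add: u)
qed

lemma bilin_flip: "bilin s \<phi> \<Longrightarrow> bilin s (\<lambda>a b. \<phi> b a)"
  by (rule bilinI) (simp_all add: bilinD)

lemma lift_slices_right_eq_0:
  assumes U: "U \<in> carr" and "\<And>f. Vector_Spaces.linear s (*) f \<Longrightarrow> lift (\<lambda>a b. s (f b) a) U = 0"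
  shows "U = 0"
proof -
  let ?flip = "lift (\<lambda>a b. pure b a)"
  note flip = bilin_flip[OF bilin_pure]
  have "?flip U = 0"
  proof (rule lift_slices_eq_0)
    fix f :: "'a \<Rightarrow> 'k" assume f: "Vector_Spaces.linear s (*) f"
    have "lift (\<lambda>a b. s (f a) b) (?flip U) = lift (\<lambda>a b. lift (\<lambda>a b. s (f a) b) (pure b a)) U"
      by (rule lift_additive) (rule lift_add[OF bilin_slice[OF f]])
    then show "lift (\<lambda>a b. s (f a) b) (?flip U) = 0"
      using assms(2)[OF f] by (simp add: lift_pure bilin_slice[OF f])
  qed (rule lift_in_carr[OF _ k_algebra_axioms], simp)
  moreover have "?flip (?flip U) = U"
    by (rule carr_eqI[OF U]) (simp_all add: lift_add[OF flip] lift_pure[OF flip])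
  ultimately show ?thesis by simp
qed

end

text \<open>The position (i, j) exceeds (n, m) lexicographically. \<open>True\<close> compares
  second degrees first, which serves the bound in the second factor; \<open>False\<close> serves the
  first factor.\<close>

definition lexlt :: "bool \<Rightarrow> nat \<Rightarrow> nat \<Rightarrow> nat \<Rightarrow> nat \<Rightarrow> bool"
  where "lexlt b n m i j \<longleftrightarrow> (if b then m < j \<or> m = j \<and> n < i else n < i \<or> n = i \<and> m < j)"

text \<open>The usual leading-monomial argument, with inequalities for p and q because commuting x
  past coefficients also produces terms of lower degree.\<close>

lemma lexlt_sum_unique:
  assumes "\<not> lexlt b n m i j" "\<not> lexlt b n' m' k l" "p \<le> i + k" "q \<le> j + l"
    and "lexlt b (n + n') (m + m') p q \<or> p = n + n' \<and> q = m + m'"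
  shows "i = n" "j = m" "k = n'" "l = m'" "p = n + n'" "q = m + m'"
  using assms by (auto simp: lexlt_def split: if_splits)

context ore
begin

definition emb :: "('r \<Rightarrow>\<^sub>0 'r) endo \<Rightarrow> ('t \<Rightarrow>\<^sub>0 't) endo"
  where "emb = R.lift (\<lambda>a b. T.pure (\<iota> a) (\<iota> b))"

text \<open>T \<otimes> T is a free left R \<otimes> R-module on the tensors x^i \<otimes> x^j; this
  is the coefficient of such a tensor.\<close>

definition tcf :: "nat \<Rightarrow> nat \<Rightarrow> ('t \<Rightarrow>\<^sub>0 't) endo \<Rightarrow> ('r \<Rightarrow>\<^sub>0 'r) endo"
  where "tcf i j = T.lift (\<lambda>a b. R.pure (cf i a) (cf j b))"

lemma bilin_emb: "bilin sR (\<lambda>a b. T.pure (\<iota> a) (\<iota> b))"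
  by (rule bilinI) (simp_all add: iota_add iota_scale T.pure_add T.pure_scale)

lemma bilin_tcf: "bilin sT (\<lambda>a b. R.pure (cf i a) (cf j b))"
  by (rule bilinI) (simp_all add: cf_add cf_scale R.pure_add R.pure_scale)

lemma emb_pure: "emb (R.pure a b) = T.pure (\<iota> a) (\<iota> b)"
  by (simp add: emb_def R.lift_pure bilin_emb)

lemma emb_add: "emb (U + V) = emb U + emb V"
  by (simp add: emb_def R.lift_add bilin_emb)

lemma emb_zero [simp]: "emb 0 = 0"
  by (simp add: emb_def)

lemma emb_carr [simp]: "emb U \<in> T.carr"
  unfolding emb_def by (rule R.lift_in_carr) (simp, unfold_locales)

lemma emb_mult: "U \<in> R.carr \<Longrightarrow> V \<in> R.carr \<Longrightarrow> emb (U * V) = emb U * emb V"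
proof (induction U rule: R.carr_induct)
  case (add a b U)
  have "emb (R.pure a b * V) = emb (R.pure a b) * emb V"
    by (rule R.carr_eqI[OF add(3)], simp_all add: distrib_left emb_add)
      (simp add: R.pure_mult emb_pure T.pure_mult iota_mult)
  with add show ?case by (simp add: distrib_right emb_add)
qed simp

lemma emb_total: "emb (R.total u) = T.total (map (map_prod \<iota> \<iota>) u)"
  by (induction u) (auto simp: emb_add emb_pure)

lemma tcf_pure: "tcf i j (T.pure a b) = R.pure (cf i a) (cf j b)"
  by (simp add: tcf_def T.lift_pure bilin_tcf)

lemma tcf_add: "tcf i j (U + V) = tcf i j U + tcf i j V"
  by (simp add: tcf_def T.lift_add bilin_tcf)

lemma tcf_zero [simp]: "tcf i j 0 = 0"
  by (simp add: tcf_def)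

lemma tcf_sum: "tcf i j (\<Sum>k\<in>K. U k) = (\<Sum>k\<in>K. tcf i j (U k))"
  by (simp add: tcf_def T.lift_sum bilin_tcf)

lemma tcf_carr [simp]: "tcf i j U \<in> R.carr"
  unfolding tcf_def by (rule T.lift_in_carr) (simp, unfold_locales)

lemma tcf_emb_mult:
  assumes "A \<in> R.carr"
  shows "tcf i j (emb A * V) = A * tcf i j V"
proof (rule R.carr_eqI[OF assms, where F = "\<lambda>A. tcf i j (emb A * V)" and G = "\<lambda>A. A * tcf i j V"])
  show "tcf i j (emb (R.pure a b) * V) = R.pure a b * tcf i j V" for a b
    unfolding emb_pure tcf_def T.lift_pure_mult[OF bilin_tcf] cf_left R.pure_mult[symmetric]
    by (rule T.lift_const_left)
qed (simp_all add: emb_add distrib_right tcf_add)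

lemma tcf_emb: "A \<in> R.carr \<Longrightarrow> tcf i j (emb A) = (if i = 0 \<and> j = 0 then A else 0)"
  by (rule R.carr_eqI[where F = "\<lambda>A. tcf i j (emb A)" and G = "\<lambda>A. if i = 0 \<and> j = 0 then A else 0"])
    (simp_all add: emb_add tcf_add emb_pure tcf_pure cf_iota)

lemma emb_eq_iff: "A \<in> R.carr \<Longrightarrow> B \<in> R.carr \<Longrightarrow> emb A = emb B \<longleftrightarrow> A = B"
  by (auto dest: arg_cong[of _ _ "tcf 0 0"] simp: tcf_emb)

definition mon :: "nat \<Rightarrow> nat \<Rightarrow> ('t \<Rightarrow>\<^sub>0 't) endo"
  where "mon i j = T.pure (x ^ i) (x ^ j)"

lemma mon_carr [simp]: "mon i j \<in> T.carr"
  by (simp add: mon_def)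

lemma tcf_mon: "tcf i j (mon k l) = (if i = k \<and> j = l then R.pure 1 1 else 0)"
  by (simp add: mon_def tcf_pure cf_x_power)

lemma tcf_emb_mon: "A \<in> R.carr \<Longrightarrow> tcf i j (emb A * mon k l) = (if i = k \<and> j = l then A else 0)"
  by (simp add: tcf_emb_mult tcf_mon)

text \<open>Asking for all large N, not for one, lets expansions of two tensors be brought to a
  common bound.\<close>

lemma tensor_expand_aux:
  "U \<in> T.carr \<Longrightarrow> \<exists>M. \<forall>N\<ge>M. U = (\<Sum>i\<le>N. \<Sum>j\<le>N. emb (tcf i j U) * mon i j)"
proof (induction rule: T.carr_induct)
  case (add a b U)
  then obtain M where M: "U = (\<Sum>i\<le>N. \<Sum>j\<le>N. emb (tcf i j U) * mon i j)" if "N \<ge> M" for N by blast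
  obtain n m where n: "\<forall>i>n. cf i a = 0" and m: "\<forall>i>m. cf i b = 0" using cf_bounded by metis
  have "T.pure a b + U = (\<Sum>i\<le>N. \<Sum>j\<le>N. emb (tcf i j (T.pure a b + U)) * mon i j)"
    if N: "N \<ge> max M (max n m)" for N
  proof -
    have sl: "T.pure (\<Sum>i\<in>I. f i) c = (\<Sum>i\<in>I. T.pure (f i) c)" for f :: "nat \<Rightarrow> 't" and I c
      by (rule additive_sum[where F = "\<lambda>z. T.pure z c"]) (rule T.pure_add_left)
    have sr: "T.pure c (\<Sum>i\<in>I. f i) = (\<Sum>i\<in>I. T.pure c (f i))" for f :: "nat \<Rightarrow> 't" and I c
      by (rule additive_sum[where F = "\<lambda>z. T.pure c z"]) (rule T.pure_add_right)
    have a: "a = (\<Sum>i\<le>N. \<iota> (cf i a) * x ^ i)" and b: "b = (\<Sum>j\<le>N. \<iota> (cf j b) * x ^ j)"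
      using N n m by (auto intro!: cf_expand)
    have "T.pure a b = (\<Sum>i\<le>N. \<Sum>j\<le>N. T.pure (\<iota> (cf i a) * x ^ i) (\<iota> (cf j b) * x ^ j))"
      by (subst a, subst b, unfold sl sr) (rule sum.swap)
    also have "\<dots> = (\<Sum>i\<le>N. \<Sum>j\<le>N. emb (tcf i j (T.pure a b)) * mon i j)"
      by (simp add: tcf_pure emb_pure mon_def T.pure_mult)
    finally show ?thesis
      using M[of N] N by (simp add: tcf_add emb_add distrib_right sum.distrib)
  qed
  then show ?case by blast
qed simp

lemma tcf_eqI:
  assumes "U \<in> T.carr" "V \<in> T.carr" "\<And>i j. tcf i j U = tcf i j V"
  shows "U = V"
proof -
  obtain M where M: "U = (\<Sum>i\<le>N. \<Sum>j\<le>N. emb (tcf i j U) * mon i j)" if "N \<ge> M" for N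
    using tensor_expand_aux[OF assms(1)] by blast
  obtain M' where M': "V = (\<Sum>i\<le>N. \<Sum>j\<le>N. emb (tcf i j V) * mon i j)" if "N \<ge> M'" for N
    using tensor_expand_aux[OF assms(2)] by blast
  show ?thesis
    using M[of "max M M'"] M'[of "max M M'"] assms(3) by simp
qed

lemma tcf_bounded:
  assumes "U \<in> T.carr"
  shows "\<exists>N. \<forall>i j. i > N \<or> j > N \<longrightarrow> tcf i j U = 0"
proof -
  obtain M where "\<forall>N\<ge>M. U = (\<Sum>i\<le>N. \<Sum>j\<le>N. emb (tcf i j U) * mon i j)"
    using tensor_expand_aux[OF assms] by blast
  then have M: "U = (\<Sum>i\<le>M. \<Sum>j\<le>M. emb (tcf i j U) * mon i j)" by blast
  have "tcf p q U = 0" if "p > M \<or> q > M" for p q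
  proof -
    have "tcf p q (\<Sum>i\<le>M. \<Sum>j\<le>M. emb (tcf i j U) * mon i j) = 0"
      using that by (auto simp: tcf_sum tcf_emb_mon intro!: sum.neutral)
    then show ?thesis using M by simp
  qed
  then show ?thesis by blast
qed

lemma tensor_expand:
  assumes "U \<in> T.carr" "\<And>i j. i > N \<or> j > N \<Longrightarrow> tcf i j U = 0"
  shows "U = (\<Sum>i\<le>N. \<Sum>j\<le>N. emb (tcf i j U) * mon i j)"
proof (rule tcf_eqI)
  show "(\<Sum>i\<le>N. \<Sum>j\<le>N. emb (tcf i j U) * mon i j) \<in> T.carr"
    by (intro T.carr_sum T.carr_mult) simp_all
  fix p q
  have "tcf p q (\<Sum>i\<le>N. \<Sum>j\<le>N. emb (tcf i j U) * mon i j) =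
      (\<Sum>i\<le>N. \<Sum>j\<le>N. if p = i \<and> q = j then tcf i j U else 0)"
    by (simp add: tcf_sum tcf_emb_mon)
  also have "\<dots> = (\<Sum>i\<le>N. if p = i then (\<Sum>j\<le>N. if q = j then tcf i j U else 0) else 0)"
    by (intro sum.cong) auto
  also have "\<dots> = tcf p q U"
    using assms(2)[of p q] by (auto simp: not_le)
  finally show "tcf p q U = tcf p q (\<Sum>i\<le>N. \<Sum>j\<le>N. emb (tcf i j U) * mon i j)" ..
qed (rule assms)

section \<open>Leading coefficients in the tensor square of T\<close>

lemma sigma_power_add: "(\<sigma> ^^ n) (a + b) = (\<sigma> ^^ n) a + (\<sigma> ^^ n) b"
  by (induction n) (auto simp: sigma_add)

lemma sigma_power_scale: "(\<sigma> ^^ n) (sR c a) = sR c ((\<sigma> ^^ n) a)"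
  by (induction n) (auto simp: sigma_scale)

definition twist :: "nat \<Rightarrow> nat \<Rightarrow> ('r \<Rightarrow>\<^sub>0 'r) endo \<Rightarrow> ('r \<Rightarrow>\<^sub>0 'r) endo"
  where "twist n m = R.lift (\<lambda>a b. R.pure ((\<sigma> ^^ n) a) ((\<sigma> ^^ m) b))"

lemma bilin_twist: "bilin sR (\<lambda>a b. R.pure ((\<sigma> ^^ n) a) ((\<sigma> ^^ m) b))"
  by (rule bilinI)
    (simp_all add: sigma_power_add sigma_power_scale R.pure_add R.pure_scale)

lemma twist_pure: "twist n m (R.pure a b) = R.pure ((\<sigma> ^^ n) a) ((\<sigma> ^^ m) b)"
  by (simp add: twist_def R.lift_pure bilin_twist)

lemma twist_add: "twist n m (U + V) = twist n m U + twist n m V"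
  by (simp add: twist_def R.lift_add bilin_twist)

lemma twist_carr [simp]: "twist n m U \<in> R.carr"
  unfolding twist_def by (rule R.lift_in_carr) (simp, unfold_locales)

lemma twist_eq_0:
  assumes "U \<in> R.carr" "twist n m U = 0"
  shows "U = 0"
proof -
  let ?inv = "\<lambda>n. inv (\<sigma> ^^ n)"
  have bij: "bij (\<sigma> ^^ n)" for n using bij_sigma by (rule bij_fn)
  have inv: "?inv n ((\<sigma> ^^ n) a) = a" "(\<sigma> ^^ n) (?inv n a) = a" for n a
    using bij[of n] by (auto simp: bij_def surj_f_inv_f)
  have inv_add: "?inv n (a + b) = ?inv n a + ?inv n b" for n a b
    using inv(1)[of n "?inv n a + ?inv n b"] by (simp add: sigma_power_add inv(2))
  have inv_scale: "?inv n (sR c a) = sR c (?inv n a)" for n a c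
    using inv(1)[of n "sR c (?inv n a)"] by (simp add: sigma_power_scale inv(2))
  have b: "bilin sR (\<lambda>a b. R.pure (?inv n a) (?inv m b))"
    by (rule bilinI) (simp_all add: inv_add inv_scale R.pure_add R.pure_scale)
  have "R.lift (\<lambda>a b. R.pure (?inv n a) (?inv m b)) (twist n m U) = U"
    by (rule R.carr_eqI[OF assms(1)])
      (simp_all add: twist_add R.lift_add[OF b] R.lift_pure[OF b] twist_pure inv)
  with assms(2) show ?thesis by simp
qed

text \<open>Moving x^i \<otimes> x^j past a coefficient applies \<sigma>^i \<otimes> \<sigma>^j to
  it; every term with a \<delta> drops in degree.\<close>

lemma tcf_mon_emb:
  assumes "B \<in> R.carr"
  shows "p > i + k \<or> q > j + l \<Longrightarrow> tcf p q (mon i j * (emb B * mon k l)) = 0"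
    and "tcf (i + k) (j + l) (mon i j * (emb B * mon k l)) = twist i j B"
proof -
  have lead: "leads (i + k) (x ^ i * (\<iota> a * x ^ k)) ((\<sigma> ^^ i) a)" for i k a
    by (rule leads_x_power) (simp add: leads_def cf_monom)
  have "tcf p q (mon i j * (emb (R.pure a b) * mon k l)) =
      R.pure (cf p (x ^ i * (\<iota> a * x ^ k))) (cf q (x ^ j * (\<iota> b * x ^ l)))" for p q a b
    by (simp add: mon_def emb_pure T.pure_mult tcf_pure)
  note * = this
  show "p > i + k \<or> q > j + l \<Longrightarrow> tcf p q (mon i j * (emb B * mon k l)) = 0"
    using lead by (intro R.carr_eqI[OF assms, where G = "\<lambda>_. 0" and F = "\<lambda>B. tcf p q (mon i j * (emb B * mon k l))"])
      (auto simp: emb_add distrib_left distrib_right tcf_add * leads_def)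
  show "tcf (i + k) (j + l) (mon i j * (emb B * mon k l)) = twist i j B"
    using lead by (intro R.carr_eqI[OF assms, where G = "twist i j" and F = "\<lambda>B. tcf (i + k) (j + l) (mon i j * (emb B * mon k l))"])
      (auto simp: emb_add distrib_left distrib_right tcf_add * leads_def twist_pure twist_add)
qed

definition tleads :: "bool \<Rightarrow> nat \<Rightarrow> nat \<Rightarrow> ('t \<Rightarrow>\<^sub>0 't) endo \<Rightarrow> ('r \<Rightarrow>\<^sub>0 'r) endo \<Rightarrow> bool"
  where "tleads b n m U A \<longleftrightarrow> tcf n m U = A \<and> (\<forall>i j. lexlt b n m i j \<longrightarrow> tcf i j U = 0)"

text \<open>In the double expansion of U V, only the product of the two leading monomials can reach
  the position (n + n', m + m'), and nothing lies above it.\<close>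

lemma tleads_mult:
  assumes U: "U \<in> T.carr" "tleads b n m U A" and V: "V \<in> T.carr" "tleads b n' m' V B"
  shows "tleads b (n + n') (m + m') (U * V) (A * twist n m B)"
proof -
  obtain N where N: "\<And>i j. i > N \<or> j > N \<Longrightarrow> tcf i j U = 0" using tcf_bounded[OF U(1)] by blast
  obtain M where M: "\<And>i j. i > M \<or> j > M \<Longrightarrow> tcf i j V = 0" using tcf_bounded[OF V(1)] by blast
  define W where "W p q = (\<lambda>(i, j). \<lambda>(k, l).
    tcf i j U * tcf p q (mon i j * (emb (tcf k l V) * mon k l)))" for p q
  let ?I = "{..N} \<times> {..N}" and ?K = "{..M} \<times> {..M}"
  have prod: "tcf p q (U * V) = (\<Sum>e\<in>?I. \<Sum>e'\<in>?K. W p q e e')" for p q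
  proof -
    have "U = (\<Sum>e\<in>?I. emb (tcf (fst e) (snd e) U) * mon (fst e) (snd e))"
      by (subst tensor_expand[OF U(1) N]) (simp_all add: sum.cartesian_product split_beta)
    moreover have "V = (\<Sum>e\<in>?K. emb (tcf (fst e) (snd e) V) * mon (fst e) (snd e))"
      by (subst tensor_expand[OF V(1) M]) (simp_all add: sum.cartesian_product split_beta)
    ultimately have "tcf p q (U * V) = tcf p q ((\<Sum>e\<in>?I. emb (tcf (fst e) (snd e) U) * mon (fst e) (snd e)) *
        (\<Sum>e\<in>?K. emb (tcf (fst e) (snd e) V) * mon (fst e) (snd e)))" by simp
    then show ?thesis
      by (simp add: sum_distrib_left sum_distrib_right tcf_sum mult.assoc tcf_emb_mult W_def split_beta)
        (rule sum.swap)
  qed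
  have zero: "W p q (i, j) (k, l) = 0"
    if "\<not> (i = n \<and> j = m \<and> k = n' \<and> l = m' \<and> p = n + n' \<and> q = m + m')"
      and "lexlt b (n + n') (m + m') p q \<or> p = n + n' \<and> q = m + m'" for p q i j k l
  proof (rule ccontr)
    assume nz: "W p q (i, j) (k, l) \<noteq> 0"
    then have "tcf i j U \<noteq> 0" "tcf k l V \<noteq> 0" by (auto simp: W_def)
    then have 1: "\<not> lexlt b n m i j" "\<not> lexlt b n' m' k l"
      using U V by (auto simp: tleads_def)
    have "tcf p q (mon i j * (emb (tcf k l V) * mon k l)) \<noteq> 0"
      using nz by (auto simp: W_def)
    then have 2: "p \<le> i + k" "q \<le> j + l"
      using tcf_mon_emb(1)[OF tcf_carr[of k l V]] by (meson not_le)+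
    show False using lexlt_sum_unique[OF 1 2 that(2)] that(1) by auto
  qed
  have "tcf p q (U * V) = 0" if "lexlt b (n + n') (m + m') p q" for p q
    unfolding prod
  proof (intro sum.neutral ballI)
    fix e e' show "W p q e e' = 0"
      using that zero[of "fst e" "snd e" "fst e'" "snd e'" p q] by (auto simp: lexlt_def split: if_splits)
  qed
  moreover have "tcf (n + n') (m + m') (U * V) = A * twist n m B"
  proof -
    let ?p = "n + n'" and ?q = "m + m'"
    have "W ?p ?q (n, m) (n', m') = A * twist n m B"
      using U V tcf_mon_emb(2)[OF tcf_carr[of n' m' V]] by (auto simp: W_def tleads_def)
    moreover have "W ?p ?q e e' = 0" if "e \<noteq> (n, m) \<or> e' \<noteq> (n', m')" for e e'
      using zero[of "fst e" "snd e" "fst e'" "snd e'" ?p ?q] that by (cases e; cases e') auto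
    \<comment> \<open>A leading coefficient may be 0, and then its position can lie outside the
      summation range.\<close>
    moreover have "(n, m) \<in> ?I \<or> W ?p ?q (n, m) (n', m') = 0"
      using N[of n m] by (cases "n \<le> N \<and> m \<le> N") (auto simp: W_def not_le)
    moreover have "(n', m') \<in> ?K \<or> W ?p ?q (n, m) (n', m') = 0"
      using M[of n' m'] by (cases "n' \<le> M \<and> m' \<le> M") (auto simp: W_def not_le)
    moreover have "(\<Sum>e\<in>?I. \<Sum>e'\<in>?K. W ?p ?q e e') = (if (n, m) \<in> ?I \<and> (n', m') \<in> ?K then W ?p ?q (n, m) (n', m') else 0)"
    proof -
      have "(\<Sum>e\<in>?I. \<Sum>e'\<in>?K. W ?p ?q e e') =
          (\<Sum>e\<in>?I. \<Sum>e'\<in>?K. if e' = (n', m') then (if e = (n, m) then W ?p ?q (n, m) (n', m') else 0) else 0)"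
        using calculation(2) by (intro sum.cong) auto
      also have "\<dots> = (if (n, m) \<in> ?I \<and> (n', m') \<in> ?K then W ?p ?q (n, m) (n', m') else 0)"
        by (cases "(n', m') \<in> ?K"; cases "(n, m) \<in> ?I") (auto simp: sum.delta intro!: sum.neutral)
      finally show ?thesis .
    qed
    ultimately show ?thesis unfolding prod by (auto split: if_splits)
  qed
  ultimately show ?thesis by (auto simp: tleads_def)
qed

end

section \<open>The degree of the coproduct of the variable\<close>

lemma (in k_algebra) lift_fun_zero [simp]: "lift (\<lambda>a b. 0) U = 0"
  by (simp add: lift_def contract_def)

lemma greatest_natE:
  fixes k :: nat
  assumes "P k" "\<And>y. P y \<Longrightarrow> y \<le> N"
  obtains m where "P m" "k \<le> m" "\<forall>y>m. \<not> P y"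
proof
  show "P (GREATEST y. P y)" using assms by (rule GreatestI_nat)
  show "k \<le> (GREATEST y. P y)" using assms by (rule Greatest_le_nat)
  show "\<forall>y>GREATEST y. P y. \<not> P y"
    using Greatest_le_nat[of P _ N] assms(2) by (meson not_le)
qed

locale hopf_ore = ore sR sT \<iota> x \<sigma> \<delta> + H: hopf_algebra sR \<Delta> \<epsilon> S
  for sR :: "'k::field \<Rightarrow> 'r::ring_1 \<Rightarrow> 'r" and sT :: "'k \<Rightarrow> 't::ring_1 \<Rightarrow> 't"
    and \<iota> :: "'r \<Rightarrow> 't" and x :: 't and \<sigma> \<delta> :: "'r \<Rightarrow> 'r" and \<Delta> \<epsilon> S
begin

definition epsl :: "('r \<Rightarrow>\<^sub>0 'r) endo \<Rightarrow> 'r"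
  where "epsl = R.lift (\<lambda>a b. sR (\<epsilon> a) b)"

definition epsr :: "('r \<Rightarrow>\<^sub>0 'r) endo \<Rightarrow> 'r"
  where "epsr = R.lift (\<lambda>a b. sR (\<epsilon> b) a)"

lemma bilin_epsl: "bilin sR (\<lambda>a b. sR (\<epsilon> a) b)"
  by (rule R.bilin_slice) (rule H.counit_linear)

lemma bilin_epsr: "bilin sR (\<lambda>a b. sR (\<epsilon> b) a)"
  by (rule R.bilin_flip[OF bilin_epsl])

lemma epsl_pure: "epsl (R.pure a b) = sR (\<epsilon> a) b" and epsr_pure: "epsr (R.pure a b) = sR (\<epsilon> b) a"
  by (simp_all add: epsl_def epsr_def R.lift_pure bilin_epsl bilin_epsr)

lemma epsl_add: "epsl (U + V) = epsl U + epsl V" and epsr_add: "epsr (U + V) = epsr U + epsr V"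
  by (simp_all add: epsl_def epsr_def R.lift_add bilin_epsl bilin_epsr)

lemma eps_zero [simp]: "epsl 0 = 0" "epsr 0 = 0"
  by (simp_all add: epsl_def epsr_def)

lemma epsl_D [simp]: "epsl (H.D r) = r" and epsr_D [simp]: "epsr (H.D r) = r"
  by (simp_all add: epsl_def epsr_def H.counit_left' H.counit_right')

lemma eps_mult:
  assumes "U \<in> R.carr"
  shows epsl_mult: "epsl (U * V) = epsl U * epsl V" and epsr_mult: "epsr (U * V) = epsr U * epsr V"
  unfolding epsl_def epsr_def
  by (rule R.lift_mult_hom[OF _ _ assms];
      simp add: bilin_epsl bilin_epsr H.counit_mult R.scale_mult mult.commute)+

end

locale hopf_ore_ext = hopf_ore sR sT \<iota> x \<sigma> \<delta> \<Delta> \<epsilon> S + HT: hopf_algebra sT \<Delta>T \<epsilon>T ST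
  for sR :: "'k::field \<Rightarrow> 'r::ring_1 \<Rightarrow> 'r" and sT :: "'k \<Rightarrow> 't::ring_1 \<Rightarrow> 't"
    and \<iota> :: "'r \<Rightarrow> 't" and x :: 't and \<sigma> \<delta> :: "'r \<Rightarrow> 'r" and \<Delta> \<epsilon> S \<Delta>T \<epsilon>T ST +
  assumes dom: "tensor_square_domain sR"
    and comult_ext: "\<And>r. \<Delta>T (\<iota> r) = tens sT (map (map_prod \<iota> \<iota>) (sw (\<Delta> r)))"
    and counit_ext: "\<And>r. \<epsilon>T (\<iota> r) = \<epsilon> r"
    and antipode_ext: "\<And>r. ST (\<iota> r) = \<iota> (S r)"
begin

lemma tensor_one_ne_0: "R.pure 1 1 \<noteq> 0"
  using dom unfolding tensor_square_domain_def R.tens_eq_iff_total by simp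

lemma tensor_domain:
  assumes "U \<in> R.carr" "V \<in> R.carr" "U * V = 0"
  shows "U = 0 \<or> V = 0"
proof -
  obtain u v where u: "U = R.total u" and v: "V = R.total v" using assms by (auto simp: R.carr_def)
  have "R.total (lmult u v) = R.total []" using assms(3) by (simp add: R.total_lmult u v)
  then have "tensor_mult sR (tens sR u) (tens sR v) = tens sR []"
    by (simp only: R.tensor_mult_tens R.tens_eq_iff_total)
  then have "tens sR u = tens sR [] \<or> tens sR v = tens sR []"
    using dom by (auto simp: tensor_square_domain_def tensors_def)
  then show ?thesis by (simp add: R.tens_eq_iff_total u v)
qed

text \<open>The map a \<mapsto> a \<otimes> 1 is multiplicative, and applying \<epsilon> to the
  second factor inverts it on the left.\<close>

lemma base_domain:
  assumes "a * b = (0 :: 'r)"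
  shows "a = 0 \<or> b = 0"
proof -
  have "R.pure a 1 * R.pure b 1 = 0" using assms by (simp add: R.pure_mult)
  then have "R.pure a 1 = 0 \<or> R.pure b 1 = 0" by (intro tensor_domain) simp_all
  then show ?thesis using epsr_pure[of a 1] epsr_pure[of b 1] by auto
qed

lemma DT_iota: "HT.D (\<iota> r) = emb (H.D r)"
  unfolding H.D_def emb_total using comult_ext[of r] by (simp add: HT.Delta_eq_iff)

section \<open>Contractions of the coproduct by functionals\<close>

definition contrl :: "('t \<Rightarrow> 'k) \<Rightarrow> 't \<Rightarrow> 't"
  where "contrl f t = T.lift (\<lambda>p q. sT (f p) q) (HT.D t)"

definition contrr :: "('t \<Rightarrow> 'k) \<Rightarrow> 't \<Rightarrow> 't"
  where "contrr f t = T.lift (\<lambda>p q. sT (f q) p) (HT.D t)"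

context
  fixes f :: "'t \<Rightarrow> 'k" assumes f: "Vector_Spaces.linear sT (*) f"
begin

lemmas f_simps = T.linearD[OF f]

lemma bilin_contrl: "bilin sT (\<lambda>p q. sT (f p) q)"
  by (rule T.bilin_slice[OF f])

lemma bilin_contrr: "bilin sT (\<lambda>p q. sT (f q) p)"
  by (rule T.bilin_flip[OF bilin_contrl])

lemma contrl_add: "contrl f (a + b) = contrl f a + contrl f b"
  by (simp add: contrl_def HT.D_add T.lift_add bilin_contrl)

lemma contrr_add: "contrr f (a + b) = contrr f a + contrr f b"
  by (simp add: contrr_def HT.D_add T.lift_add bilin_contrr)

lemma contrl_scale: "contrl f (sT c a) = sT c (contrl f a)"
proof -
  have "contrl f (sT c a) = T.lift (\<lambda>p q. sT c (sT (f p) q)) (HT.D a)"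
    by (simp add: contrl_def HT.D_scale T.lift_pure_mult bilin_contrl T.scale_mult_left f_simps)
  then show ?thesis
    unfolding contrl_def T.lift_additive[where F = "sT c", OF T.scale_right_distrib] .
qed

lemma contrr_scale: "contrr f (sT c a) = sT c (contrr f a)"
proof -
  have "contrr f (sT c a) = T.lift (\<lambda>p q. sT c (sT (f q) p)) (HT.D a)"
    by (simp add: contrr_def HT.D_scale T.lift_pure_mult bilin_contrr T.scale_mult_left f_simps mult.commute)
  then show ?thesis
    unfolding contrr_def T.lift_additive[where F = "sT c", OF T.scale_right_distrib] .
qed

text \<open>Coassociativity with the first of three factors contracted. The second factor of
  \<Delta>(t) survives untouched, which is what the degree bound exploits.\<close>

lemma D_contrl: "HT.D (contrl f t) = T.lift (\<lambda>a b. T.pure (contrl f a) b) (HT.D t)"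
proof -
  have "T.lift (\<lambda>a b. T.lift (\<lambda>p q. T.pure (sT (f p) q) b) (HT.D a)) (HT.D t) =
      T.lift (\<lambda>a b. T.lift (\<lambda>p q. T.pure (sT (f a) p) q) (HT.D b)) (HT.D t)"
    by (rule HT.coassoc_lift, rule trilinI)
      (simp_all add: f_simps T.pure_add T.scale_distrib
        T.pure_scale mult.commute)
  moreover have "T.lift (\<lambda>p q. T.pure (sT (f p) q) b) (HT.D a) = T.pure (contrl f a) b" for a b
    unfolding contrl_def by (rule T.lift_additive[where F = "\<lambda>z. T.pure z b", symmetric]) (rule T.pure_add_left)
  moreover have "T.lift (\<lambda>p q. T.pure (sT (f a) p) q) (HT.D b) = HT.D (sT (f a) b)" for a b
    by (simp add: HT.D_scale T.lift_pure_scale)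
  moreover have "HT.D (contrl f t) = T.lift (\<lambda>a b. HT.D (sT (f a) b)) (HT.D t)"
    unfolding contrl_def by (rule T.lift_additive) (rule HT.D_add)
  ultimately show ?thesis by simp
qed

lemma D_contrr: "HT.D (contrr f t) = T.lift (\<lambda>a b. T.pure a (contrr f b)) (HT.D t)"
proof -
  have "T.lift (\<lambda>a b. T.lift (\<lambda>p q. T.pure p (sT (f b) q)) (HT.D a)) (HT.D t) =
      T.lift (\<lambda>a b. T.lift (\<lambda>p q. T.pure a (sT (f q) p)) (HT.D b)) (HT.D t)"
    by (rule HT.coassoc_lift, rule trilinI)
      (simp_all add: f_simps T.pure_add T.scale_distrib
        T.pure_scale mult.commute)
  moreover have "T.lift (\<lambda>p q. T.pure a (sT (f q) p)) (HT.D b) = T.pure a (contrr f b)" for a b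
    unfolding contrr_def by (rule T.lift_additive[where F = "T.pure a", symmetric]) (rule T.pure_add_right)
  moreover have "T.lift (\<lambda>p q. T.pure p (sT (f b) q)) (HT.D a) = HT.D (sT (f b) a)" for a b
    by (simp add: HT.D_scale T.lift_pure_scale T.pure_scale[symmetric])
  moreover have "HT.D (contrr f t) = T.lift (\<lambda>a b. HT.D (sT (f b) a)) (HT.D t)"
    unfolding contrr_def by (rule T.lift_additive) (rule HT.D_add)
  ultimately show ?thesis by simp
qed

text \<open>Coassociativity with the middle factor contracted.\<close>

lemma contr_middle:
  "T.lift (\<lambda>a b. T.pure (contrr f a) b) (HT.D t) = T.lift (\<lambda>a b. T.pure a (contrl f b)) (HT.D t)"
proof -
  have "T.lift (\<lambda>a b. T.lift (\<lambda>p q. T.pure (sT (f q) p) b) (HT.D a)) (HT.D t) =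
      T.lift (\<lambda>a b. T.lift (\<lambda>p q. T.pure (sT (f p) a) q) (HT.D b)) (HT.D t)"
    by (rule HT.coassoc_lift, rule trilinI)
      (simp_all add: f_simps T.pure_add T.scale_distrib
        T.pure_scale mult.commute)
  moreover have "T.lift (\<lambda>p q. T.pure (sT (f q) p) b) (HT.D a) = T.pure (contrr f a) b" for a b
    unfolding contrr_def by (rule T.lift_additive[where F = "\<lambda>z. T.pure z b", symmetric]) (rule T.pure_add_left)
  moreover have "T.lift (\<lambda>p q. T.pure (sT (f p) a) q) (HT.D b) = T.pure a (contrl f b)" for a b
    unfolding contrl_def T.pure_scale
    by (rule T.lift_additive[where F = "T.pure a", symmetric]) (rule T.pure_add_right)
  ultimately show ?thesis by simp
qed

end

text \<open>The coefficient of x^j is taken in the second factor only and put back into T, so that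
  functionals on T still apply to the first factor.\<close>

definition slotr :: "nat \<Rightarrow> ('t \<Rightarrow>\<^sub>0 't) endo \<Rightarrow> ('t \<Rightarrow>\<^sub>0 't) endo"
  where "slotr j = T.lift (\<lambda>a b. T.pure a (\<iota> (cf j b)))"

definition slotl :: "nat \<Rightarrow> ('t \<Rightarrow>\<^sub>0 't) endo \<Rightarrow> ('t \<Rightarrow>\<^sub>0 't) endo"
  where "slotl i = T.lift (\<lambda>a b. T.pure (\<iota> (cf i a)) b)"

lemma slot_carr [simp]: "slotr j U \<in> T.carr" "slotl i U \<in> T.carr"
  unfolding slotr_def slotl_def by (rule T.lift_in_carr; (simp | unfold_locales))+

lemma tcf_slotr: "tcf i l (slotr j U) = (if l = 0 then tcf i j U else 0)"
proof -
  have "tcf i l (slotr j U) = T.lift (\<lambda>a b. tcf i l (T.pure a (\<iota> (cf j b)))) U"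
    unfolding slotr_def by (rule T.lift_additive) (rule tcf_add)
  then show ?thesis by (cases "l = 0") (simp_all add: tcf_pure cf_iota, simp add: tcf_def)
qed

lemma tcf_slotl: "tcf l j (slotl i U) = (if l = 0 then tcf i j U else 0)"
proof -
  have "tcf l j (slotl i U) = T.lift (\<lambda>a b. tcf l j (T.pure (\<iota> (cf i a)) b)) U"
    unfolding slotl_def by (rule T.lift_additive) (rule tcf_add)
  then show ?thesis by (cases "l = 0") (simp_all add: tcf_pure cf_iota, simp add: tcf_def)
qed

lemma slotr_eq_0: "(\<And>i. tcf i j U = 0) \<Longrightarrow> slotr j U = 0"
  by (rule tcf_eqI) (simp_all add: tcf_slotr)

lemma slotl_eq_0: "(\<And>j. tcf i j U = 0) \<Longrightarrow> slotl i U = 0"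
  by (rule tcf_eqI) (simp_all add: tcf_slotl)

lemma lift_slotr: "bilin sT \<phi> \<Longrightarrow> T.lift \<phi> (slotr j U) = T.lift (\<lambda>a b. \<phi> a (\<iota> (cf j b))) U"
  unfolding slotr_def T.lift_additive[where F = "T.lift \<phi>", OF T.lift_add] by (simp add: T.lift_pure)

lemma lift_slotl: "bilin sT \<phi> \<Longrightarrow> T.lift \<phi> (slotl i U) = T.lift (\<lambda>a b. \<phi> (\<iota> (cf i a)) b) U"
  unfolding slotl_def T.lift_additive[where F = "T.lift \<phi>", OF T.lift_add] by (simp add: T.lift_pure)

text \<open>The leading coefficient of a power is a product of twisted copies of A; it stays nonzero
  since twists are injective and R \<otimes> R is a domain.\<close>

lemma D_x_power_leads:
  assumes "tleads b n m (HT.D x) A" "A \<noteq> 0"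
  shows "\<exists>B\<in>R.carr. B \<noteq> 0 \<and> tleads b (d * n) (d * m) (HT.D (x ^ d)) B"
proof (induction d)
  case 0
  have "tleads b 0 0 (T.pure 1 1) (R.pure 1 1)"
    using tcf_mon[of _ _ 0 0] by (auto simp: tleads_def mon_def lexlt_def split: if_splits)
  then show ?case using tensor_one_ne_0 by (auto simp: HT.D_one)
next
  case (Suc d)
  then obtain B where B: "B \<in> R.carr" "B \<noteq> 0" "tleads b (d * n) (d * m) (HT.D (x ^ d)) B" by blast
  have "tleads b (Suc d * n) (Suc d * m) (HT.D (x ^ Suc d)) (A * twist n m B)"
    using tleads_mult[OF _ assms(1) _ B(3)] by (simp add: HT.D_mult)
  moreover have "A \<in> R.carr" using assms(1) by (auto simp: tleads_def)
  moreover from this have "A * twist n m B \<noteq> 0"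
    using tensor_domain[OF _ twist_carr, of A n m B] assms(2) B(2) twist_eq_0[OF B(1)] by blast
  ultimately show ?case by (intro bexI[of _ "A * twist n m B"]) simp_all
qed

lemma D_inj: "H.D r = 0 \<Longrightarrow> r = 0"
  using epsl_D[of r] by simp

text \<open>\<Delta>(t) is a sum of \<Delta>(r_i) \<Delta>(x)^i with leading positions (i n, i m).
  These increase strictly with i because (n, m) is not (0, 0), so the top term cannot be
  cancelled.\<close>

lemma D_leads:
  assumes "tleads b n m (HT.D x) A" "A \<noteq> 0" "n \<noteq> 0 \<or> m \<noteq> 0" and t: "leads d t r" "r \<noteq> 0"
  shows "tcf (d * n) (d * m) (HT.D t) \<noteq> 0"
proof -
  have "t = (\<Sum>i\<le>d. \<iota> (cf i t) * x ^ i)"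
    using t by (intro cf_expand) (simp add: leads_def)
  then have "HT.D t = HT.D (\<Sum>i\<le>d. \<iota> (cf i t) * x ^ i)" by simp
  also have "\<dots> = (\<Sum>i\<le>d. emb (H.D (cf i t)) * HT.D (x ^ i))"
    by (subst additive_sum) (simp_all add: HT.D_add HT.D_mult DT_iota)
  finally have "tcf (d * n) (d * m) (HT.D t) = (\<Sum>i\<le>d. H.D (cf i t) * tcf (d * n) (d * m) (HT.D (x ^ i)))"
    by (simp add: tcf_sum tcf_emb_mult)
  also have "\<dots> = (\<Sum>i\<in>{d}. H.D (cf i t) * tcf (d * n) (d * m) (HT.D (x ^ i)))"
  proof (rule sum.mono_neutral_right)
    show "\<forall>i\<in>{..d} - {d}. H.D (cf i t) * tcf (d * n) (d * m) (HT.D (x ^ i)) = 0"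
    proof
      fix i assume i: "i \<in> {..d} - {d}"
      obtain B where "tleads b (i * n) (i * m) (HT.D (x ^ i)) B" using D_x_power_leads[OF assms(1,2)] by blast
      moreover have "lexlt b (i * n) (i * m) (d * n) (d * m)"
        using i assms(3) by (auto simp: lexlt_def)
      ultimately show "H.D (cf i t) * tcf (d * n) (d * m) (HT.D (x ^ i)) = 0" by (auto simp: tleads_def)
    qed
  qed auto
  also have "\<dots> = H.D r * tcf (d * n) (d * m) (HT.D (x ^ d))" using t by (simp add: leads_def)
  finally have eq: "tcf (d * n) (d * m) (HT.D t) = H.D r * tcf (d * n) (d * m) (HT.D (x ^ d))" .
  obtain B where "B \<noteq> 0" "tleads b (d * n) (d * m) (HT.D (x ^ d)) B" using D_x_power_leads[OF assms(1,2)] by blast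
  then have "tcf (d * n) (d * m) (HT.D (x ^ d)) \<noteq> 0" by (simp add: tleads_def)
  then show ?thesis
    unfolding eq using tensor_domain[of "H.D r" "tcf (d * n) (d * m) (HT.D (x ^ d))"] D_inj t by auto
qed

text \<open>If \<open>m\<close> is the degree of \<open>\<Delta>(x)\<close> in the second factor, a suitable contraction \<open>t\<close> of the
  first factor has degree \<open>m\<close>, so \<open>\<Delta>(t)\<close> has degree \<open>m\<^sup>2\<close> in the second factor; by coassociativity
  \<open>\<Delta>(t)\<close> is also a contraction of \<open>\<Delta>(x)\<close>, hence has degree at most \<open>m\<close>.\<close>

lemma degree_right: "j \<ge> 2 \<Longrightarrow> tcf i j (HT.D x) = 0"
proof (rule ccontr)
  let ?X = "HT.D x"
  assume j: "j \<ge> 2" "tcf i j ?X \<noteq> 0"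
  obtain N where N: "\<And>i j. i > N \<or> j > N \<Longrightarrow> tcf i j ?X = 0" using tcf_bounded[of ?X] by auto
  have "\<exists>i. tcf i j ?X \<noteq> 0" "\<And>j. \<exists>i. tcf i j ?X \<noteq> 0 \<Longrightarrow> j \<le> N"
    using j(2) N not_le by blast+
  then obtain m where m: "\<exists>i. tcf i m ?X \<noteq> 0" "j \<le> m" and "\<forall>j>m. \<not> (\<exists>i. tcf i j ?X \<noteq> 0)"
    by (rule greatest_natE[where P = "\<lambda>j. \<exists>i. tcf i j ?X \<noteq> 0"])
  then have above: "tcf i j ?X = 0" if "j > m" for i j
    using that by blast
  obtain i0 where "tcf i0 m ?X \<noteq> 0" using m(1) by blast
  moreover have "\<And>i. tcf i m ?X \<noteq> 0 \<Longrightarrow> i \<le> N" using N not_le by blast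
  ultimately obtain n where n: "tcf n m ?X \<noteq> 0" "i0 \<le> n" "\<forall>i>n. \<not> tcf i m ?X \<noteq> 0"
    by (rule greatest_natE[where P = "\<lambda>i. tcf i m ?X \<noteq> 0"])
  have lead: "tleads True n m ?X (tcf n m ?X)"
    using above n by (auto simp: tleads_def lexlt_def)
  \<comment> \<open>A functional that does not annihilate the top slot makes the contraction t have
    degree exactly m.\<close>
  have "slotr m ?X \<noteq> 0" using n(1) tcf_slotr[of n 0 m ?X] by auto
  then obtain f where f: "Vector_Spaces.linear sT (*) f" "T.lift (\<lambda>a b. sT (f a) b) (slotr m ?X) \<noteq> 0"
    using T.lift_slices_eq_0[of "slotr m ?X"] by auto
  define t where "t = contrl f x"
  have coeff: "\<iota> (cf l t) = T.lift (\<lambda>a b. sT (f a) b) (slotr l ?X)" for l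
  proof -
    have "\<iota> (cf l t) = T.lift (\<lambda>a b. \<iota> (cf l (sT (f a) b))) ?X"
      unfolding t_def contrl_def
      by (rule T.lift_additive[where F = "\<lambda>z. \<iota> (cf l z)"]) (simp add: cf_add iota_add)
    then show ?thesis by (simp add: lift_slotr T.bilin_slice[OF f(1)] cf_scale iota_scale)
  qed
  have "leads m t (cf m t)" "cf m t \<noteq> 0"
  proof -
    have "cf l t = 0" if "l > m" for l
    proof -
      have "slotr l ?X = 0" using above[OF that] by (rule slotr_eq_0)
      then have "\<iota> (cf l t) = \<iota> 0" using coeff[of l] by simp
      then show ?thesis by (simp only: iota_eq_iff)
    qed
    then show "leads m t (cf m t)" by (simp add: leads_def)
    show "cf m t \<noteq> 0" using coeff[of m] f(2) by auto
  qed
  then have "tcf (m * n) (m * m) (HT.D t) \<noteq> 0"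
    using D_leads[OF lead n(1)] m(2) j(1) by auto
  \<comment> \<open>By \<open>D_contrl\<close> only first factors of \<Delta>(x) are altered, so no
    second degree above m can appear.\<close>
  moreover have "tcf p q (HT.D t) = 0" if "q > m" for p q
  proof -
    have b: "bilin sT (\<lambda>a b. R.pure (cf p (contrl f a)) (cf 0 b))"
      by (rule bilinI) (simp_all add: cf_add cf_scale contrl_add[OF f(1)] contrl_scale[OF f(1)]
          R.pure_add R.pure_scale)
    have "tcf p q (HT.D t) = T.lift (\<lambda>a b. tcf p q (T.pure (contrl f a) b)) ?X"
      unfolding t_def D_contrl[OF f(1)] by (rule T.lift_additive) (rule tcf_add)
    also have "\<dots> = T.lift (\<lambda>a b. R.pure (cf p (contrl f a)) (cf 0 b)) (slotr q ?X)"
      by (simp add: lift_slotr[OF b] tcf_pure cf_iota)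
    also have "slotr q ?X = 0" using above[OF that] by (rule slotr_eq_0)
    finally show ?thesis by simp
  qed
  moreover have "m * m > m" using m(2) j(1) by auto
  ultimately show False by blast
qed

text \<open>Mirror image of \<open>degree_right\<close>: the second factor is contracted and the
  other lexicographic order is used.\<close>

lemma degree_left: "i \<ge> 2 \<Longrightarrow> tcf i j (HT.D x) = 0"
proof (rule ccontr)
  let ?X = "HT.D x"
  assume i: "i \<ge> 2" "tcf i j ?X \<noteq> 0"
  obtain N where N: "\<And>i j. i > N \<or> j > N \<Longrightarrow> tcf i j ?X = 0" using tcf_bounded[of ?X] by auto
  have "\<exists>j. tcf i j ?X \<noteq> 0" "\<And>i. \<exists>j. tcf i j ?X \<noteq> 0 \<Longrightarrow> i \<le> N"
    using i(2) N not_le by blast+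
  then obtain n where n: "\<exists>j. tcf n j ?X \<noteq> 0" "i \<le> n" and "\<forall>i>n. \<not> (\<exists>j. tcf i j ?X \<noteq> 0)"
    by (rule greatest_natE[where P = "\<lambda>i. \<exists>j. tcf i j ?X \<noteq> 0"])
  then have above: "tcf i j ?X = 0" if "i > n" for i j
    using that by blast
  obtain j0 where "tcf n j0 ?X \<noteq> 0" using n(1) by blast
  moreover have "\<And>j. tcf n j ?X \<noteq> 0 \<Longrightarrow> j \<le> N" using N not_le by blast
  ultimately obtain m where m: "tcf n m ?X \<noteq> 0" "j0 \<le> m" "\<forall>j>m. \<not> tcf n j ?X \<noteq> 0"
    by (rule greatest_natE[where P = "\<lambda>j. tcf n j ?X \<noteq> 0"])
  have lead: "tleads False n m ?X (tcf n m ?X)"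
    using above m by (auto simp: tleads_def lexlt_def)
  have "slotl n ?X \<noteq> 0" using m(1) tcf_slotl[of 0 m n ?X] by auto
  then obtain f where f: "Vector_Spaces.linear sT (*) f" "T.lift (\<lambda>a b. sT (f b) a) (slotl n ?X) \<noteq> 0"
    using T.lift_slices_right_eq_0[of "slotl n ?X"] by auto
  define t where "t = contrr f x"
  have coeff: "\<iota> (cf l t) = T.lift (\<lambda>a b. sT (f b) a) (slotl l ?X)" for l
  proof -
    have "\<iota> (cf l t) = T.lift (\<lambda>a b. \<iota> (cf l (sT (f b) a))) ?X"
      unfolding t_def contrr_def
      by (rule T.lift_additive[where F = "\<lambda>z. \<iota> (cf l z)"]) (simp add: cf_add iota_add)
    then show ?thesis by (simp add: lift_slotl bilin_contrr[OF f(1)] cf_scale iota_scale)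
  qed
  have "leads n t (cf n t)" "cf n t \<noteq> 0"
  proof -
    have "cf l t = 0" if "l > n" for l
    proof -
      have "slotl l ?X = 0" using above[OF that] by (rule slotl_eq_0)
      then have "\<iota> (cf l t) = \<iota> 0" using coeff[of l] by simp
      then show ?thesis by (simp only: iota_eq_iff)
    qed
    then show "leads n t (cf n t)" by (simp add: leads_def)
    show "cf n t \<noteq> 0" using coeff[of n] f(2) by auto
  qed
  then have "tcf (n * n) (n * m) (HT.D t) \<noteq> 0"
    using D_leads[OF lead m(1)] n(2) i(1) by auto
  moreover have "tcf p q (HT.D t) = 0" if "p > n" for p q
  proof -
    have b: "bilin sT (\<lambda>a b. R.pure (cf 0 a) (cf q (contrr f b)))"
      by (rule bilinI) (simp_all add: cf_add cf_scale contrr_add[OF f(1)] contrr_scale[OF f(1)]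
          R.pure_add R.pure_scale)
    have "tcf p q (HT.D t) = T.lift (\<lambda>a b. tcf p q (T.pure a (contrr f b))) ?X"
      unfolding t_def D_contrr[OF f(1)] by (rule T.lift_additive) (rule tcf_add)
    also have "\<dots> = T.lift (\<lambda>a b. R.pure (cf 0 a) (cf q (contrr f b))) (slotl p ?X)"
      by (simp add: lift_slotl[OF b] tcf_pure cf_iota)
    also have "slotl p ?X = 0" using above[OF that] by (rule slotl_eq_0)
    finally show ?thesis by simp
  qed
  moreover have "n * n > n" using n(2) i(1) by auto
  ultimately show False by blast
qed

lemma D_x: "HT.D x = emb (tcf 0 0 (HT.D x)) + emb (tcf 0 1 (HT.D x)) * T.pure 1 x
    + emb (tcf 1 0 (HT.D x)) * T.pure x 1 + emb (tcf 1 1 (HT.D x)) * T.pure x x"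
proof -
  have "HT.D x = (\<Sum>i\<le>1. \<Sum>j\<le>1. emb (tcf i j (HT.D x)) * mon i j)"
    by (rule tensor_expand) (auto intro: degree_left degree_right)
  then show ?thesis by (simp add: mon_def add.assoc)
qed

end

section \<open>The coproduct of the variable\<close>

context ore
begin

lemma lift_emb: "bilin sT \<phi> \<Longrightarrow> T.lift \<phi> (emb U) = R.lift (\<lambda>a b. \<phi> (\<iota> a) (\<iota> b)) U"
  unfolding emb_def R.lift_additive[where F = "T.lift \<phi>", OF T.lift_add] by (simp add: T.lift_pure)

lemma lift_emb_pure:
  assumes "bilin sT \<phi>"
  shows "T.lift \<phi> (emb A * T.pure s t) = R.lift (\<lambda>a b. \<phi> (\<iota> a * s) (\<iota> b * t)) A"
proof -
  have "bilin sT (\<lambda>a b. \<phi> (a * s) (b * t))"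
    by (rule bilinI) (simp_all add: distrib_right bilinD[OF assms] T.scale_mult_left)
  then show ?thesis by (simp add: T.lift_mult_pure[OF assms] lift_emb)
qed

text \<open>The shape that the degree bounds leave for \<Delta>(x). The coefficients belong to 1
  \<otimes> 1, 1 \<otimes> x, x \<otimes> 1 and x \<otimes> x, in this order.\<close>

definition quad where
  "quad A\<^sub>0 A\<^sub>1 A\<^sub>2 A\<^sub>3 = emb A\<^sub>0 + emb A\<^sub>1 * T.pure 1 x + emb A\<^sub>2 * T.pure x 1 + emb A\<^sub>3 * T.pure x x"

lemma quad_eq_iff:
  assumes "A\<^sub>0 \<in> R.carr" "A\<^sub>1 \<in> R.carr" "A\<^sub>2 \<in> R.carr" "A\<^sub>3 \<in> R.carr"
    "B\<^sub>0 \<in> R.carr" "B\<^sub>1 \<in> R.carr" "B\<^sub>2 \<in> R.carr" "B\<^sub>3 \<in> R.carr"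
  shows "quad A\<^sub>0 A\<^sub>1 A\<^sub>2 A\<^sub>3 = quad B\<^sub>0 B\<^sub>1 B\<^sub>2 B\<^sub>3 \<longleftrightarrow> A\<^sub>0 = B\<^sub>0 \<and> A\<^sub>1 = B\<^sub>1 \<and> A\<^sub>2 = B\<^sub>2 \<and> A\<^sub>3 = B\<^sub>3"
proof -
  have "tcf 0 0 (quad A\<^sub>0 A\<^sub>1 A\<^sub>2 A\<^sub>3) = A\<^sub>0" "tcf 0 1 (quad A\<^sub>0 A\<^sub>1 A\<^sub>2 A\<^sub>3) = A\<^sub>1"
    "tcf 1 0 (quad A\<^sub>0 A\<^sub>1 A\<^sub>2 A\<^sub>3) = A\<^sub>2" "tcf 1 1 (quad A\<^sub>0 A\<^sub>1 A\<^sub>2 A\<^sub>3) = A\<^sub>3"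
    if "A\<^sub>0 \<in> R.carr" "A\<^sub>1 \<in> R.carr" "A\<^sub>2 \<in> R.carr" "A\<^sub>3 \<in> R.carr" for A\<^sub>0 A\<^sub>1 A\<^sub>2 A\<^sub>3
    using that cf_iota[of _ 1] by (auto simp: quad_def tcf_add tcf_emb tcf_emb_mult tcf_pure cf_x)
  then show ?thesis using assms by metis
qed

lemma emb_pure_affine:
  assumes "A \<in> R.carr"
  shows "emb A * T.pure (\<iota> p + \<iota> q * x) t = emb (A * R.pure p 1) * T.pure 1 t + emb (A * R.pure q 1) * T.pure x t"
    and "emb A * T.pure t (\<iota> p + \<iota> q * x) = emb (A * R.pure 1 p) * T.pure t 1 + emb (A * R.pure 1 q) * T.pure t x"
  using assms
  by (simp_all add: T.pure_add distrib_left emb_mult emb_pure mult.assoc T.pure_mult)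

context
  fixes G :: "'t \<Rightarrow> 't" and y :: 't
  assumes G_add: "\<And>a b. G (a + b) = G a + G b" and G_scale: "\<And>c a. G (sT c a) = sT c (G a)"
    and G_iota: "\<And>r. G (\<iota> r) = 0" and G_x: "\<And>r. G (\<iota> r * x) = \<iota> r * y"
begin

lemma bilin_G: "bilin sT (\<lambda>p q. T.pure (G p) q)" "bilin sT (\<lambda>p q. T.pure p (G q))"
  by (rule bilinI; simp add: G_add G_scale T.pure_add T.pure_scale)+

text \<open>G stands for \<open>contrl f\<^sub>1\<close> or \<open>contrr f\<^sub>1\<close>: both
  vanish on R and send r x to r times a fixed element.\<close>

lemma lift_G:
  "T.lift (\<lambda>p q. T.pure (G p) q) (quad A\<^sub>0 A\<^sub>1 A\<^sub>2 A\<^sub>3) = emb A\<^sub>2 * T.pure y 1 + emb A\<^sub>3 * T.pure y x"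
  "T.lift (\<lambda>p q. T.pure p (G q)) (quad A\<^sub>0 A\<^sub>1 A\<^sub>2 A\<^sub>3) = emb A\<^sub>1 * T.pure 1 y + emb A\<^sub>3 * T.pure x y"
proof -
  have *: "R.lift (\<lambda>a b. T.pure (\<iota> a * s) (\<iota> b * t)) A = emb A * T.pure s t" for s t A
    by (simp add: T.pure_mult[symmetric] R.lift_const_right emb_def)
  show "T.lift (\<lambda>p q. T.pure (G p) q) (quad A\<^sub>0 A\<^sub>1 A\<^sub>2 A\<^sub>3) = emb A\<^sub>2 * T.pure y 1 + emb A\<^sub>3 * T.pure y x"
    using *[of y 1] *[of y x]
    by (simp add: quad_def T.lift_add[OF bilin_G(1)] lift_emb_pure[OF bilin_G(1)] lift_emb[OF bilin_G(1)]
        G_iota G_x)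
  show "T.lift (\<lambda>p q. T.pure p (G q)) (quad A\<^sub>0 A\<^sub>1 A\<^sub>2 A\<^sub>3) = emb A\<^sub>1 * T.pure 1 y + emb A\<^sub>3 * T.pure x y"
    using *[of 1 y] *[of x y]
    by (simp add: quad_def T.lift_add[OF bilin_G(2)] lift_emb_pure[OF bilin_G(2)] lift_emb[OF bilin_G(2)]
        G_iota G_x)
qed

end

lemma ex_leads: "t \<noteq> 0 \<Longrightarrow> \<exists>n r. r \<noteq> 0 \<and> leads n t r"
proof -
  assume "t \<noteq> 0"
  then obtain k where k: "cf k t \<noteq> 0" using cf_eqI[of t 0] by auto
  obtain N where N: "\<forall>i>N. cf i t = 0" using cf_bounded by blast
  then have "\<And>i. cf i t \<noteq> 0 \<Longrightarrow> i \<le> N" using not_le by blast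
  from greatest_natE[of "\<lambda>i. cf i t \<noteq> 0", OF k this]
  obtain m where "cf m t \<noteq> 0" "\<forall>i>m. \<not> cf i t \<noteq> 0" by blast
  then show ?thesis by (auto simp: leads_def)
qed

end

context hopf_ore
begin

lemma lift_eps_const:
  "R.lift (\<lambda>a b. sT (\<epsilon> a) (\<iota> b * t)) A = \<iota> (epsl A) * t"
  "R.lift (\<lambda>a b. sT (\<epsilon> b) (\<iota> a * t)) A = \<iota> (epsr A) * t"
  using R.lift_additive[where F = "\<lambda>z. \<iota> z * t" and \<psi> = "\<lambda>a b. sR (\<epsilon> a) b" and U = A]
    R.lift_additive[where F = "\<lambda>z. \<iota> z * t" and \<psi> = "\<lambda>a b. sR (\<epsilon> b) a" and U = A]
  by (simp_all add: iota_add distrib_right iota_scale T.scale_mult_left epsl_def epsr_def)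

lemma eps_eps: "A \<in> R.carr \<Longrightarrow> \<epsilon> (epsl A) = \<epsilon> (epsr A)"
  by (rule R.carr_eqI[where F = "\<lambda>A. \<epsilon> (epsl A)" and G = "\<lambda>A. \<epsilon> (epsr A)"])
    (simp_all add: epsl_add epsr_add H.counit_add epsl_pure epsr_pure H.counit_scale)

end

context hopf_ore_ext
begin

definition w\<^sub>0 where "w\<^sub>0 = tcf 0 0 (HT.D x)"
definition a\<^sub>0 where "a\<^sub>0 = tcf 0 1 (HT.D x)"
definition b\<^sub>0 where "b\<^sub>0 = tcf 1 0 (HT.D x)"
definition c\<^sub>0 where "c\<^sub>0 = tcf 1 1 (HT.D x)"

lemma coeff_carr [simp]: "w\<^sub>0 \<in> R.carr" "a\<^sub>0 \<in> R.carr" "b\<^sub>0 \<in> R.carr" "c\<^sub>0 \<in> R.carr"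
  by (simp_all add: w\<^sub>0_def a\<^sub>0_def b\<^sub>0_def c\<^sub>0_def)

lemma D_x_quad: "HT.D x = quad w\<^sub>0 a\<^sub>0 b\<^sub>0 c\<^sub>0"
  unfolding quad_def w\<^sub>0_def a\<^sub>0_def b\<^sub>0_def c\<^sub>0_def by (rule D_x)

lemma emb_mult_quad:
  assumes "A \<in> R.carr" "w \<in> R.carr" "a \<in> R.carr" "b \<in> R.carr" "c \<in> R.carr"
  shows "emb A * quad w a b c = quad (A * w) (A * a) (A * b) (A * c)"
  using assms by (simp add: quad_def distrib_left emb_mult mult.assoc)

definition f\<^sub>1 :: "'t \<Rightarrow> 'k" where "f\<^sub>1 t = \<epsilon> (cf 1 t)"

lemma linear_f1: "Vector_Spaces.linear sT (*) f\<^sub>1"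
  unfolding f\<^sub>1_def
  by (rule T.linearI) (use H.counit_linear in \<open>auto simp: cf_add cf_scale H.counit_add H.counit_scale
      Vector_Spaces.linear_def\<close>)

lemma f1_simps: "f\<^sub>1 (\<iota> r) = 0" "f\<^sub>1 (\<iota> r * x) = \<epsilon> r"
  by (simp_all add: f\<^sub>1_def cf_iota cf_left cf_x)

lemma D_iota_x: "HT.D (\<iota> r * x) = quad (H.D r * w\<^sub>0) (H.D r * a\<^sub>0) (H.D r * b\<^sub>0) (H.D r * c\<^sub>0)"
  by (simp add: HT.D_mult DT_iota D_x_quad emb_mult_quad)

lemma contrl_f1_quad: "T.lift (\<lambda>p q. sT (f\<^sub>1 p) q) (quad w a b c) = \<iota> (epsl b) + \<iota> (epsl c) * x"
  using lift_eps_const(1)[of 1 b] lift_eps_const(1)[of x c]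
  by (simp add: quad_def T.lift_add[OF bilin_contrl[OF linear_f1]] lift_emb_pure[OF bilin_contrl[OF linear_f1]]
      lift_emb[OF bilin_contrl[OF linear_f1]] f1_simps)

lemma contrr_f1_quad: "T.lift (\<lambda>p q. sT (f\<^sub>1 q) p) (quad w a b c) = \<iota> (epsr a) + \<iota> (epsr c) * x"
  using lift_eps_const(2)[of 1 a] lift_eps_const(2)[of x c]
  by (simp add: quad_def T.lift_add[OF bilin_contrr[OF linear_f1]] lift_emb_pure[OF bilin_contrr[OF linear_f1]]
      lift_emb[OF bilin_contrr[OF linear_f1]] f1_simps)

definition yl where "yl = \<iota> (epsl b\<^sub>0) + \<iota> (epsl c\<^sub>0) * x"
definition yr where "yr = \<iota> (epsr a\<^sub>0) + \<iota> (epsr c\<^sub>0) * x"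

lemma contr_f1: "contrl f\<^sub>1 (\<iota> r) = 0" "contrr f\<^sub>1 (\<iota> r) = 0"
    "contrl f\<^sub>1 (\<iota> r * x) = \<iota> r * yl" "contrr f\<^sub>1 (\<iota> r * x) = \<iota> r * yr"
  by (simp_all add: contrl_def contrr_def DT_iota lift_emb bilin_contrl[OF linear_f1] bilin_contrr[OF linear_f1]
      f1_simps D_iota_x contrl_f1_quad contrr_f1_quad epsl_mult epsr_mult yl_def yr_def iota_mult
      distrib_left mult.assoc)

lemma contr_f1_x: "contrl f\<^sub>1 x = yl" "contrr f\<^sub>1 x = yr"
  using contr_f1(3,4)[of 1] by simp_all

lemmas lift_contrl = lift_G[of "contrl f\<^sub>1" yl, OF contrl_add[OF linear_f1] contrl_scale[OF linear_f1] contr_f1(1,3)]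
lemmas lift_contrr = lift_G[of "contrr f\<^sub>1" yr, OF contrr_add[OF linear_f1] contrr_scale[OF linear_f1] contr_f1(2,4)]

lemma D_affine: "HT.D (\<iota> p + \<iota> q * x) =
    quad (H.D p + H.D q * w\<^sub>0) (H.D q * a\<^sub>0) (H.D q * b\<^sub>0) (H.D q * c\<^sub>0)"
  by (simp add: HT.D_add D_iota_x DT_iota) (simp add: quad_def emb_add add.assoc)

lemma coassoc_left:
  "H.D (epsl b\<^sub>0) + H.D (epsl c\<^sub>0) * w\<^sub>0 = b\<^sub>0 * R.pure (epsl b\<^sub>0) 1"
  "H.D (epsl c\<^sub>0) * a\<^sub>0 = c\<^sub>0 * R.pure (epsl b\<^sub>0) 1"
  "H.D (epsl c\<^sub>0) * b\<^sub>0 = b\<^sub>0 * R.pure (epsl c\<^sub>0) 1"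
  "H.D (epsl c\<^sub>0) * c\<^sub>0 = c\<^sub>0 * R.pure (epsl c\<^sub>0) 1"
proof -
  have "HT.D yl = emb b\<^sub>0 * T.pure yl 1 + emb c\<^sub>0 * T.pure yl x"
    using D_contrl[OF linear_f1, of x] by (simp add: contr_f1_x D_x_quad lift_contrl)
  also have "\<dots> = quad (b\<^sub>0 * R.pure (epsl b\<^sub>0) 1) (c\<^sub>0 * R.pure (epsl b\<^sub>0) 1)
      (b\<^sub>0 * R.pure (epsl c\<^sub>0) 1) (c\<^sub>0 * R.pure (epsl c\<^sub>0) 1)"
    by (simp add: yl_def emb_pure_affine quad_def add_ac)
  finally show "H.D (epsl b\<^sub>0) + H.D (epsl c\<^sub>0) * w\<^sub>0 = b\<^sub>0 * R.pure (epsl b\<^sub>0) 1"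
    "H.D (epsl c\<^sub>0) * a\<^sub>0 = c\<^sub>0 * R.pure (epsl b\<^sub>0) 1"
    "H.D (epsl c\<^sub>0) * b\<^sub>0 = b\<^sub>0 * R.pure (epsl c\<^sub>0) 1"
    "H.D (epsl c\<^sub>0) * c\<^sub>0 = c\<^sub>0 * R.pure (epsl c\<^sub>0) 1"
    unfolding yl_def D_affine by (simp_all add: quad_eq_iff)
qed

lemma coassoc_right:
  "H.D (epsr a\<^sub>0) + H.D (epsr c\<^sub>0) * w\<^sub>0 = a\<^sub>0 * R.pure 1 (epsr a\<^sub>0)"
  "H.D (epsr c\<^sub>0) * a\<^sub>0 = a\<^sub>0 * R.pure 1 (epsr c\<^sub>0)"
  "H.D (epsr c\<^sub>0) * b\<^sub>0 = c\<^sub>0 * R.pure 1 (epsr a\<^sub>0)"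
  "H.D (epsr c\<^sub>0) * c\<^sub>0 = c\<^sub>0 * R.pure 1 (epsr c\<^sub>0)"
proof -
  have "HT.D yr = emb a\<^sub>0 * T.pure 1 yr + emb c\<^sub>0 * T.pure x yr"
    using D_contrr[OF linear_f1, of x] by (simp add: contr_f1_x D_x_quad lift_contrr)
  also have "\<dots> = quad (a\<^sub>0 * R.pure 1 (epsr a\<^sub>0)) (a\<^sub>0 * R.pure 1 (epsr c\<^sub>0))
      (c\<^sub>0 * R.pure 1 (epsr a\<^sub>0)) (c\<^sub>0 * R.pure 1 (epsr c\<^sub>0))"
    by (simp add: yr_def emb_pure_affine quad_def add_ac)
  finally show "H.D (epsr a\<^sub>0) + H.D (epsr c\<^sub>0) * w\<^sub>0 = a\<^sub>0 * R.pure 1 (epsr a\<^sub>0)"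
    "H.D (epsr c\<^sub>0) * a\<^sub>0 = a\<^sub>0 * R.pure 1 (epsr c\<^sub>0)"
    "H.D (epsr c\<^sub>0) * b\<^sub>0 = c\<^sub>0 * R.pure 1 (epsr a\<^sub>0)"
    "H.D (epsr c\<^sub>0) * c\<^sub>0 = c\<^sub>0 * R.pure 1 (epsr c\<^sub>0)"
    unfolding yr_def D_affine by (simp_all add: quad_eq_iff)
qed

lemma coassoc_middle:
  "b\<^sub>0 * R.pure (epsr a\<^sub>0) 1 = a\<^sub>0 * R.pure 1 (epsl b\<^sub>0)"
  "c\<^sub>0 * R.pure (epsr a\<^sub>0) 1 = a\<^sub>0 * R.pure 1 (epsl c\<^sub>0)"
  "b\<^sub>0 * R.pure (epsr c\<^sub>0) 1 = c\<^sub>0 * R.pure 1 (epsl b\<^sub>0)"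
  "c\<^sub>0 * R.pure (epsr c\<^sub>0) 1 = c\<^sub>0 * R.pure 1 (epsl c\<^sub>0)"
proof -
  have "emb b\<^sub>0 * T.pure yr 1 + emb c\<^sub>0 * T.pure yr x = emb a\<^sub>0 * T.pure 1 yl + emb c\<^sub>0 * T.pure x yl"
    using contr_middle[OF linear_f1, of x] by (simp add: D_x_quad lift_contrr lift_contrl)
  then have "quad (b\<^sub>0 * R.pure (epsr a\<^sub>0) 1) (c\<^sub>0 * R.pure (epsr a\<^sub>0) 1)
      (b\<^sub>0 * R.pure (epsr c\<^sub>0) 1) (c\<^sub>0 * R.pure (epsr c\<^sub>0) 1) =
    quad (a\<^sub>0 * R.pure 1 (epsl b\<^sub>0)) (a\<^sub>0 * R.pure 1 (epsl c\<^sub>0))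
      (c\<^sub>0 * R.pure 1 (epsl b\<^sub>0)) (c\<^sub>0 * R.pure 1 (epsl c\<^sub>0))"
    by (simp add: yr_def yl_def emb_pure_affine quad_def add_ac)
  then show "b\<^sub>0 * R.pure (epsr a\<^sub>0) 1 = a\<^sub>0 * R.pure 1 (epsl b\<^sub>0)"
    "c\<^sub>0 * R.pure (epsr a\<^sub>0) 1 = a\<^sub>0 * R.pure 1 (epsl c\<^sub>0)"
    "b\<^sub>0 * R.pure (epsr c\<^sub>0) 1 = c\<^sub>0 * R.pure 1 (epsl b\<^sub>0)"
    "c\<^sub>0 * R.pure (epsr c\<^sub>0) 1 = c\<^sub>0 * R.pure 1 (epsl c\<^sub>0)"
    by (simp_all add: quad_eq_iff)
qed

context
  assumes eps_x: "\<epsilon>T x = 0"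
begin

text \<open>Coefficients of x in the counit axioms at x. Since \<epsilon>(x) = 0, each axiom retains
  only one of the terms containing x.\<close>

lemma counit_coeffs: "epsl a\<^sub>0 = 1" "epsr b\<^sub>0 = 1"
proof -
  have bl: "bilin sT (\<lambda>a b. sT (\<epsilon>T a) b)" by (rule T.bilin_slice[OF HT.counit_linear])
  have br: "bilin sT (\<lambda>a b. sT (\<epsilon>T b) a)" by (rule T.bilin_flip[OF bl])
  have "x = T.lift (\<lambda>a b. sT (\<epsilon>T a) b) (quad w\<^sub>0 a\<^sub>0 b\<^sub>0 c\<^sub>0)"
    unfolding D_x_quad[symmetric] by (rule HT.counit_left'[symmetric])
  also have "\<dots> = \<iota> (epsl w\<^sub>0) + \<iota> (epsl a\<^sub>0) * x"
    using lift_eps_const(1)[of 1 w\<^sub>0] lift_eps_const(1)[of x a\<^sub>0]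
    by (simp add: quad_def T.lift_add[OF bl] lift_emb_pure[OF bl] lift_emb[OF bl] HT.counit_mult eps_x counit_ext)
  finally have "cf 1 x = cf 1 (\<iota> (epsl w\<^sub>0) + \<iota> (epsl a\<^sub>0) * x)" by simp
  then show "epsl a\<^sub>0 = 1" by (simp add: cf_add cf_left cf_x cf_iota)
  have "x = T.lift (\<lambda>a b. sT (\<epsilon>T b) a) (quad w\<^sub>0 a\<^sub>0 b\<^sub>0 c\<^sub>0)"
    unfolding D_x_quad[symmetric] by (rule HT.counit_right'[symmetric])
  also have "\<dots> = \<iota> (epsr w\<^sub>0) + \<iota> (epsr b\<^sub>0) * x"
    using lift_eps_const(2)[of 1 w\<^sub>0] lift_eps_const(2)[of x b\<^sub>0]
    by (simp add: quad_def T.lift_add[OF br] lift_emb_pure[OF br] lift_emb[OF br] HT.counit_mult eps_x counit_ext)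
  finally have "cf 1 x = cf 1 (\<iota> (epsr w\<^sub>0) + \<iota> (epsr b\<^sub>0) * x)" by simp
  then show "epsr b\<^sub>0 = 1" by (simp add: cf_add cf_left cf_x cf_iota)
qed

lemma counit_units: "\<epsilon> (epsr a\<^sub>0) = 1" "\<epsilon> (epsl b\<^sub>0) = 1"
  using eps_eps[of a\<^sub>0] eps_eps[of b\<^sub>0] counit_coeffs by simp_all

lemma tensor_cancel:
  assumes "A \<in> R.carr" "B \<in> R.carr" "C \<in> R.carr" "A \<noteq> 0" "A * B = A * C"
  shows "B = C"
  using tensor_domain[of A "B - C"] assms by (simp add: right_diff_distrib)

lemma scalar_commute: "A \<in> R.carr \<Longrightarrow> A * R.pure (sR g 1) 1 = R.pure (sR g 1) 1 * A"
  by (rule R.carr_eqI[where F = "\<lambda>A. A * R.pure (sR g 1) 1" and G = "\<lambda>A. R.pure (sR g 1) 1 * A"])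
    (simp_all add: distrib_left distrib_right R.pure_mult R.scale_mult)

text \<open>If \<open>c\<^sub>0 \<noteq> 0\<close>, the comparison of coefficients produces \<open>y = \<gamma> x + p\<close> with
  \<open>\<gamma> \<Delta>(y) = c\<^sub>0 (y \<otimes> y)\<close>; the antipode axiom then makes \<open>y\<close> left invertible although it has degree 1.\<close>

lemma c0_eq_0: "c\<^sub>0 = 0"
proof (rule ccontr)
  assume c: "c\<^sub>0 \<noteq> 0"
  define \<gamma> where "\<gamma> = \<epsilon> (epsl c\<^sub>0)"
  define g where "g = sR \<gamma> 1"
  define G where "G = R.pure g 1"
  define p where "p = epsl b\<^sub>0"
  have G_carr [simp]: "G \<in> R.carr" by (simp add: G_def)
  have G_alt: "R.pure 1 g = G" by (simp add: G_def g_def R.pure_scale)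
  have comm: "A * G = G * A" if "A \<in> R.carr" for A
    using scalar_commute[OF that] by (simp add: G_def g_def)
  \<comment> \<open>An identity r \<otimes> 1 = 1 \<otimes> r' forces r and r' to be the same
    scalar; applying \<epsilon> to either factor shows that it is \<gamma>.\<close>
  have eq: "R.pure (epsr c\<^sub>0) 1 = R.pure 1 (epsl c\<^sub>0)"
    by (rule tensor_cancel[OF _ _ _ c coassoc_middle(4)]) simp_all
  have cr: "epsr c\<^sub>0 = g"
    using arg_cong[OF eq, of epsr] by (simp add: epsr_pure g_def \<gamma>_def)
  have cl: "epsl c\<^sub>0 = g"
    using arg_cong[OF eq, of epsl] eps_eps[of c\<^sub>0] by (simp add: epsl_pure g_def \<gamma>_def)
  have DG: "H.D g = G" by (simp add: g_def H.D_scale H.D_one G_def R.pure_mult)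
  have 1: "G * a\<^sub>0 = c\<^sub>0 * R.pure p 1" using coassoc_left(2) by (simp add: cl DG p_def)
  have "c\<^sub>0 * R.pure (epsr a\<^sub>0) 1 = c\<^sub>0 * R.pure p 1"
    using coassoc_middle(2) 1 by (simp add: cl G_alt comm)
  then have "R.pure (epsr a\<^sub>0) 1 = R.pure p 1" by (rule tensor_cancel[rotated 4]) (simp_all add: c)
  from arg_cong[OF this, of epsr] have ap: "epsr a\<^sub>0 = p" by (simp add: epsr_pure)
  have 2: "G * b\<^sub>0 = c\<^sub>0 * R.pure 1 p" using coassoc_right(3) by (simp add: cr DG ap)
  have 3: "H.D p + G * w\<^sub>0 = b\<^sub>0 * R.pure p 1" using coassoc_left(1) by (simp add: cl DG p_def)
  \<comment> \<open>Otherwise \<open>c\<^sub>0\<close> annihilates p \<otimes> 1, hence p = 0,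
    against \<epsilon>(p) = 1.\<close>
  have \<gamma>: "\<gamma> \<noteq> 0"
  proof
    assume "\<gamma> = 0"
    then have "c\<^sub>0 * R.pure p 1 = 0" using 1 by (simp add: G_def g_def)
    then have "R.pure p 1 = 0" using tensor_domain[of c\<^sub>0 "R.pure p 1"] c by simp
    from arg_cong[OF this, of epsr] have "p = 0" by (simp add: epsr_pure)
    then show False using counit_units(2) by (simp add: p_def)
  qed
  \<comment> \<open>By the values found above, both contractions \<open>yl\<close> and
    \<open>yr\<close> of x coincide with this element.\<close>
  define y where "y = \<iota> p + \<iota> g * x"
  have "emb G * HT.D y = quad (G * (H.D p + G * w\<^sub>0)) (G * (G * a\<^sub>0)) (G * (G * b\<^sub>0)) (G * (G * c\<^sub>0))"
    unfolding y_def D_affine by (simp add: emb_mult_quad DG)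
  also have "\<dots> = quad (c\<^sub>0 * R.pure p p) (c\<^sub>0 * R.pure p g) (c\<^sub>0 * R.pure g p) (c\<^sub>0 * R.pure g g)"
  proof -
    have "G * (H.D p + G * w\<^sub>0) = c\<^sub>0 * R.pure p p"
      unfolding 3 mult.assoc[symmetric] 2 by (simp add: mult.assoc R.pure_mult)
    moreover have "G * (G * a\<^sub>0) = c\<^sub>0 * R.pure p g"
      unfolding 1 comm[of "c\<^sub>0 * R.pure p 1", simplified, symmetric]
      by (simp add: mult.assoc G_alt[symmetric] R.pure_mult)
    moreover have "G * (G * b\<^sub>0) = c\<^sub>0 * R.pure g p"
      unfolding 2 comm[of "c\<^sub>0 * R.pure 1 p", simplified, symmetric]
      by (simp add: mult.assoc G_def R.pure_mult)
    moreover have "G * (G * c\<^sub>0) = c\<^sub>0 * R.pure g g"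
    proof -
      have "G * (G * c\<^sub>0) = c\<^sub>0 * G * G"
        using comm[of c\<^sub>0] comm[of "G * c\<^sub>0"] by (simp add: mult.assoc)
      also have "\<dots> = c\<^sub>0 * (G * R.pure 1 g)" by (simp add: mult.assoc G_alt)
      finally have "G * (G * c\<^sub>0) = c\<^sub>0 * (G * R.pure 1 g)" .
      then show ?thesis by (simp add: G_def R.pure_mult)
    qed
    ultimately show ?thesis by simp
  qed
  also have "\<dots> = emb c\<^sub>0 * T.pure y y"
    unfolding y_def
    by (simp add: quad_def emb_mult emb_pure T.pure_add distrib_left mult.assoc
        T.pure_mult add_ac)
  finally have yy: "emb G * HT.D y = emb c\<^sub>0 * T.pure y y" .
  have S: "bilin sT (\<lambda>p q. ST p * q)"
    by (rule bilinI) (simp_all add: HT.hopf_linear_simps)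
  \<comment> \<open>Under a \<otimes> b \<mapsto> S(a) b the left side becomes \<gamma>
    \<epsilon>(y) = \<gamma>, and the right side ends in the factor y.\<close>
  have "T.lift (\<lambda>p q. ST p * q) (emb G * HT.D y) = T.lift (\<lambda>p q. ST p * q) (HT.D (sT \<gamma> y))"
    by (simp add: HT.D_scale G_def emb_pure g_def iota_scale)
  also have "\<dots> = sT \<gamma> 1"
    using counit_units(2) by (simp add: HT.antipode_left' HT.counit_scale y_def HT.counit_add HT.counit_mult eps_x counit_ext p_def)
  finally have lhs: "T.lift (\<lambda>p q. ST p * q) (emb G * HT.D y) = \<iota> g" by (simp add: g_def iota_scale)
  define z where "z = T.lift (\<lambda>a b. ST (a * y) * b) (emb c\<^sub>0)"
  have "T.lift (\<lambda>p q. ST p * q) (emb c\<^sub>0 * T.pure y y) = z * y"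
    unfolding z_def T.lift_mult_pure[OF S emb_carr] T.lift_const_right[symmetric] mult.assoc ..
  then have zy: "z * y = \<iota> g" using lhs yy by simp
  have g0: "g \<noteq> 0"
    using \<gamma> H.counit_scale[of \<gamma> 1] by (auto simp: g_def)
  then have "z \<noteq> 0" using zy iota_eq_iff[of g 0] by auto
  then obtain n r where nr: "r \<noteq> 0" "leads n z r" using ex_leads by blast
  have "leads 1 y g" by (auto simp: y_def leads_def cf_add cf_iota cf_left cf_x)
  \<comment> \<open>z y has degree n + 1, while it equals a scalar; so the product of the leading
    coefficients would be 0 in the domain R.\<close>
  from leads_mult[OF nr(2) this] have "cf (n + 1) (\<iota> g) = r * (\<sigma> ^^ n) g" by (simp add: zy leads_def)
  moreover have "(\<sigma> ^^ n) g \<noteq> 0" using g0 sigma_power_eq_iff[of n g 0] by simp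
  ultimately show False using base_domain[of r "(\<sigma> ^^ n) g"] nr(1) by (simp add: cf_iota)
qed

text \<open>With the x \<otimes> x term gone the relations are \<Delta>(b) =
  \<open>b\<^sub>0\<close> (b \<otimes> 1), \<Delta>(a') = \<open>a\<^sub>0\<close> (1 \<otimes> a')
  and \<open>b\<^sub>0\<close> (a' \<otimes> 1) = \<open>a\<^sub>0\<close> (1 \<otimes> b). Once a'
  and b are units, scaling x by the inverse of b turns the coefficient of x \<otimes> 1 into
  1.\<close>

lemma normal_form:
  obtains v b h w where "v * b = 1" "b * v = 1" "w \<in> R.carr" "\<epsilon> h = 1" "H.D h = R.pure h h"
    "HT.D (\<iota> v * x) = T.pure (\<iota> (S h)) (\<iota> v * x) + T.pure (\<iota> v * x) 1 + emb w"
proof -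
  have [simp]: "H.D 0 = 0" using H.D_diff[of 0 0] by simp
  define a' where "a' = epsr a\<^sub>0"
  define b where "b = epsl b\<^sub>0"
  have D_b: "H.D b = b\<^sub>0 * R.pure b 1" using coassoc_left(1) by (simp add: c0_eq_0 b_def)
  have D_a: "H.D a' = a\<^sub>0 * R.pure 1 a'" using coassoc_right(1) by (simp add: c0_eq_0 a'_def)
  have mid: "b\<^sub>0 * R.pure a' 1 = a\<^sub>0 * R.pure 1 b" using coassoc_middle(1) by (simp add: a'_def b_def)
  have bil: "bilin sR (\<lambda>p q. S p * q)" "bilin sR (\<lambda>p q. p * S q)"
    by (rule bilinI; simp add: H.hopf_linear_simps)+
  \<comment> \<open>Applying p \<otimes> q \<mapsto> S(p) q to \<Delta>(a') =
    \<open>a\<^sub>0\<close> (1 \<otimes> a') yields 1 = u a', because \<epsilon>(a') = 1.\<close>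
  define u where "u = R.lift (\<lambda>p q. S p * q) a\<^sub>0"
  have "R.lift (\<lambda>p q. S p * q) (H.D a') = 1"
    using counit_units(1) by (simp add: H.antipode_left' a'_def)
  then have ua: "u * a' = 1"
    unfolding D_a R.lift_mult_pure[OF bil(1) coeff_carr(2)] u_def
    by (simp add: R.lift_const_right[symmetric] mult.assoc)
  have au: "a' * u = 1"
  proof -
    have "(a' * u - 1) * a' = 0" by (simp add: left_diff_distrib mult.assoc ua)
    then show ?thesis using base_domain[of "a' * u - 1" a'] ua by auto
  qed
  define h where "h = u * b"
  have b_h: "b = a' * h" by (simp add: h_def mult.assoc[symmetric] au)
  \<comment> \<open>Substituting b = a' h into \<Delta>(b) and using the middle relation gives
    \<Delta>(b) = \<Delta>(a') (h \<otimes> h); cancelling \<Delta>(a') shows that h is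
    grouplike.\<close>
  have "H.D b = b\<^sub>0 * R.pure a' 1 * R.pure h 1"
    unfolding D_b by (simp add: mult.assoc R.pure_mult b_h)
  also have "\<dots> = a\<^sub>0 * R.pure 1 a' * R.pure h h"
    unfolding mid by (simp add: mult.assoc R.pure_mult b_h)
  finally have "H.D b = H.D a' * R.pure h h" by (simp add: D_a)
  then have D_h: "H.D h = R.pure h h"
    by (simp add: h_def H.D_mult mult.assoc[symmetric] H.D_mult[symmetric] ua H.D_one R.pure_mult)
  have "\<epsilon> u = 1"
    using arg_cong[OF ua, of \<epsilon>] counit_units(1) by (simp add: H.counit_mult a'_def)
  then have eps_h: "\<epsilon> h = 1" using counit_units(2) by (simp add: h_def H.counit_mult b_def)
  have Sh: "S h * h = 1" "h * S h = 1"
    using H.antipode_left'[of h] H.antipode_right'[of h] by (simp_all add: D_h R.lift_pure bil eps_h)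
  define v where "v = S h * u"
  have vb: "v * b = 1" using Sh(1) by (simp add: v_def mult.assoc h_def[symmetric])
  have bv: "b * v = 1"
    by (simp add: v_def b_h mult.assoc) (simp add: mult.assoc[symmetric] Sh au mult.assoc[of a'])
  have va: "v * a' = S h" by (simp add: v_def mult.assoc ua)
  \<comment> \<open>\<Delta>(v) inverts \<Delta>(b), so it determines the two scaled coefficients
    \<Delta>(v) \<open>b\<^sub>0\<close> and \<Delta>(v) \<open>a\<^sub>0\<close>.\<close>
  have "H.D v * (b\<^sub>0 * R.pure b 1) = R.pure 1 1"
    unfolding D_b[symmetric] H.D_mult[symmetric] vb by (rule H.D_one)
  then have "H.D v * (b\<^sub>0 * R.pure b 1) * R.pure v 1 = R.pure 1 1 * R.pure v 1" by simp
  then have vb0: "H.D v * b\<^sub>0 = R.pure v 1" by (simp add: mult.assoc R.pure_mult bv)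
  have "H.D v * a\<^sub>0 * R.pure 1 b = H.D v * b\<^sub>0 * R.pure a' 1" by (simp add: mult.assoc mid)
  also have "\<dots> = R.pure (S h) 1" by (simp add: vb0 R.pure_mult va)
  finally have "H.D v * a\<^sub>0 * R.pure 1 b * R.pure 1 v = R.pure (S h) 1 * R.pure 1 v" by simp
  then have va0: "H.D v * a\<^sub>0 = R.pure (S h) v" by (simp add: mult.assoc R.pure_mult bv)
  have "HT.D (\<iota> v * x) = T.pure (\<iota> (S h)) (\<iota> v * x) + T.pure (\<iota> v * x) 1 + emb (H.D v * w\<^sub>0)"
    unfolding D_iota_x vb0 va0 c0_eq_0
    by (simp add: quad_def emb_pure T.pure_mult add_ac)
  with that[OF vb bv _ eps_h D_h, of "H.D v * w\<^sub>0"] show ?thesis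
    by (simp only: R.carr_mult H.D_carr coeff_carr)
qed

end

end

section \<open>Necessity of the conditions\<close>

context ore
begin

definition sl where "sl U = R.lift (\<lambda>a b. R.pure (\<sigma> a) b) U"
definition sr where "sr U = R.lift (\<lambda>a b. R.pure a (\<sigma> b)) U"
definition dl where "dl U = R.lift (\<lambda>a b. R.pure (\<delta> a) b) U"
definition dr where "dr U = R.lift (\<lambda>a b. R.pure a (\<delta> b)) U"

lemma slots_carr [simp]: "sl U \<in> R.carr" "sr U \<in> R.carr" "dl U \<in> R.carr" "dr U \<in> R.carr"
  unfolding sl_def sr_def dl_def dr_def by (rule R.lift_in_carr; (simp | unfold_locales))+

lemma slots_pure:
  "sl (R.pure a b) = R.pure (\<sigma> a) b" "sr (R.pure a b) = R.pure a (\<sigma> b)"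
  "dl (R.pure a b) = R.pure (\<delta> a) b" "dr (R.pure a b) = R.pure a (\<delta> b)"
  unfolding sl_def sr_def dl_def dr_def
  by (rule R.lift_pure, rule bilinI;
      simp add: sigma_add sigma_scale delta_add delta_scale R.pure_add R.pure_scale)+

lemma slots_add:
  "sl (U + V) = sl U + sl V" "sr (U + V) = sr U + sr V" "dl (U + V) = dl U + dl V" "dr (U + V) = dr U + dr V"
  unfolding sl_def sr_def dl_def dr_def
  by (rule R.lift_add, rule bilinI;
      simp add: sigma_add sigma_scale delta_add delta_scale R.pure_add R.pure_scale)+

lemma x_left_emb:
  assumes "U \<in> R.carr"
  shows "T.pure x 1 * emb U = emb (sl U) * T.pure x 1 + emb (dl U)"
    and "T.pure 1 x * emb U = emb (sr U) * T.pure 1 x + emb (dr U)"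
proof -
  show "T.pure x 1 * emb U = emb (sl U) * T.pure x 1 + emb (dl U)"
    by (rule R.carr_eqI[OF assms, where F = "\<lambda>U. T.pure x 1 * emb U" and G = "\<lambda>U. emb (sl U) * T.pure x 1 + emb (dl U)"])
      (simp_all add: slots_add emb_add distrib_left distrib_right slots_pure emb_pure T.pure_mult x_iota T.pure_add_left)
  show "T.pure 1 x * emb U = emb (sr U) * T.pure 1 x + emb (dr U)"
    by (rule R.carr_eqI[OF assms, where F = "\<lambda>U. T.pure 1 x * emb U" and G = "\<lambda>U. emb (sr U) * T.pure 1 x + emb (dr U)"])
      (simp_all add: slots_add emb_add distrib_left distrib_right slots_pure emb_pure T.pure_mult x_iota T.pure_add_right)
qed

end

context hopf_algebra
begin

lemma grouplike_inverse:
  assumes "D h = pure h h" "\<epsilon> h = 1"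
  shows "S h * h = 1" "h * S h = 1" "ring_inv h = S h" "D (S h) = pure (S h) (S h)" "\<epsilon> (S h) = 1" "S (S h) = h"
proof -
  have bil: "bilin s (\<lambda>p q. S p * q)" "bilin s (\<lambda>p q. p * S q)"
    by (rule bilinI; simp add: hopf_linear_simps)+
  show 1: "S h * h = 1" "h * S h = 1"
    using antipode_left'[of h] antipode_right'[of h] by (simp_all add: assms lift_pure bil)
  show "ring_inv h = S h"
    unfolding ring_inv_def
  proof (rule the_equality)
    fix b assume b: "h * b = 1 \<and> b * h = 1"
    then have "S h * (h * b) = S h" by simp
    then show "b = S h" using 1 by (simp add: mult.assoc[symmetric])
  qed (use 1 in simp)
  have "D (S h) * D h * pure (S h) (S h) = pure 1 1 * pure (S h) (S h)"
    by (simp add: D_mult[symmetric] 1 D_one)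
  then show "D (S h) = pure (S h) (S h)"
    by (simp add: assms(1) mult.assoc pure_mult 1)
  then show eps: "\<epsilon> (S h) = 1"
    using counit_mult[of "S h" h] assms(2) by (simp add: 1)
  have "S (S h) * S h * h = 1 * h"
    using antipode_mult[of h "S h"] by (simp add: 1 antipode_one)
  then show "S (S h) = h" by (simp add: mult.assoc 1)
qed

end

context hopf_ore
begin

lemma sum_sw_lift:
  fixes \<phi> :: "'r \<Rightarrow> 'r \<Rightarrow> 'v::ab_group_add"
  shows "bilin sR \<phi> \<Longrightarrow> R.total (sw w) = W \<Longrightarrow> (\<Sum>(a, b)\<leftarrow>sw w. \<phi> a b) = R.lift \<phi> W"
  by (simp add: R.lift_total[symmetric])

text \<open>Translation of the conditions into the model, with S(\<beta>) in place of the inverse of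
  \<beta> and the cocycle condition tested by slices.\<close>

lemma hopf_ore_data_iff:
  assumes w: "w \<in> tensors sR"
  defines "W \<equiv> R.total (sw w)"
  shows "hopf_ore_data sR \<Delta> \<epsilon> S \<sigma> \<delta> \<beta> w \<chi> \<longleftrightarrow>
    H.D \<beta> = R.pure \<beta> \<beta> \<and> \<epsilon> \<beta> = 1 \<and>
    \<beta> * R.lift (\<lambda>a b. a * S b) W = R.lift (\<lambda>a b. S a * b) W \<and> character sR \<chi> \<and>
    (\<forall>r. \<sigma> r = R.lift (\<lambda>a b. sR (\<chi> a) b) (H.D r)) \<and>
    (\<forall>r. \<sigma> r = R.lift (\<lambda>a b. sR (\<chi> b) (S \<beta> * a * \<beta>)) (H.D r)) \<and>
    (\<forall>r. dl (H.D r) + R.pure (S \<beta>) 1 * dr (H.D r) + W * H.D r = H.D (\<sigma> r) * W + H.D (\<delta> r)) \<and>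
    (\<forall>f. Vector_Spaces.linear sR (*) f \<longrightarrow>
      R.lift (\<lambda>a b. R.pure (sR (f a) b) 1) W + R.lift (\<lambda>a b. R.lift (\<lambda>p q. R.pure (sR (f p) q) b) (H.D a)) W =
      R.lift (\<lambda>a b. R.pure (sR (f (S \<beta>)) a) b) W + R.lift (\<lambda>a b. R.pure (sR (f a) 1) 1 * H.D b) W)"
    (is "?L \<longleftrightarrow> ?R")
proof -
  have gl: "grouplike sR \<Delta> \<epsilon> \<beta> \<longleftrightarrow> H.D \<beta> = R.pure \<beta> \<beta> \<and> \<epsilon> \<beta> = 1"
    by (simp add: grouplike_def H.Delta_eq_iff)
  have ri: "ring_inv \<beta> = S \<beta>" if "H.D \<beta> = R.pure \<beta> \<beta> \<and> \<epsilon> \<beta> = 1"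
    using H.grouplike_inverse(3) that by blast
  have bil: "bilin sR (\<lambda>p q. S p * q)" "bilin sR (\<lambda>p q. p * S q)"
    by (rule bilinI; simp add: H.hopf_linear_simps)+
  have anti: "(\<Sum>(a, b)\<leftarrow>sw w. a * S b) = R.lift (\<lambda>a b. a * S b) W" "(\<Sum>(a, b)\<leftarrow>sw w. S a * b) = R.lift (\<lambda>a b. S a * b) W"
    by (simp_all add: sum_sw_lift bil W_def)
  have sig1: "(\<Sum>(a, b)\<leftarrow>sw (\<Delta> r). sR (\<chi> a) b) = R.lift (\<lambda>a b. sR (\<chi> a) b) (H.D r)"
    if "character sR \<chi>" for r
    using that by (intro H.lift_D[symmetric] R.bilin_slice) (simp add: algebra_hom_def)
  have sig2: "(\<Sum>(a, b)\<leftarrow>sw (\<Delta> r). sR (\<chi> b) (S \<beta> * a * \<beta>)) = R.lift (\<lambda>a b. sR (\<chi> b) (S \<beta> * a * \<beta>)) (H.D r)"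
    if "character sR \<chi>" for r
  proof (rule H.lift_D[symmetric], rule bilinI)
    note l = R.linearD[OF conjunct1[OF that[unfolded algebra_hom_def]]]
    show "sR (\<chi> b) (S \<beta> * (a + a') * \<beta>) = sR (\<chi> b) (S \<beta> * a * \<beta>) + sR (\<chi> b) (S \<beta> * a' * \<beta>)" for a a' b
      by (simp add: distrib_left distrib_right R.scale_right_distrib)
    show "sR (\<chi> (b + b')) (S \<beta> * a * \<beta>) = sR (\<chi> b) (S \<beta> * a * \<beta>) + sR (\<chi> b') (S \<beta> * a * \<beta>)" for a b b'
      by (simp add: l R.scale_left_distrib)
    show "sR (\<chi> b) (S \<beta> * sR c a * \<beta>) = sR (\<chi> (sR c b)) (S \<beta> * a * \<beta>)" for c a b
      by (simp add: l R.scale_mult mult.commute)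
  qed
  have der: "tens sR (sw (\<Delta> (\<delta> r)) @ lneg (map (\<lambda>(a, b). (\<delta> a, b)) (sw (\<Delta> r)))
      @ lneg (map (\<lambda>(a, b). (S \<beta> * a, \<delta> b)) (sw (\<Delta> r))) @ lneg (lmult (sw w) (sw (\<Delta> r)))
      @ lmult (sw (\<Delta> (\<sigma> r))) (sw w)) = tens sR [] \<longleftrightarrow>
    dl (H.D r) + R.pure (S \<beta>) 1 * dr (H.D r) + W * H.D r = H.D (\<sigma> r) * W + H.D (\<delta> r)" for r
  proof -
    have 1: "R.total (map (\<lambda>(a, b). (\<delta> a, b)) u) = dl (R.total u)" for u
      by (induction u) (auto simp: slots_add slots_pure, simp add: dl_def)
    have 2: "R.total (map (\<lambda>(a, b). (S \<beta> * a, \<delta> b)) u) = R.pure (S \<beta>) 1 * dr (R.total u)" for u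
      by (induction u) (auto simp: slots_add slots_pure distrib_left R.pure_mult, simp add: dr_def)
    show ?thesis
      unfolding R.tens_eq_iff_total
      by (simp add: R.total_lneg R.total_lmult 1 2 H.D_def[symmetric] W_def[symmetric])
        (auto simp: algebra_simps)
  qed
  let ?l = "\<lambda>f u. \<Sum>(a, b, c)\<leftarrow>u. R.pure (sR (f a) b) c"
  have slice: "?l f (map (\<lambda>(a, b). (a, b, 1)) (sw w)
         @ concat (map (\<lambda>(a, b). map (\<lambda>(p, q). (p, q, b)) (sw (\<Delta> a))) (sw w)))
      = ?l f (map (\<lambda>(a, b). (S \<beta>, a, b)) (sw w)
         @ concat (map (\<lambda>(a, b). map (\<lambda>(p, q). (a, p, q)) (sw (\<Delta> b))) (sw w))) \<longleftrightarrow>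
      R.lift (\<lambda>a b. R.pure (sR (f a) b) 1) W + R.lift (\<lambda>a b. R.lift (\<lambda>p q. R.pure (sR (f p) q) b) (H.D a)) W =
      R.lift (\<lambda>a b. R.pure (sR (f (S \<beta>)) a) b) W + R.lift (\<lambda>a b. R.pure (sR (f a) 1) 1 * H.D b) W"
    if f: "Vector_Spaces.linear sR (*) f" for f
  proof -
    have b4: "bilin sR (\<lambda>a b. R.pure (sR (f (S \<beta>)) a) b)"
      by (rule bilinI) (simp_all add: R.pure_add R.pure_scale R.scale_right_distrib mult.commute)
    have 1: "?l f (map (\<lambda>(a, b). (a, b, 1)) (sw w)) = R.lift (\<lambda>a b. R.pure (sR (f a) b) 1) W"
      unfolding W_def R.lift_total[OF R.bilin_slice_pure[OF f]] by (simp add: o_def case_prod_unfold)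
    have 2: "?l f (map (\<lambda>(a, b). (S \<beta>, a, b)) (sw w)) = R.lift (\<lambda>a b. R.pure (sR (f (S \<beta>)) a) b) W"
      unfolding W_def R.lift_total[OF b4] by (simp add: o_def case_prod_unfold)
    show ?thesis
      unfolding map_append sum_list_append 1 2
        R.slice_coproduct_lists[where \<Delta> = \<Delta>, OF H.D_add H.D_scale f H.D_def[symmetric]] W_def ..
  qed
  have coc: "tens3 sR (map (\<lambda>(a, b). (a, b, 1)) (sw w)
         @ concat (map (\<lambda>(a, b). map (\<lambda>(p, q). (p, q, b)) (sw (\<Delta> a))) (sw w)))
      = tens3 sR (map (\<lambda>(a, b). (S \<beta>, a, b)) (sw w)
         @ concat (map (\<lambda>(a, b). map (\<lambda>(p, q). (a, p, q)) (sw (\<Delta> b))) (sw w))) \<longleftrightarrow>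
    (\<forall>f. Vector_Spaces.linear sR (*) f \<longrightarrow>
      R.lift (\<lambda>a b. R.pure (sR (f a) b) 1) W + R.lift (\<lambda>a b. R.lift (\<lambda>p q. R.pure (sR (f p) q) b) (H.D a)) W =
      R.lift (\<lambda>a b. R.pure (sR (f (S \<beta>)) a) b) W + R.lift (\<lambda>a b. R.pure (sR (f a) 1) 1 * H.D b) W)"
    unfolding R.tens3_eq_iff_slices
    by (rule iff_allI, rule imp_cong[OF HOL.refl], erule slice)
  show ?thesis
  \<comment> \<open>The inverse of \<beta> and the linearity of \<chi> are available only under
    these conjuncts; without them both sides are false.\<close>
  proof (cases "(H.D \<beta> = R.pure \<beta> \<beta> \<and> \<epsilon> \<beta> = 1) \<and> character sR \<chi>")
    case True
    then show ?thesis
      using w unfolding hopf_ore_data_def gl ri[OF conjunct1[OF True]] anti der coc by (simp add: sig1 sig2)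
  next
    case False
    then show ?thesis unfolding hopf_ore_data_def gl by blast
  qed
qed

end

context ore
begin

lemma total_ore_comult:
  "T.total ([(\<iota> g, x), (x, 1)] @ map (map_prod \<iota> \<iota>) (sw w)) =
    T.pure (\<iota> g) x + T.pure x 1 + emb (R.total (sw w))"
  by (simp add: emb_total add.assoc)

end

context k_algebra
begin

lemma carr_tensor:
  assumes "W \<in> carr"
  obtains w where "w \<in> tensors s" "total (sw w) = W"
proof -
  obtain u where "W = total u" using assms by (auto simp: carr_def)
  then show ?thesis using that[of "tens s u"] by (simp add: tensors_def total_sw_tens)
qed

end

context hopf_ore_ext
begin

text \<open>The antipode axioms at x give S(x) and its compatibility with w. Applying \<Delta> to x
  r = \<sigma>(r) x + \<delta>(r) gives the conditions on \<sigma> and \<delta>, and coassociativity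
  at x gives the cocycle condition.\<close>

lemma necessary_conditions:
  assumes eps_x: "\<epsilon>T x = 0" and W: "W \<in> R.carr" and \<beta>: "H.D \<beta> = R.pure \<beta> \<beta>" "\<epsilon> \<beta> = 1"
    and D_x: "HT.D x = T.pure (\<iota> (S \<beta>)) x + T.pure x 1 + emb W"
  shows "\<exists>w \<chi>. hopf_ore_data sR \<Delta> \<epsilon> S \<sigma> \<delta> \<beta> w \<chi> \<and>
    \<Delta>T x = ore_comult sT \<iota> x \<beta> w \<and> ST x = ore_antipode \<iota> S x \<beta> w"
proof -
  note gl = H.grouplike_inverse[OF \<beta>]
  obtain w where w: "w \<in> tensors sR" "R.total (sw w) = W" using R.carr_tensor[OF W] by blast
  \<comment> \<open>The only possible choice: applying \<epsilon> to \<sigma>(r) = \<Sum> \<chi>(r1)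
    r2 returns \<chi>(r).\<close>
  define \<chi> where "\<chi> r = \<epsilon> (\<sigma> r)" for r
  let ?h = "S \<beta>"
  have ibh: "\<iota> \<beta> * (\<iota> ?h * t) = t" for t by (simp add: mult.assoc[symmetric] iota_mult[symmetric] gl)
  have quad: "HT.D x = quad W (R.pure ?h 1) (R.pure 1 1) 0"
    unfolding D_x by (simp add: quad_def emb_pure T.pure_mult add_ac)
  have bil: "bilin sR (\<lambda>p q. S p * q)" "bilin sR (\<lambda>p q. p * S q)"
    by (rule bilinI; simp add: H.hopf_linear_simps)+
  define W1 where "W1 = R.lift (\<lambda>a b. a * S b) W"
  define W2 where "W2 = R.lift (\<lambda>a b. S a * b) W"
  have ST_x: "ST x = - \<iota> \<beta> * (x + \<iota> W1)"
  proof -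
    have b: "bilin sT (\<lambda>p q. p * ST q)" by (rule bilinI) (simp_all add: HT.hopf_linear_simps)
    have "T.lift (\<lambda>p q. p * ST q) (emb W) = \<iota> W1"
      unfolding W1_def lift_emb[OF b] antipode_ext iota_mult[symmetric]
      by (rule R.lift_additive[symmetric]) (rule iota_add)
    then have "\<iota> ?h * ST x + x + \<iota> W1 = 0"
      using HT.antipode_right'[of x] unfolding D_x
      by (simp add: T.lift_add[OF b] T.lift_pure[OF b] HT.antipode_one eps_x)
    then have "\<iota> ?h * ST x = - (x + \<iota> W1)" by (simp only: eq_neg_iff_add_eq_0 add.assoc)
    then have "\<iota> \<beta> * (\<iota> ?h * ST x) = - \<iota> \<beta> * (x + \<iota> W1)"
      by (simp only: mult_minus_left mult_minus_right)
    then show ?thesis by (simp only: ibh)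
  qed
  \<comment> \<open>The right antipode axiom has already determined S(x); inserting it into the left
    one leaves exactly this relation.\<close>
  have W12: "\<beta> * W1 = W2"
  proof -
    have b: "bilin sT (\<lambda>p q. ST p * q)" by (rule bilinI) (simp_all add: HT.hopf_linear_simps)
    have "T.lift (\<lambda>p q. ST p * q) (emb W) = \<iota> W2"
      unfolding W2_def lift_emb[OF b] antipode_ext iota_mult[symmetric]
      by (rule R.lift_additive[symmetric]) (rule iota_add)
    then have "\<iota> \<beta> * x + ST x + \<iota> W2 = 0"
      using HT.antipode_left'[of x] unfolding D_x
      by (simp add: T.lift_add[OF b] T.lift_pure[OF b] antipode_ext gl eps_x)
    then have "\<iota> (\<beta> * W1) = \<iota> W2" unfolding ST_x by (simp add: algebra_simps iota_mult)
    then show ?thesis by simp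
  qed
  \<comment> \<open>Coefficients at 1 \<otimes> 1, 1 \<otimes> x and x \<otimes> 1 of the two
    expressions for \<Delta>(x r).\<close>
  have cmp: "R.pure ?h 1 * dr (H.D r) + dl (H.D r) + W * H.D r = H.D (\<sigma> r) * W + H.D (\<delta> r)"
    "R.pure ?h 1 * sr (H.D r) = H.D (\<sigma> r) * R.pure ?h 1" "sl (H.D r) = H.D (\<sigma> r)" for r
  proof -
    let ?U = "H.D r"
    have ph: "T.pure (\<iota> ?h) x = emb (R.pure ?h 1) * T.pure 1 x" by (simp add: emb_pure T.pure_mult)
    have "HT.D (x * \<iota> r) = HT.D x * emb ?U" by (simp add: HT.D_mult DT_iota)
    also have "\<dots> = quad (R.pure ?h 1 * dr ?U + dl ?U + W * ?U) (R.pure ?h 1 * sr ?U) (sl ?U) 0"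
      unfolding D_x ph distrib_right mult.assoc x_left_emb[OF H.D_carr]
      by (simp add: quad_def emb_add emb_mult W distrib_left mult.assoc add_ac)
    finally have l: "HT.D (x * \<iota> r) = \<dots>" .
    have "HT.D (x * \<iota> r) = emb (H.D (\<sigma> r)) * HT.D x + emb (H.D (\<delta> r))"
      by (simp add: x_iota HT.D_add HT.D_mult DT_iota)
    also have "\<dots> = quad (H.D (\<sigma> r) * W + H.D (\<delta> r)) (H.D (\<sigma> r) * R.pure ?h 1) (H.D (\<sigma> r)) 0"
      unfolding quad by (simp add: emb_mult_quad W) (simp add: quad_def emb_add add_ac)
    finally show "R.pure ?h 1 * dr (H.D r) + dl (H.D r) + W * H.D r = H.D (\<sigma> r) * W + H.D (\<delta> r)"
      "R.pure ?h 1 * sr (H.D r) = H.D (\<sigma> r) * R.pure ?h 1" "sl (H.D r) = H.D (\<sigma> r)"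
      unfolding l by (simp_all add: quad_eq_iff W)
  qed
  have chi: "character sR \<chi>"
    unfolding algebra_hom_def \<chi>_def
    by (intro conjI R.linearI) (use H.counit_linear in \<open>simp_all add: sigma_add sigma_scale sigma_mult
        H.counit_add H.counit_scale H.counit_mult Vector_Spaces.linear_def\<close>)
  have sig1: "\<sigma> r = R.lift (\<lambda>a b. sR (\<chi> a) b) (H.D r)" for r
  proof -
    have "\<sigma> r = epsl (sl (H.D r))" by (simp add: cmp)
    also have "\<dots> = R.lift (\<lambda>a b. epsl (R.pure (\<sigma> a) b)) (H.D r)"
      unfolding sl_def by (rule R.lift_additive) (rule epsl_add)
    finally show ?thesis by (simp add: epsl_pure \<chi>_def)
  qed
  have sig2: "\<sigma> r = R.lift (\<lambda>a b. sR (\<chi> b) (?h * a * \<beta>)) (H.D r)" for r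
  proof -
    have "epsr (sr (H.D r)) = R.lift (\<lambda>a b. epsr (R.pure a (\<sigma> b))) (H.D r)"
      unfolding sr_def by (rule R.lift_additive) (rule epsr_add)
    then have e: "epsr (sr (H.D r)) = R.lift (\<lambda>a b. sR (\<chi> b) a) (H.D r)" by (simp add: epsr_pure \<chi>_def)
    have "\<sigma> r * ?h = ?h * epsr (sr (H.D r))"
      using arg_cong[OF cmp(2)[of r], of epsr] by (simp add: epsr_mult epsr_pure)
    then have "\<sigma> r * ?h * \<beta> = ?h * epsr (sr (H.D r)) * \<beta>" by simp
    then have "\<sigma> r = ?h * R.lift (\<lambda>a b. sR (\<chi> b) a) (H.D r) * \<beta>" by (simp add: mult.assoc gl e)
    then show ?thesis
      by (simp add: R.lift_const_left[symmetric] R.lift_const_right[symmetric] R.scale_mult)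
  qed
  have coc: "R.lift (\<lambda>a b. R.pure (sR (f a) b) 1) W + R.lift (\<lambda>a b. R.lift (\<lambda>p q. R.pure (sR (f p) q) b) (H.D a)) W =
      R.lift (\<lambda>a b. R.pure (sR (f ?h) a) b) W + R.lift (\<lambda>a b. R.pure (sR (f a) 1) 1 * H.D b) W"
    if f: "Vector_Spaces.linear sR (*) f" for f
  proof -
    note fl = R.linearD[OF f]
    \<comment> \<open>f is extended to T so as to vanish at x. In the contracted coassociativity law
      the terms with x then agree on both sides, and the part in R \<otimes> R is the slice by f of
      the cocycle condition.\<close>
    define F where "F t = f (cf 0 t)" for t
    have F: "Vector_Spaces.linear sT (*) F"
      unfolding F_def by (rule T.linearI) (use H.counit_linear in \<open>simp_all add: cf_add cf_scale fl Vector_Spaces.linear_def\<close>)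
    have F_simps: "F (\<iota> r) = f r" "F x = 0" for r
      using fl(2)[of 0 0] by (simp_all add: F_def cf_iota cf_x)
    define l where "l r = R.lift (\<lambda>p q. sR (f p) q) (H.D r)" for r
    define m where "m = R.lift (\<lambda>p q. sR (f p) q) W"
    have li: "T.lift (\<lambda>p q. sT (F p) q) (emb U) = \<iota> (R.lift (\<lambda>p q. sR (f p) q) U)" for U
      unfolding lift_emb[OF bilin_contrl[OF F]] F_simps iota_scale[symmetric]
      by (rule R.lift_additive[symmetric]) (rule iota_add)
    have cr: "contrl F (\<iota> r) = \<iota> (l r)" for r
      by (simp add: contrl_def DT_iota li l_def)
    have cx: "contrl F x = sT (f ?h) x + \<iota> m"
      by (simp add: contrl_def D_x T.lift_add[OF bilin_contrl[OF F]] T.lift_pure[OF bilin_contrl[OF F]] li m_def F_simps)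
    have lh: "l ?h = sR (f ?h) ?h"
      by (simp add: l_def gl R.lift_pure R.bilin_slice[OF f])
    have b: "bilin sT (\<lambda>a b. T.pure (contrl F a) b)"
      by (rule bilinI) (simp_all add: contrl_add[OF F] contrl_scale[OF F] T.pure_add T.pure_scale)
    have k: "T.pure (sT c 1) 1 * V = emb (R.pure (sR c 1) 1) * V" for c V
      by (simp add: emb_pure iota_scale)
    have "HT.D (contrl F x) = T.pure (sT (f ?h) (\<iota> ?h)) x + T.pure (sT (f ?h) x) 1 + emb (R.pure (sR (f ?h) 1) 1 * W + H.D m)"
      by (simp add: cx HT.D_add HT.D_scale DT_iota D_x distrib_left T.pure_mult T.scale_mult_left emb_add emb_mult W
          emb_pure iota_scale)
    moreover have "HT.D (contrl F x) = T.pure (sT (f ?h) (\<iota> ?h)) x + T.pure (sT (f ?h) x) 1 +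
        emb (R.pure m 1 + R.lift (\<lambda>a b. R.pure (l a) b) W)"
      unfolding D_contrl[OF F]
      unfolding D_x T.lift_add[OF b] T.lift_pure[OF b] lift_emb[OF b] cr cx lh
        emb_add R.lift_additive[where F = emb, OF emb_add]
      by (simp add: emb_pure T.pure_add_left iota_scale)
    ultimately have "emb (R.pure (sR (f ?h) 1) 1 * W + H.D m) = emb (R.pure m 1 + R.lift (\<lambda>a b. R.pure (l a) b) W)"
      by simp
    moreover have "R.lift (\<lambda>a b. R.pure (l a) b) W \<in> R.carr"
      by (rule R.lift_in_carr[OF _ R.k_algebra_axioms]) simp
    ultimately have eq: "R.pure (sR (f ?h) 1) 1 * W + H.D m = R.pure m 1 + R.lift (\<lambda>a b. R.pure (l a) b) W"
      by (simp add: emb_eq_iff W)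
    have "R.pure m 1 = R.lift (\<lambda>a b. R.pure (sR (f a) b) 1) W"
      unfolding m_def by (rule R.lift_additive[where F = "\<lambda>z. R.pure z 1"]) (rule R.pure_add_left)
    moreover have "R.pure (l a) b = R.lift (\<lambda>p q. R.pure (sR (f p) q) b) (H.D a)" for a b
      unfolding l_def by (rule R.lift_additive[where F = "\<lambda>z. R.pure z b"]) (rule R.pure_add_left)
    moreover have "H.D m = R.lift (\<lambda>a b. H.D (sR (f a) b)) W"
      unfolding m_def by (rule R.lift_additive) (rule H.D_add)
    ultimately show ?thesis
      using eq by (simp add: H.D_scale R.lift_pure_scale W)
  qed
  have "hopf_ore_data sR \<Delta> \<epsilon> S \<sigma> \<delta> \<beta> w \<chi>"
    unfolding hopf_ore_data_iff[OF w(1)] w(2) W1_def[symmetric] W2_def[symmetric]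
    using \<beta> W12 chi sig1 sig2 cmp(1) coc by (simp add: add_ac)
  moreover have "\<Delta>T x = ore_comult sT \<iota> x \<beta> w"
    unfolding ore_comult_def HT.Delta_eq_iff total_ore_comult gl(3) w(2) by (rule D_x)
  moreover have "ST x = ore_antipode \<iota> S x \<beta> w"
    unfolding ore_antipode_def ST_x W1_def by (simp add: sum_sw_lift bil w)
  ultimately show ?thesis by blast
qed

lemma change_variable_ext:
  assumes "ore_extension sR sT \<iota> y \<tau> d"
  shows "hopf_ore_ext sR sT \<iota> y \<tau> d \<Delta> \<epsilon> S \<Delta>T \<epsilon>T ST"
proof -
  interpret Y: ore sR sT \<iota> y \<tau> d
    using assms by unfold_locales
  show ?thesis
    by unfold_locales (rule dom comult_ext counit_ext antipode_ext)+
qed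

text \<open>Two changes of variable: the shift by -\<epsilon>(x) achieves \<epsilon>(x) = 0, and the
  subsequent scaling by a unit preserves this because \<epsilon> is multiplicative.\<close>

theorem necessity:
  "\<exists>x' \<sigma>' \<delta>' \<beta> w \<chi>. ore_extension sR sT \<iota> x' \<sigma>' \<delta>' \<and>
    hopf_ore_data sR \<Delta> \<epsilon> S \<sigma>' \<delta>' \<beta> w \<chi> \<and>
    \<Delta>T x' = ore_comult sT \<iota> x' \<beta> w \<and> ST x' = ore_antipode \<iota> S x' \<beta> w"
proof -
  let ?e = "sR (\<epsilon>T x) 1"
  define y where "y = \<iota> 1 * x + \<iota> (- ?e)"
  have ore_y: "ore_extension sR sT \<iota> y (\<lambda>r. 1 * \<sigma> r * 1) (\<lambda>r. 1 * \<delta> r + - ?e * r - 1 * \<sigma> r * 1 * - ?e)"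
    unfolding y_def by (rule change_of_variable) simp_all
  interpret Y: hopf_ore_ext sR sT \<iota> y "\<lambda>r. 1 * \<sigma> r * 1" "\<lambda>r. 1 * \<delta> r + - ?e * r - 1 * \<sigma> r * 1 * - ?e" \<Delta> \<epsilon> S \<Delta>T \<epsilon>T ST
    by (rule change_variable_ext[OF ore_y])
  have eps_y: "\<epsilon>T y = 0"
    by (simp add: y_def HT.counit_add counit_ext H.counit_minus H.counit_scale)
  from Y.normal_form[OF eps_y] obtain v b h w where n: "v * b = 1" "b * v = 1" "w \<in> R.carr" "\<epsilon> h = 1"
    "H.D h = R.pure h h" "HT.D (\<iota> v * y) = T.pure (\<iota> (S h)) (\<iota> v * y) + T.pure (\<iota> v * y) 1 + emb w" .
  define z where "z = \<iota> v * y"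
  obtain \<tau> d where ore_z: "ore_extension sR sT \<iota> z \<tau> d"
    using Y.change_of_variable[OF n(1,2), of 0] by (auto simp: z_def)
  interpret Z: hopf_ore_ext sR sT \<iota> z \<tau> d \<Delta> \<epsilon> S \<Delta>T \<epsilon>T ST
    by (rule change_variable_ext[OF ore_z])
  have "\<epsilon>T z = 0" by (simp add: z_def HT.counit_mult eps_y)
  from Z.necessary_conditions[OF this n(3,5,4)] n(6) ore_z show ?thesis
    unfolding z_def[symmetric] by blast
qed

end

section \<open>Sufficiency of the conditions\<close>

context k_algebra
begin

lemma linear_separates:
  assumes "\<And>f. Vector_Spaces.linear s (*) f \<Longrightarrow> f a = 0"
  shows "a = 0"
proof -
  have "a = (\<Sum>q | crd a q \<noteq> 0. s (crd a q) q)" by (rule crd_expand[symmetric])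
  then show ?thesis using assms[OF linear_crd] by simp
qed

lemma scalar_central: "U \<in> carr \<Longrightarrow> U * (pure (s k 1) 1 * V) = pure (s k 1) 1 * (U * V)"
  by (rule carr_eqI[where F = "\<lambda>U. U * (pure (s k 1) 1 * V)" and G = "\<lambda>U. pure (s k 1) 1 * (U * V)"])
    (simp_all add: distrib_left distrib_right mult.assoc[symmetric] pure_mult scale_mult)

lemma lift_sandwich:
  "U \<in> carr \<Longrightarrow> lift (\<lambda>p q. pure (a * p * c) (b * q * d)) U = pure a b * U * pure c d"
  using lift_const_left[of "pure a b" pure U] lift_const_right[of "\<lambda>p q. pure a b * pure p q" "pure c d" U]
  by (simp add: lift_pure_id pure_mult)

end

locale hopf_ore_datum = hopf_ore sR sT \<iota> x \<sigma> \<delta> \<Delta> \<epsilon> S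
  for sR :: "'k::field \<Rightarrow> 'r::ring_1 \<Rightarrow> 'r" and sT :: "'k \<Rightarrow> 't::ring_1 \<Rightarrow> 't"
    and \<iota> :: "'r \<Rightarrow> 't" and x :: 't and \<sigma> \<delta> :: "'r \<Rightarrow> 'r" and \<Delta> \<epsilon> S +
  fixes \<beta> :: 'r and w :: "'r tensor2" and \<chi> :: "'r \<Rightarrow> 'k"
  assumes datum: "hopf_ore_data sR \<Delta> \<epsilon> S \<sigma> \<delta> \<beta> w \<chi>"
begin

definition W where "W = R.total (sw w)"

abbreviation h where "h \<equiv> S \<beta>"

lemma W_carr [simp]: "W \<in> R.carr"
  by (simp add: W_def)

lemma w_tensor: "w \<in> tensors sR"
  using datum by (simp add: hopf_ore_data_def)

lemmas datum_model = datum[unfolded hopf_ore_data_iff[OF w_tensor] W_def[symmetric]]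

lemma grouplike_beta: "H.D \<beta> = R.pure \<beta> \<beta>" "\<epsilon> \<beta> = 1"
  using datum_model by blast+

lemmas gl = H.grouplike_inverse[OF grouplike_beta]

lemma chi_linear: "\<chi> (a + b) = \<chi> a + \<chi> b" "\<chi> (sR c a) = c * \<chi> a"
proof -
  have "Vector_Spaces.linear sR (*) \<chi>" using datum_model by (simp add: algebra_hom_def)
  then show "\<chi> (a + b) = \<chi> a + \<chi> b" "\<chi> (sR c a) = c * \<chi> a" by (simp_all add: R.linearD)
qed

lemma sigma_left: "\<sigma> r = R.lift (\<lambda>a b. sR (\<chi> a) b) (H.D r)"
  and sigma_right: "\<sigma> r = R.lift (\<lambda>a b. sR (\<chi> b) (h * a * \<beta>)) (H.D r)"
  and delta_cocycle: "dl (H.D r) + R.pure h 1 * dr (H.D r) + W * H.D r = H.D (\<sigma> r) * W + H.D (\<delta> r)"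
  using datum_model by blast+

lemma w_cocycle:
  assumes "Vector_Spaces.linear sR (*) f"
  shows "R.lift (\<lambda>a b. R.pure (sR (f a) b) 1) W + R.lift (\<lambda>a b. R.lift (\<lambda>p q. R.pure (sR (f p) q) b) (H.D a)) W =
      R.lift (\<lambda>a b. R.pure (sR (f h) a) b) W + R.lift (\<lambda>a b. R.pure (sR (f a) 1) 1 * H.D b) W"
  using datum_model assms by blast

text \<open>A left winding map touches only the first factor: coassociativity turns \<Delta> \<circ>
  \<sigma> into (\<sigma> \<otimes> I) \<circ> \<Delta>.\<close>

lemma D_sigma: "H.D (\<sigma> r) = sl (H.D r)"
proof -
  have "H.D (\<sigma> r) = R.lift (\<lambda>a b. H.D (sR (\<chi> a) b)) (H.D r)"
    by (subst sigma_left) (rule R.lift_additive, rule H.D_add)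
  also have "\<dots> = R.lift (\<lambda>a b. R.lift (\<lambda>p q. R.pure (sR (\<chi> a) p) q) (H.D b)) (H.D r)"
    by (simp add: H.D_scale R.lift_pure_scale)
  also have "\<dots> = R.lift (\<lambda>a b. R.lift (\<lambda>p q. R.pure (sR (\<chi> p) q) b) (H.D a)) (H.D r)"
    by (rule H.coassoc_lift[symmetric], rule trilinI)
      (simp_all add: chi_linear R.pure_add R.scale_distrib
        R.pure_scale mult.commute)
  also have "\<dots> = R.lift (\<lambda>a b. R.pure (\<sigma> a) b) (H.D r)"
    unfolding sigma_left R.lift_additive[where F = "\<lambda>z. R.pure z b" for b, OF R.pure_add_left] ..
  finally show ?thesis by (simp add: sl_def)
qed

text \<open>The right winding description touches only the second factor, up to the grouplike
  conjugation that leaves h \<otimes> 1 on both sides.\<close>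

lemma D_sigma': "H.D (\<sigma> r) * R.pure h 1 = R.pure h 1 * sr (H.D r)"
proof -
  have 1: "H.D (sR k (h * a * \<beta>)) * R.pure h 1 = R.lift (\<lambda>p q. R.pure (h * p) (sR k (h * q * \<beta>))) (H.D a)" for k a
  proof -
    have "H.D (sR k (h * a * \<beta>)) * R.pure h 1 = R.pure (sR k h) h * H.D a * R.pure 1 \<beta>"
      by (simp add: H.D_scale H.D_mult gl grouplike_beta mult.assoc R.pure_mult)
        (simp add: mult.assoc[symmetric] R.pure_mult R.scale_mult_left)
    also have "\<dots> = R.lift (\<lambda>p q. R.pure (sR k h * p * 1) (h * q * \<beta>)) (H.D a)"
      by (rule R.lift_sandwich[symmetric]) simp
    finally show ?thesis by (simp add: R.scale_mult_left R.pure_scale)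
  qed
  have "H.D (\<sigma> r) * R.pure h 1 = R.lift (\<lambda>a b. H.D (sR (\<chi> b) (h * a * \<beta>)) * R.pure h 1) (H.D r)"
    by (subst sigma_right) (rule R.lift_additive[where F = "\<lambda>z. H.D z * R.pure h 1"], simp add: H.D_add distrib_right)
  also have "\<dots> = R.lift (\<lambda>a b. R.lift (\<lambda>p q. R.pure (h * p) (sR (\<chi> b) (h * q * \<beta>))) (H.D a)) (H.D r)"
    by (simp add: 1)
  also have "\<dots> = R.lift (\<lambda>a b. R.lift (\<lambda>p q. R.pure (h * a) (sR (\<chi> q) (h * p * \<beta>))) (H.D b)) (H.D r)"
    by (rule H.coassoc_lift, rule trilinI)
      (simp_all add: chi_linear R.pure_add R.scale_distrib
        R.scale_mult distrib_left distrib_right mult.commute[of _ "\<chi> _"] R.pure_scale)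
  also have "\<dots> = R.lift (\<lambda>a b. R.pure (h * a) (\<sigma> b)) (H.D r)"
    unfolding sigma_right R.lift_additive[where F = "R.pure c" for c, OF R.pure_add_right] ..
  also have "\<dots> = R.pure h 1 * sr (H.D r)"
    unfolding sr_def R.lift_const_left[symmetric] by (simp add: R.pure_mult)
  finally show ?thesis .
qed

definition X where "X = T.pure (\<iota> h) x + T.pure x 1 + emb W"

lemma X_carr [simp]: "X \<in> T.carr"
  by (simp add: X_def)

text \<open>The Ore relation for the prescribed \<Delta>(x), as the universal property demands it.
  Its parts at 1 \<otimes> x, x \<otimes> 1 and 1 \<otimes> 1 are \<open>D_sigma'\<close>,
  \<open>D_sigma\<close> and \<open>delta_cocycle\<close>.\<close>

lemma X_commute: "X * emb (H.D r) = emb (H.D (\<sigma> r)) * X + emb (H.D (\<delta> r))"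
proof -
  let ?U = "H.D r"
  have ph: "T.pure (\<iota> h) x = emb (R.pure h 1) * T.pure 1 x" by (simp add: emb_pure T.pure_mult)
  have "X * emb ?U = emb (R.pure h 1 * sr ?U) * T.pure 1 x + emb (sl ?U) * T.pure x 1 +
      emb (dl ?U + R.pure h 1 * dr ?U + W * ?U)"
    unfolding X_def ph distrib_right mult.assoc x_left_emb[OF H.D_carr]
    by (simp add: emb_add emb_mult distrib_left mult.assoc add_ac)
  also have "\<dots> = emb (H.D (\<sigma> r)) * X + emb (H.D (\<delta> r))"
    unfolding delta_cocycle D_sigma'[symmetric] D_sigma[symmetric] X_def ph
    by (simp add: emb_add emb_mult distrib_left mult.assoc add_ac)
  finally show ?thesis .
qed

section \<open>Extension of the coproduct to T\<close>

definition DT :: "'t \<Rightarrow> ('t \<Rightarrow>\<^sub>0 't) endo"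
  where "DT = ext (\<lambda>r. emb (H.D r)) (\<lambda>z. z * X)"

lemma DT_add: "DT (s + t) = DT s + DT t"
  unfolding DT_def by (rule ext_add) (simp_all add: H.D_add emb_add distrib_right)

lemma DT_iota: "DT (\<iota> r) = emb (H.D r)"
  unfolding DT_def by (rule ext_iota) (simp_all add: H.D_add emb_add distrib_right)

lemma emb_one: "emb (R.pure 1 1) = T.pure 1 1"
  by (simp add: emb_pure)

lemma DT_x: "DT x = X"
  unfolding DT_def by (subst ext_x) (simp_all add: H.D_add emb_add distrib_right H.D_one emb_one)

lemma DT_one: "DT 1 = T.pure 1 1"
  using DT_iota[of 1] by (simp add: H.D_one emb_one)

lemma DT_mult: "DT (s * t) = DT s * DT t"
  unfolding DT_def
  by (rule ext_mult[where m = "(*)" and y = X])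
    (simp_all add: H.D_add emb_add distrib_right distrib_left mult.assoc H.D_mult emb_mult H.D_one emb_one X_commute)

lemma DT_scale: "DT (sT c t) = T.pure (sT c 1) 1 * DT t"
  unfolding DT_def
  by (rule ext_scale)
    (simp_all add: H.D_add emb_add distrib_right distrib_left mult.assoc H.D_scale emb_mult emb_pure iota_scale)

lemma DT_carr [simp]: "DT t \<in> T.carr"
  by (induction t rule: ore_induct_alg) (simp_all add: DT_iota DT_x DT_add DT_mult)

section \<open>Extension of the counit to T\<close>

definition \<kappa> where "\<kappa> = \<epsilon> (epsr W)"

text \<open>\<epsilon> is applied to the middle factor of the cocycle condition: both terms
  containing a coproduct collapse to the same slice of w and cancel.\<close>

lemma eps_cocycle:
  assumes f: "Vector_Spaces.linear sR (*) f"
  shows "sR (f (epsr W)) 1 = sR (f h) (epsl W)"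
proof -
  note fl = R.linearD[OF f]
  define m where "m = R.lift (\<lambda>a b. sR (f a) b) W"
  have la: "epsl (R.lift \<phi> U) = R.lift (\<lambda>a b. epsl (\<phi> a b)) U" for \<phi> U
    by (rule R.lift_additive) (rule epsl_add)
  have "epsl (R.lift (\<lambda>a b. R.pure (sR (f a) b) 1) W) = sR (f (epsr W)) 1"
    unfolding la epsr_def R.lift_additive[where F = "\<lambda>z. sR (f z) 1", unfolded fl, OF R.scale_left_distrib]
    by (simp add: epsl_pure H.counit_scale fl mult.commute)
  moreover have "epsl (R.lift (\<lambda>a b. R.lift (\<lambda>p q. R.pure (sR (f p) q) b) (H.D a)) W) = m"
  proof -
    have "R.lift (\<lambda>p q. sR (f p * \<epsilon> q) b) (H.D a) = sR (f a) b" for a b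
      using H.lift_counit_right[where F = "\<lambda>z. sR (f z) b" and r = a]
      by (simp add: fl R.scale_left_distrib mult.commute)
    then show ?thesis unfolding la m_def by (simp add: epsl_pure H.counit_scale)
  qed
  moreover have "epsl (R.lift (\<lambda>a b. R.pure (sR (f h) a) b) W) = sR (f h) (epsl W)"
    unfolding R.lift_pure_scale[OF W_carr] by (simp add: epsl_mult epsl_pure H.counit_scale R.scale_mult_left)
  moreover have "epsl (R.lift (\<lambda>a b. R.pure (sR (f a) 1) 1 * H.D b) W) = m"
    unfolding la m_def by (simp add: epsl_mult epsl_pure H.counit_scale R.scale_mult_left)
  ultimately show ?thesis
    using arg_cong[OF w_cocycle[OF f], of epsl] by (simp add: epsl_add)
qed

lemma epsl_W: "epsl W = sR \<kappa> 1"
  using eps_cocycle[OF H.counit_linear] by (simp add: \<kappa>_def gl)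

text \<open>Since (\<epsilon> \<otimes> I)(w) is the scalar \<kappa>, \<open>eps_cocycle\<close>
  evaluates every functional at (I \<otimes> \<epsilon>)(w), and functionals separate
  points.\<close>

lemma epsr_W: "epsr W = sR \<kappa> h"
proof -
  have "epsr W - sR \<kappa> h = 0"
  proof (rule R.linear_separates)
    fix f :: "'r \<Rightarrow> 'k" assume f: "Vector_Spaces.linear sR (*) f"
    have "sR (f (epsr W) - f h * \<kappa>) 1 = 0"
      using eps_cocycle[OF f] by (simp add: epsl_W R.scale_left_diff_distrib)
    then have "\<epsilon> (sR (f (epsr W) - f h * \<kappa>) 1) = 0" by simp
    moreover have "f (epsr W - sR \<kappa> h) = f (epsr W) - f h * \<kappa>"
      using R.linearD(1)[OF f, of "epsr W - sR \<kappa> h" "sR \<kappa> h"] by (simp add: R.linearD[OF f])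
    ultimately show "f (epsr W - sR \<kappa> h) = 0" by (simp add: H.counit_scale)
  qed
  then show ?thesis by simp
qed

text \<open>\<epsilon> \<otimes> \<epsilon> applied to \<open>delta_cocycle\<close>, where
  \<epsilon>(\<delta>(r)) arises twice on the left and once on the right. It is the Ore relation for
  \<epsilon>(x) = -\<kappa>.\<close>

lemma eps_delta: "\<epsilon> (\<delta> r) = \<kappa> * \<epsilon> (\<sigma> r) - \<kappa> * \<epsilon> r"
proof -
  have la: "\<epsilon> (epsl (R.lift \<phi> U)) = R.lift (\<lambda>a b. \<epsilon> (epsl (\<phi> a b))) U" for \<phi> U
    by (rule R.lift_additive[where F = "\<lambda>z. \<epsilon> (epsl z)"]) (simp add: epsl_add H.counit_add)
  have "\<epsilon> (epsl (dl (H.D r))) = \<epsilon> (\<delta> r)" "\<epsilon> (epsl (dr (H.D r))) = \<epsilon> (\<delta> r)"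
    using H.lift_counit_right[where F = "\<lambda>z. \<epsilon> (\<delta> z)" and r = r] H.lift_counit_left[where F = "\<lambda>z. \<epsilon> (\<delta> z)" and r = r]
    unfolding dl_def dr_def la
    by (simp_all add: epsl_pure H.counit_scale H.counit_add delta_add delta_scale mult.commute)
  then show ?thesis
    using arg_cong[OF delta_cocycle[of r], of "\<lambda>z. \<epsilon> (epsl z)"]
    by (simp add: epsl_add epsl_mult epsl_pure H.counit_add H.counit_mult epsl_W H.counit_scale gl algebra_simps)
qed

definition \<epsilon>T :: "'t \<Rightarrow> 'k"
  where "\<epsilon>T = ext \<epsilon> (\<lambda>z. z * - \<kappa>)"

lemma epsT_add: "\<epsilon>T (s + t) = \<epsilon>T s + \<epsilon>T t"
  unfolding \<epsilon>T_def by (rule ext_add) (simp_all add: H.counit_add algebra_simps)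

lemma epsT_iota: "\<epsilon>T (\<iota> r) = \<epsilon> r"
  unfolding \<epsilon>T_def by (rule ext_iota) (simp_all add: H.counit_add algebra_simps)

lemma epsT_x: "\<epsilon>T x = - \<kappa>"
  unfolding \<epsilon>T_def by (subst ext_x) (simp_all add: H.counit_add algebra_simps)

lemma epsT_mult: "\<epsilon>T (s * t) = \<epsilon>T s * \<epsilon>T t"
  unfolding \<epsilon>T_def
  by (rule ext_mult[where m = "(*)" and y = "- \<kappa>"])
    (simp_all add: H.counit_add H.counit_mult eps_delta algebra_simps)

lemma epsT_scale: "\<epsilon>T (sT c t) = c * \<epsilon>T t"
  unfolding \<epsilon>T_def
  by (rule ext_scale) (simp_all add: H.counit_add H.counit_scale algebra_simps)

lemma vector_space_field: "vector_space ((*) :: 'k \<Rightarrow> 'k \<Rightarrow> 'k)"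
  using H.counit_linear by (simp add: Vector_Spaces.linear_def)

lemma epsT_hom: "algebra_hom sT (*) \<epsilon>T"
  unfolding algebra_hom_def
  using epsT_iota[of 1] by (intro conjI T.linearI vector_space_field) (simp_all add: epsT_add epsT_scale epsT_mult)

lemma bilin_counit: "bilin sT (\<lambda>a b. sT (\<epsilon>T a) b)" "bilin sT (\<lambda>a b. sT (\<epsilon>T b) a)"
  using epsT_hom by (auto intro!: T.bilin_slice T.bilin_flip[OF T.bilin_slice] simp: algebra_hom_def)

lemma DT_counit_left: "T.lift (\<lambda>a b. sT (\<epsilon>T a) b) (DT t) = t"
proof (induction t rule: ore_induct_alg)
  case (iota r)
  show ?case using lift_eps_const(1)[of 1 "H.D r"] by (simp add: DT_iota lift_emb bilin_counit epsT_iota)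
next
  case x
  show ?case
    using lift_eps_const(1)[of 1 W]
    by (simp add: DT_x X_def T.lift_add bilin_counit T.lift_pure lift_emb epsT_iota epsT_x gl epsl_W iota_scale)
next
  case (add s t) then show ?case by (simp add: DT_add T.lift_add bilin_counit)
next
  case (mult s t)
  have "T.lift (\<lambda>a b. sT (\<epsilon>T a) b) (DT s * DT t) =
      T.lift (\<lambda>a b. sT (\<epsilon>T a) b) (DT s) * T.lift (\<lambda>a b. sT (\<epsilon>T a) b) (DT t)"
    by (rule T.lift_mult_hom)
      (simp_all add: bilin_counit epsT_mult T.scale_mult mult.commute)
  with mult show ?case by (simp add: DT_mult)
qed

lemma DT_counit_right: "T.lift (\<lambda>a b. sT (\<epsilon>T b) a) (DT t) = t"
proof (induction t rule: ore_induct_alg)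
  case (iota r)
  show ?case using lift_eps_const(2)[of 1 "H.D r"] by (simp add: DT_iota lift_emb bilin_counit epsT_iota)
next
  case x
  show ?case
    using lift_eps_const(2)[of 1 W] epsT_iota[of 1]
    by (simp add: DT_x X_def T.lift_add bilin_counit T.lift_pure lift_emb epsT_iota epsT_x gl epsr_W iota_scale)
next
  case (add s t) then show ?case by (simp add: DT_add T.lift_add bilin_counit)
next
  case (mult s t)
  have "T.lift (\<lambda>a b. sT (\<epsilon>T b) a) (DT s * DT t) =
      T.lift (\<lambda>a b. sT (\<epsilon>T b) a) (DT s) * T.lift (\<lambda>a b. sT (\<epsilon>T b) a) (DT t)"
    by (rule T.lift_mult_hom)
      (simp_all add: bilin_counit epsT_mult T.scale_mult mult.commute)
  with mult show ?case by (simp add: DT_mult)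
qed

section \<open>Coassociativity of the extended coproduct\<close>

definition co1 :: "('t \<Rightarrow> 'k) \<Rightarrow> 't \<Rightarrow> ('t \<Rightarrow>\<^sub>0 't) endo"
  where "co1 f t = T.lift (\<lambda>a b. T.lift (\<lambda>p q. T.pure (sT (f p) q) b) (DT a)) (DT t)"

definition co2 :: "('t \<Rightarrow> 'k) \<Rightarrow> 't \<Rightarrow> ('t \<Rightarrow>\<^sub>0 't) endo"
  where "co2 f t = T.lift (\<lambda>a b. T.pure (sT (f a) 1) 1 * DT b) (DT t)"

context
  fixes f :: "'t \<Rightarrow> 'k" assumes f: "Vector_Spaces.linear sT (*) f"
begin

lemmas fl = T.linearD[OF f]

lemmas bilin_co_inner = T.bilin_slice_pure[OF f]
lemmas bilin_co1 = T.bilin_slice_left[where D = DT, OF DT_add DT_scale f]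
lemmas bilin_co2 = T.bilin_slice_right[where D = DT, OF DT_add DT_scale f]

lemma co_iota: "co1 f (\<iota> r) = co2 f (\<iota> r)"
proof -
  have "co1 f (\<iota> r) = R.lift (\<lambda>a b. R.lift (\<lambda>p q. T.pure (sT (f (\<iota> p)) (\<iota> q)) (\<iota> b)) (H.D a)) (H.D r)"
    by (simp add: co1_def DT_iota lift_emb[OF bilin_co1] lift_emb[OF bilin_co_inner])
  also have "\<dots> = R.lift (\<lambda>a b. R.lift (\<lambda>p q. T.pure (sT (f (\<iota> a)) (\<iota> p)) (\<iota> q)) (H.D b)) (H.D r)"
    by (rule H.coassoc_lift, rule trilinI)
      (simp_all add: fl iota_add iota_scale T.pure_add T.pure_scale T.scale_distrib mult.commute)
  also have "\<dots> = R.lift (\<lambda>a b. T.pure (sT (f (\<iota> a)) 1) 1 * emb (H.D b)) (H.D r)"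
    unfolding emb_def R.lift_const_left[symmetric] by (simp add: T.pure_mult T.scale_mult_left)
  also have "\<dots> = co2 f (\<iota> r)"
    by (simp add: co2_def DT_iota lift_emb[OF bilin_co2])
  finally show ?thesis .
qed

lemma co_x: "co1 f x = co2 f x"
proof -
  define g where "g r = f (\<iota> r)" for r
  have g: "Vector_Spaces.linear sR (*) g"
    unfolding g_def by (rule R.linearI[OF vector_space_field]) (simp_all add: iota_add iota_scale fl)
  have ea: "emb (R.lift \<phi> U) = R.lift (\<lambda>a b. emb (\<phi> a b)) U" for \<phi> U
    by (rule R.lift_additive) (rule emb_add)
  have inner: "T.lift (\<lambda>p q. T.pure (sT (f p) q) (\<iota> b)) (emb U) = emb (R.lift (\<lambda>p q. R.pure (sR (g p) q) b) U)" for U b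
    by (simp add: lift_emb[OF bilin_co_inner] ea emb_pure iota_scale g_def)
  have "co1 f x = T.pure (sT (g h) (\<iota> h)) x + T.pure (sT (g h) x) 1 + T.pure (sT (f x) 1) 1 +
      emb (R.lift (\<lambda>a b. R.pure (sR (g a) b) 1) W + R.lift (\<lambda>a b. R.lift (\<lambda>p q. R.pure (sR (g p) q) b) (H.D a)) W)"
    unfolding co1_def DT_x X_def T.lift_add[OF bilin_co1] T.lift_pure[OF bilin_co1] lift_emb[OF bilin_co1] emb_add
    using inner[of 1 W]
    by (simp add: DT_iota DT_x X_def T.lift_add[OF bilin_co_inner] T.lift_pure[OF bilin_co_inner] gl inner emb_pure iota_scale ea g_def)
  also have "\<dots> = T.pure (sT (g h) (\<iota> h)) x + T.pure (sT (g h) x) 1 + T.pure (sT (f x) 1) 1 +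
      emb (R.lift (\<lambda>a b. R.pure (sR (g h) a) b) W + R.lift (\<lambda>a b. R.pure (sR (g a) 1) 1 * H.D b) W)"
    unfolding w_cocycle[OF g] ..
  also have "\<dots> = co2 f x"
    unfolding co2_def DT_x X_def T.lift_add[OF bilin_co2] T.lift_pure[OF bilin_co2] lift_emb[OF bilin_co2] emb_add
      R.lift_pure_scale[OF W_carr] ea
    by (simp add: DT_iota DT_x DT_one X_def emb_mult emb_pure iota_scale distrib_left T.pure_mult T.scale_mult_left
        g_def add_ac)
  finally show ?thesis .
qed

lemma co_add: "co1 f (s + t) = co1 f s + co1 f t" "co2 f (s + t) = co2 f s + co2 f t"
  by (simp_all add: co1_def co2_def DT_add T.lift_add bilin_co1 bilin_co2)

end

lemma linear_mult_const:
  assumes "Vector_Spaces.linear sT (*) f"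
  shows "Vector_Spaces.linear sT (*) (\<lambda>c. f (a * c))" "Vector_Spaces.linear sT (*) (\<lambda>c. f (c * a))"
  by (rule T.linearI[OF vector_space_field]; simp add: distrib_left distrib_right T.scale_mult T.linearD[OF assms])+

text \<open>Slicing a product by f means slicing one factor by a \<mapsto> f(a p) or c \<mapsto> f(a
  c), with the other argument fixed. Hence both factors must satisfy the law for all functionals,
  and the induction keeps f arbitrary.\<close>

lemma co_mult:
  assumes t: "\<And>f. Vector_Spaces.linear sT (*) f \<Longrightarrow> co1 f t = co2 f t"
    and u: "\<And>f. Vector_Spaces.linear sT (*) f \<Longrightarrow> co1 f u = co2 f u"
    and f: "Vector_Spaces.linear sT (*) f"
  shows "co1 f (t * u) = co2 f (t * u)"
proof -
  have sw: "T.lift (\<lambda>a b. T.lift (\<lambda>c d. \<phi> a b c d) V) U = T.lift (\<lambda>c d. T.lift (\<lambda>a b. \<phi> a b c d) U) V" for \<phi> :: "'t \<Rightarrow> 't \<Rightarrow> 't \<Rightarrow> 't \<Rightarrow> ('t \<Rightarrow>\<^sub>0 't) endo" and U V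
    by (rule T.lift_swap[OF T.k_algebra_axioms])
  let ?p = "\<lambda>k. T.pure (sT k 1) 1"
  have "co2 f (t * u) = T.lift (\<lambda>a b. T.lift (\<lambda>c d. ?p (f (a * c)) * (DT b * DT d)) (DT u)) (DT t)"
    by (simp add: co2_def DT_mult T.lift_mult[OF bilin_co2[OF f]])
  also have "\<dots> = T.lift (\<lambda>a b. DT b * co2 (\<lambda>c. f (a * c)) u) (DT t)"
    unfolding co2_def T.lift_const_left[symmetric] by (simp add: T.scalar_central)
  also have "\<dots> = T.lift (\<lambda>a b. DT b * co1 (\<lambda>c. f (a * c)) u) (DT t)"
    by (simp add: u linear_mult_const[OF f])
  also have "\<dots> = T.lift (\<lambda>a b. T.lift (\<lambda>c d. T.lift (\<lambda>p q. ?p (f (a * p)) * DT b * T.pure q d) (DT c)) (DT u)) (DT t)"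
    unfolding co1_def T.lift_const_left[symmetric]
    by (simp add: mult.assoc T.scalar_central[symmetric] T.pure_mult T.scale_mult_left)
  also have "\<dots> = T.lift (\<lambda>c d. T.lift (\<lambda>p q. co2 (\<lambda>a. f (a * p)) t * T.pure q d) (DT c)) (DT u)"
    unfolding sw[of _ "DT u" "DT t"] sw[of _ "DT _" "DT t"] co2_def T.lift_const_right ..
  also have "\<dots> = T.lift (\<lambda>c d. T.lift (\<lambda>p q. co1 (\<lambda>a. f (a * p)) t * T.pure q d) (DT c)) (DT u)"
    by (simp add: t linear_mult_const[OF f])
  also have "\<dots> = T.lift (\<lambda>c d. T.lift (\<lambda>p q. T.lift (\<lambda>a b. T.lift (\<lambda>r s. T.pure (sT (f (r * p)) (s * q)) (b * d)) (DT a)) (DT t)) (DT c)) (DT u)"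
    unfolding co1_def T.lift_const_right[symmetric] by (simp add: T.pure_mult T.scale_mult_left)
  also have "\<dots> = T.lift (\<lambda>a b. T.lift (\<lambda>c d. T.lift (\<lambda>r s. T.lift (\<lambda>p q. T.pure (sT (f (r * p)) (s * q)) (b * d)) (DT c)) (DT a)) (DT u)) (DT t)"
    by (subst (2) sw, subst sw, subst (3) sw) (rule HOL.refl)
  also have "\<dots> = co1 f (t * u)"
    by (simp add: co1_def DT_mult T.lift_mult[OF bilin_co1[OF f]] T.lift_mult[OF bilin_co_inner[OF f]])
  finally show ?thesis ..
qed

lemma DT_coassoc: "Vector_Spaces.linear sT (*) f \<Longrightarrow> co1 f t = co2 f t"
proof (induction t arbitrary: f rule: ore_induct_alg)
  case (mult s t)
  then show ?case by (intro co_mult)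
qed (simp_all add: co_iota co_x co_add)

section \<open>Extension of the antipode to T\<close>

definition W\<^sub>1 where "W\<^sub>1 = R.lift (\<lambda>a b. a * S b) W"
definition W\<^sub>2 where "W\<^sub>2 = R.lift (\<lambda>a b. S a * b) W"

lemma W12: "\<beta> * W\<^sub>1 = W\<^sub>2"
  using datum_model unfolding W\<^sub>1_def W\<^sub>2_def by blast

lemma bilin_S: "bilin sR (\<lambda>p q. S p * q)" "bilin sR (\<lambda>p q. p * S q)"
  by (rule bilinI; simp add: H.hopf_linear_simps)+

text \<open>Apply \<open>a \<otimes> b \<otimes> c \<mapsto> S(a) b S(c)\<close> to the cocycle condition on \<open>w\<close>.\<close>

lemma kappa_beta: "sR \<kappa> \<beta> = sR \<kappa> 1"
proof -
  let ?l = "\<lambda>u. \<Sum>(a, b, c)\<leftarrow>u. S a * b * S c"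
  have cc: "?l (concat (map g u)) = (\<Sum>p\<leftarrow>u. ?l (g p))" for g and u :: "('r \<times> 'r) list"
    by (induction u) simp_all
  have ri: "ring_inv \<beta> = h" by (rule gl)
  have "formal_cong (trilinear_rel sR) (map (\<lambda>(a, b). (a, b, 1)) (sw w)
         @ concat (map (\<lambda>(a, b). map (\<lambda>(p, q). (p, q, b)) (sw (\<Delta> a))) (sw w)))
      (map (\<lambda>(a, b). (h, a, b)) (sw w)
         @ concat (map (\<lambda>(a, b). map (\<lambda>(p, q). (a, p, q)) (sw (\<Delta> b))) (sw w)))"
    using datum unfolding hopf_ore_data_def tens3_eq_iff ri by blast
  then have eq: "?l (map (\<lambda>(a, b). (a, b, 1)) (sw w)
         @ concat (map (\<lambda>(a, b). map (\<lambda>(p, q). (p, q, b)) (sw (\<Delta> a))) (sw w))) =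
      ?l (map (\<lambda>(a, b). (h, a, b)) (sw w)
         @ concat (map (\<lambda>(a, b). map (\<lambda>(p, q). (a, p, q)) (sw (\<Delta> b))) (sw w)))"
    by (rule R.sum_trilinear) (simp_all add: H.hopf_linear_simps)
  have 1: "?l (map (\<lambda>(a, b). (a, b, 1)) (sw w)) = W\<^sub>2"
    unfolding W\<^sub>2_def W_def R.lift_total[OF bilin_S(1)] by (simp add: o_def case_prod_unfold H.antipode_one)
  have 2: "?l (map (\<lambda>(a, b). (h, a, b)) (sw w)) = \<beta> * W\<^sub>1"
  proof -
    have "?l (map (\<lambda>(a, b). (h, a, b)) u) = \<beta> * (\<Sum>(a, b)\<leftarrow>u. a * S b)" for u
      by (induction u) (auto simp: gl distrib_left mult.assoc)
    then show ?thesis unfolding W\<^sub>1_def W_def R.lift_total[OF bilin_S(2)] .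
  qed
  have "?l (map (\<lambda>(p, q). (p, q, b)) (sw (\<Delta> a))) = sR (\<epsilon> a) (S b)" for a b
  proof -
    have "?l (map (\<lambda>(p, q). (p, q, b)) u) = (\<Sum>(p, q)\<leftarrow>u. S p * q) * S b" for u
      by (induction u) (auto simp: distrib_right)
    then show ?thesis by (simp add: H.antipode_left R.scale_mult_left)
  qed
  then have "?l (concat (map (\<lambda>(a, b). map (\<lambda>(p, q). (p, q, b)) (sw (\<Delta> a))) (sw w))) = (\<Sum>(a, b)\<leftarrow>sw w. S (sR (\<epsilon> a) b))"
    unfolding cc by (simp add: split_beta) (simp add: case_prod_unfold H.S_scale)
  also have "\<dots> = S (epsl W)"
    unfolding epsl_def R.lift_additive[where F = S, OF H.S_add] W_def
    by (rule R.lift_total[symmetric], rule bilinI) (simp_all add: H.hopf_linear_simps mult.commute)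
  finally have 3: "?l (concat (map (\<lambda>(a, b). map (\<lambda>(p, q). (p, q, b)) (sw (\<Delta> a))) (sw w))) = sR \<kappa> 1"
    by (simp add: epsl_W H.S_scale H.antipode_one)
  have "?l (map (\<lambda>(p, q). (a, p, q)) (sw (\<Delta> b))) = sR (\<epsilon> b) (S a)" for a b
  proof -
    have "?l (map (\<lambda>(p, q). (a, p, q)) u) = S a * (\<Sum>(p, q)\<leftarrow>u. p * S q)" for u
      by (induction u) (auto simp: distrib_left mult.assoc)
    then show ?thesis by (simp add: H.antipode_right R.scale_mult_right)
  qed
  then have "?l (concat (map (\<lambda>(a, b). map (\<lambda>(p, q). (a, p, q)) (sw (\<Delta> b))) (sw w))) = (\<Sum>(a, b)\<leftarrow>sw w. S (sR (\<epsilon> b) a))"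
    unfolding cc by (simp add: split_beta) (simp add: case_prod_unfold H.S_scale)
  also have "\<dots> = S (epsr W)"
    unfolding epsr_def R.lift_additive[where F = S, OF H.S_add] W_def
    by (rule R.lift_total[symmetric], rule bilinI) (simp_all add: H.hopf_linear_simps mult.commute)
  finally have 4: "?l (concat (map (\<lambda>(a, b). map (\<lambda>(p, q). (a, p, q)) (sw (\<Delta> b))) (sw w))) = sR \<kappa> \<beta>"
    by (simp add: epsr_W H.S_scale gl)
  \<comment> \<open>The equation reads \<open>W\<^sub>2\<close> + \<kappa> = \<beta>
    \<open>W\<^sub>1\<close> + \<kappa> \<beta>, and \<open>W12\<close> cancels the terms from
    w.\<close>
  show ?thesis
    using eq unfolding map_append sum_list_append 1 2 3 4 W12 by simp
qed

text \<open>The solution of the right antipode axiom at x, h y + x + \<open>W\<^sub>1\<close> =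
  -\<kappa>; it is the prescribed S(x) when \<kappa> = 0.\<close>

definition y where "y = \<iota> \<beta> * (sT (- \<kappa>) 1 - x - \<iota> W\<^sub>1)"

definition ST :: "'t \<Rightarrow> 't"
  where "ST = ext (\<lambda>r. \<iota> (S r)) (\<lambda>z. y * z)"

lemma iS_add: "\<iota> (S (a + b)) = \<iota> (S a) + \<iota> (S b)"
  by (simp add: H.S_add iota_add)

lemma ST_add: "ST (s + t) = ST s + ST t"
  unfolding ST_def by (rule ext_add) (simp_all add: iS_add distrib_left)

lemma ST_iota: "ST (\<iota> r) = \<iota> (S r)"
  unfolding ST_def by (rule ext_iota) (simp_all add: iS_add distrib_left)

lemma ST_iota_x: "ST (\<iota> r * x) = y * \<iota> (S r)"
  using ext_monom[of "\<lambda>r. \<iota> (S r)" "\<lambda>z. y * z" r 1] by (simp add: ST_def iS_add distrib_left)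

lemma ST_one: "ST 1 = 1"
  using ST_iota[of 1] by (simp add: H.antipode_one)

lemma ST_x: "ST x = y"
  using ST_iota_x[of 1] by (simp add: H.antipode_one)

lemma ST_scale: "ST (sT c t) = sT c (ST t)"
  unfolding ST_def
  by (rule ext_scale) (simp_all add: iS_add distrib_left H.S_scale iota_scale T.scale_mult_right T.scale_right_distrib)

lemma bilin_ST: "bilin sT (\<lambda>p q. p * ST q)" "bilin sT (\<lambda>p q. ST p * q)"
  by (rule bilinI; simp add: ST_add ST_scale distrib_left distrib_right T.scale_mult)+

lemma y_eq: "\<iota> h * y + x + \<iota> W\<^sub>1 = sT (- \<kappa>) 1"
  by (simp add: y_def mult.assoc[symmetric] iota_mult[symmetric] gl)

lemma lift_ST_emb: "T.lift (\<lambda>p q. p * ST q) (emb U) = \<iota> (R.lift (\<lambda>p q. p * S q) U)"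
  unfolding lift_emb[OF bilin_ST(1)] R.lift_additive[where F = \<iota>, OF iota_add] by (simp add: ST_iota iota_mult)

lemma lift_S_prod:
  assumes "U \<in> R.carr"
  shows "R.lift (\<lambda>p q. p * S q) (U * V) = R.lift (\<lambda>a b. a * R.lift (\<lambda>p q. p * S q) V * S b) U"
  unfolding R.lift_mult[OF bilin_S(2) assms]
  by (simp add: H.antipode_mult R.lift_const_left[symmetric] R.lift_const_right[symmetric] mult.assoc)

text \<open>The relation follows by applying \<open>p \<otimes> q \<mapsto> p S(q)\<close> to
  \<open>\<Delta>(x) \<Delta>(r) = \<Delta>(\<sigma>(r)) \<Delta>(x) + \<Delta>(\<delta>(r))\<close> and cancelling by convolution.\<close>

lemma ST_commute: "\<iota> (S r) * y = y * \<iota> (S (\<sigma> r)) + \<iota> (S (\<delta> r))"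
proof -
  let ?\<psi> = "T.lift (\<lambda>p q. p * ST q)"
  \<comment> \<open>This is the value of \<open>ST\<close> at x r, known from linearity and the
    values on monomials before \<open>ST\<close> is known to reverse products.\<close>
  define F where "F r = y * \<iota> (S (\<sigma> r)) + \<iota> (S (\<delta> r))" for r
  have ST_F: "ST (x * \<iota> r) = F r" for r
    by (simp add: x_iota ST_add ST_iota ST_iota_x F_def)
  have F_lin: "Vector_Spaces.linear sR sT F"
    unfolding F_def
    by (rule R.linearI) (simp_all add: T.vector_space_axioms sigma_add delta_add sigma_scale delta_scale
        H.S_add H.S_scale iota_add iota_scale distrib_left T.scale_mult_right T.scale_right_distrib algebra_simps)
  have "F r = \<iota> (S r) * y"
  proof (rule H.conv_cancel_left[OF T.k_algebra_axioms linear_iota iota_mult iota_one F_lin])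
    fix r
    let ?U = "H.D r" and ?V = "H.D (\<sigma> r)"
    define Z where "Z = R.lift (\<lambda>p q. \<iota> p * F q) ?U"
    have "?\<psi> (T.pure (\<iota> h) x * emb ?U) = \<iota> h * Z"
    proof -
      have b: "bilin sT (\<lambda>c d. \<iota> h * c * ST (x * d))"
        by (rule bilinI) (simp_all add: ST_add ST_scale distrib_left distrib_right T.scale_mult)
      show ?thesis
        unfolding T.lift_pure_mult[OF bilin_ST(1)] lift_emb[OF b] Z_def R.lift_const_left[symmetric]
        by (simp add: ST_F mult.assoc)
    qed
    moreover have "?\<psi> (T.pure x 1 * emb ?U) = sT (\<epsilon> r) x"
    proof -
      have b: "bilin sT (\<lambda>c d. x * c * ST (1 * d))"
        by (rule bilinI) (simp_all add: ST_add ST_scale distrib_left distrib_right T.scale_mult)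
      have "?\<psi> (T.pure x 1 * emb ?U) = x * \<iota> (R.lift (\<lambda>p q. p * S q) ?U)"
        unfolding T.lift_pure_mult[OF bilin_ST(1)] lift_emb[OF b] R.lift_additive[where F = \<iota>, OF iota_add]
          R.lift_const_left[symmetric]
        by (simp add: ST_iota mult.assoc iota_mult)
      then show ?thesis by (simp add: H.antipode_right' iota_scale T.scale_mult_right)
    qed
    moreover have "?\<psi> (emb W * emb ?U) = sT (\<epsilon> r) (\<iota> W\<^sub>1)"
    proof -
      have "R.lift (\<lambda>p q. p * S q) (W * ?U) = sR (\<epsilon> r) W\<^sub>1"
        unfolding lift_S_prod[OF W_carr] H.antipode_right' W\<^sub>1_def
          R.lift_additive[where F = "sR (\<epsilon> r)", OF R.scale_right_distrib]
        by (simp add: R.scale_mult)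
      then show ?thesis by (simp add: emb_mult[symmetric] lift_ST_emb iota_scale)
    qed
    ultimately have l: "?\<psi> (X * emb ?U) = \<iota> h * Z + sT (\<epsilon> r) x + sT (\<epsilon> r) (\<iota> W\<^sub>1)"
      by (simp add: X_def distrib_right T.lift_add[OF bilin_ST(1)])
    \<comment> \<open>The three terms of X combine to h y + x + \<open>W\<^sub>1\<close>, a scalar
      by the choice of y, so what remains is the antipode axiom in R.\<close>
    have "?\<psi> (emb ?V * X) = R.lift (\<lambda>a b. \<iota> a * (\<iota> h * y + x + \<iota> W\<^sub>1) * \<iota> (S b)) ?V"
    proof -
      have "?\<psi> (emb ?V * emb W) = R.lift (\<lambda>a b. \<iota> a * \<iota> W\<^sub>1 * \<iota> (S b)) ?V"
        unfolding emb_mult[OF H.D_carr W_carr, symmetric] lift_ST_emb lift_S_prod[OF H.D_carr] W\<^sub>1_def[symmetric]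
          R.lift_additive[where F = \<iota>, OF iota_add] by (simp add: iota_mult)
      then show ?thesis
        unfolding X_def distrib_left[of "emb ?V"] T.lift_add[OF bilin_ST(1)] lift_emb_pure[OF bilin_ST(1)]
        by (simp add: ST_iota ST_iota_x distrib_left distrib_right R.lift_fun_add mult.assoc)
    qed
    also have "\<dots> = sT (- \<kappa>) (\<iota> (R.lift (\<lambda>a b. a * S b) ?V))"
      unfolding y_eq R.lift_additive[where F = "\<lambda>z. sT (- \<kappa>) (\<iota> z)", OF HOL.trans[OF arg_cong[OF iota_add, of "sT _"] T.scale_right_distrib]]
      by (simp add: T.scale_mult iota_mult)
    finally have "?\<psi> (emb ?V * X) = sT (- \<kappa> * \<epsilon> (\<sigma> r)) 1"
      by (simp add: H.antipode_right' iota_scale)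
    moreover have "?\<psi> (emb (H.D (\<delta> r))) = sT (\<epsilon> (\<delta> r)) 1"
      by (simp add: lift_ST_emb H.antipode_right' iota_scale)
    ultimately have "?\<psi> (X * emb ?U) = sT (- \<kappa> * \<epsilon> r) 1"
      unfolding X_commute T.lift_add[OF bilin_ST(1)]
      by (simp add: T.scale_left_distrib[symmetric] eps_delta del: T.scale_minus_left)
    then have "\<iota> h * Z = sT (\<epsilon> r) (sT (- \<kappa>) 1 - x - \<iota> W\<^sub>1)"
      unfolding l by (simp add: T.scale_right_diff_distrib algebra_simps)
    then have "\<iota> \<beta> * (\<iota> h * Z) = sT (\<epsilon> r) y"
      by (simp add: y_def T.scale_mult_right)
    then show "R.lift (\<lambda>p q. \<iota> p * F q) (H.D r) = sT (\<epsilon> r) y"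
      by (simp add: Z_def[symmetric] mult.assoc[symmetric] iota_mult[symmetric] gl)
  qed
  then show ?thesis by (simp add: F_def)
qed

lemma ST_mult: "ST (s * t) = ST t * ST s"
  unfolding ST_def
  by (rule ext_mult[where m = "\<lambda>a b. b * a" and y = y])
    (simp_all add: iS_add distrib_left distrib_right mult.assoc H.antipode_mult iota_mult H.antipode_one ST_commute)

lemma DT_antipode_left: "T.lift (\<lambda>p q. ST p * q) (DT t) = sT (\<epsilon>T t) 1"
proof (induction t rule: ore_induct_alg)
  case (iota r)
  have "T.lift (\<lambda>p q. ST p * q) (emb (H.D r)) = \<iota> (R.lift (\<lambda>p q. S p * q) (H.D r))"
    unfolding lift_emb[OF bilin_ST(2)] R.lift_additive[where F = \<iota>, OF iota_add] by (simp add: ST_iota iota_mult)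
  then show ?case by (simp add: DT_iota H.antipode_left' iota_scale epsT_iota)
next
  case x
  have "T.lift (\<lambda>p q. ST p * q) (emb W) = \<iota> W\<^sub>2"
    unfolding lift_emb[OF bilin_ST(2)] W\<^sub>2_def R.lift_additive[where F = \<iota>, OF iota_add] by (simp add: ST_iota iota_mult)
  then have "T.lift (\<lambda>p q. ST p * q) (DT x) = \<iota> \<beta> * x + y + \<iota> W\<^sub>2"
    by (simp add: DT_x X_def T.lift_add[OF bilin_ST(2)] T.lift_pure[OF bilin_ST(2)] ST_iota ST_x gl)
  also have "\<dots> = sT (- \<kappa>) (\<iota> \<beta>)"
    unfolding y_def W12[symmetric] by (simp add: algebra_simps iota_mult T.scale_mult_right)
  also have "\<dots> = \<iota> (- sR \<kappa> \<beta>)" by (simp add: iota_scale iota_minus)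
  \<comment> \<open>y was fitted to the right axiom, so the left one is an additional condition at
    x; it amounts to \<kappa> \<beta> = \<kappa>.\<close>
  also have "\<dots> = sT (- \<kappa>) 1" unfolding kappa_beta by (simp add: iota_scale iota_minus)
  finally show ?case by (simp add: epsT_x)
next
  case (add s t)
  then show ?case by (simp add: DT_add T.lift_add[OF bilin_ST(2)] epsT_add T.scale_left_distrib)
next
  case (mult s t)
  have "T.lift (\<lambda>p q. ST p * q) (DT (s * t)) = T.lift (\<lambda>a b. T.lift (\<lambda>c d. ST c * (ST a * b) * d) (DT t)) (DT s)"
    by (simp add: DT_mult T.lift_mult[OF bilin_ST(2)] ST_mult mult.assoc)
  \<comment> \<open>As S reverses products, the sum belonging to s is the inner one and must be
    contracted first.\<close>
  also have "\<dots> = T.lift (\<lambda>c d. T.lift (\<lambda>a b. ST c * (ST a * b) * d) (DT s)) (DT t)"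
    by (rule T.lift_swap[OF T.k_algebra_axioms])
  also have "\<dots> = T.lift (\<lambda>c d. sT (\<epsilon>T s) 1 * (ST c * d)) (DT t)"
    by (simp add: T.lift_const_left T.lift_const_right mult T.scale_mult)
  also have "\<dots> = sT (\<epsilon>T (s * t)) 1"
    unfolding T.lift_const_left mult(2) by (simp add: T.scale_mult_left epsT_mult)
  finally show ?case .
qed

lemma DT_antipode_right: "T.lift (\<lambda>p q. p * ST q) (DT t) = sT (\<epsilon>T t) 1"
proof (induction t rule: ore_induct_alg)
  case (iota r)
  then show ?case by (simp add: DT_iota lift_ST_emb H.antipode_right' iota_scale epsT_iota)
next
  case x
  have "T.lift (\<lambda>p q. p * ST q) (DT x) = \<iota> h * y + x + \<iota> W\<^sub>1"
    by (simp add: DT_x X_def T.lift_add[OF bilin_ST(1)] T.lift_pure[OF bilin_ST(1)] lift_ST_emb ST_x ST_one W\<^sub>1_def)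
  then show ?case by (simp only: y_eq epsT_x)
next
  case (add s t)
  then show ?case by (simp add: DT_add T.lift_add[OF bilin_ST(1)] epsT_add T.scale_left_distrib)
next
  case (mult s t)
  have "T.lift (\<lambda>p q. p * ST q) (DT (s * t)) = T.lift (\<lambda>a b. T.lift (\<lambda>c d. a * (c * ST d) * ST b) (DT t)) (DT s)"
    by (simp add: DT_mult T.lift_mult[OF bilin_ST(1)] ST_mult mult.assoc)
  also have "\<dots> = T.lift (\<lambda>a b. sT (\<epsilon>T t) 1 * (a * ST b)) (DT s)"
    by (simp add: T.lift_const_left T.lift_const_right mult T.scale_mult)
  also have "\<dots> = sT (\<epsilon>T (s * t)) 1"
    unfolding T.lift_const_left mult(1) by (simp add: T.scale_mult_left epsT_mult mult.commute)
  finally show ?case .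
qed

text \<open>The constructed S(x) differs from the prescribed value by -\<kappa> \<beta>, and
  \<epsilon>(x) = -\<kappa>; the two values of S(x) therefore agree when \<epsilon>(x) = 0.\<close>

theorem sufficiency:
  "\<exists>\<Delta>T \<epsilon>T ST. hopf_extends \<iota> \<Delta> \<epsilon> S sT \<Delta>T \<epsilon>T ST \<and>
    \<Delta>T x = ore_comult sT \<iota> x \<beta> w \<and> (\<epsilon>T x = 0 \<longrightarrow> ST x = ore_antipode \<iota> S x \<beta> w)"
proof -
  have "\<exists>\<Delta>T. hopf_algebra sT \<Delta>T \<epsilon>T ST \<and> (\<forall>r u. T.total u = DT r \<longrightarrow> \<Delta>T r = tens sT u)"
  proof (rule T.hopf_algebraI)
    show "T.lift (\<lambda>a b. T.lift (\<lambda>p q. T.pure (sT (f p) q) b) (DT a)) (DT r) =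
        T.lift (\<lambda>a b. T.pure (sT (f a) 1) 1 * DT b) (DT r)" if "Vector_Spaces.linear sT (*) f" for f r
      using DT_coassoc[OF that, of r] by (simp add: co1_def co2_def)
    show "Vector_Spaces.linear sT sT ST"
      by (rule T.linearI[OF T.vector_space_axioms]) (simp_all add: ST_add ST_scale)
  qed (simp_all add: DT_add DT_scale DT_mult DT_one epsT_hom DT_counit_left DT_counit_right
      DT_antipode_left DT_antipode_right)
  then obtain \<Delta>T where hopf: "hopf_algebra sT \<Delta>T \<epsilon>T ST"
    and \<Delta>T: "\<And>r u. T.total u = DT r \<Longrightarrow> \<Delta>T r = tens sT u" by blast
  have "\<Delta>T (\<iota> r) = tens sT (map (map_prod \<iota> \<iota>) (sw (\<Delta> r)))" for r
    by (rule \<Delta>T) (simp add: DT_iota H.D_def emb_total)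
  moreover have "\<Delta>T x = ore_comult sT \<iota> x \<beta> w"
    unfolding ore_comult_def by (rule \<Delta>T) (simp only: total_ore_comult gl(3) DT_x X_def W_def)
  moreover have "ST x = ore_antipode \<iota> S x \<beta> w" if "\<epsilon>T x = 0"
  proof -
    have "\<kappa> = 0" using that by (simp add: epsT_x)
    then show ?thesis
      by (simp add: ST_x y_def ore_antipode_def W\<^sub>1_def W_def R.lift_total[OF bilin_S(2)] algebra_simps)
  qed
  ultimately show ?thesis
    using hopf unfolding hopf_extends_def by (blast intro: epsT_iota ST_iota)
qed

end

theorem theorem1p3:
  fixes sR :: "'k::field \<Rightarrow> 'r::ring_1 \<Rightarrow> 'r"
    and \<Delta> :: "'r \<Rightarrow> 'r tensor2"
    and \<epsilon> :: "'r \<Rightarrow> 'k"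
    and S :: "'r \<Rightarrow> 'r"
    and sT :: "'k \<Rightarrow> 't::ring_1 \<Rightarrow> 't"
    and \<iota> :: "'r \<Rightarrow> 't"
    and x :: "'t"
    and \<sigma> \<delta> :: "'r \<Rightarrow> 'r"
  assumes "hopf_algebra sR \<Delta> \<epsilon> S"
    and "noetherian TYPE('r)"
    and "ore_extension sR sT \<iota> x \<sigma> \<delta>"
    and "tensor_square_domain sR"
  shows
    "(\<forall>\<Delta>T \<epsilon>T ST. hopf_extends \<iota> \<Delta> \<epsilon> S sT \<Delta>T \<epsilon>T ST \<longrightarrow>
        (\<exists>x' \<sigma>' \<delta>' \<beta> w \<chi>.
           ore_extension sR sT \<iota> x' \<sigma>' \<delta>' \<and>
           hopf_ore_data sR \<Delta> \<epsilon> S \<sigma>' \<delta>' \<beta> w \<chi> \<and>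
           \<Delta>T x' = ore_comult sT \<iota> x' \<beta> w \<and>
           ST x' = ore_antipode \<iota> S x' \<beta> w)) \<and>
     (\<forall>x' \<sigma>' \<delta>' \<beta> w \<chi>.
        ore_extension sR sT \<iota> x' \<sigma>' \<delta>' \<and> hopf_ore_data sR \<Delta> \<epsilon> S \<sigma>' \<delta>' \<beta> w \<chi> \<longrightarrow>
        (\<exists>\<Delta>T \<epsilon>T ST.
           hopf_extends \<iota> \<Delta> \<epsilon> S sT \<Delta>T \<epsilon>T ST \<and>
           \<Delta>T x' = ore_comult sT \<iota> x' \<beta> w \<and>
           (\<epsilon>T x' = 0 \<longrightarrow> ST x' = ore_antipode \<iota> S x' \<beta> w)))"
proof (intro conjI allI impI)
  have alg: "k_algebra sR" using assms(1) by (simp add: hopf_algebra_def)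
  fix \<Delta>T \<epsilon>T ST
  assume ext: "hopf_extends \<iota> \<Delta> \<epsilon> S sT \<Delta>T \<epsilon>T ST"
  interpret hopf_ore_ext sR sT \<iota> x \<sigma> \<delta> \<Delta> \<epsilon> S \<Delta>T \<epsilon>T ST
    using assms ext alg
    by (auto simp: hopf_extends_def intro!: hopf_ore_ext.intro hopf_ore.intro ore.intro hopf_ore_ext_axioms.intro)
  show "\<exists>x' \<sigma>' \<delta>' \<beta> w \<chi>. ore_extension sR sT \<iota> x' \<sigma>' \<delta>' \<and>
      hopf_ore_data sR \<Delta> \<epsilon> S \<sigma>' \<delta>' \<beta> w \<chi> \<and>
      \<Delta>T x' = ore_comult sT \<iota> x' \<beta> w \<and> ST x' = ore_antipode \<iota> S x' \<beta> w"
    by (rule necessity)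
next
  have alg: "k_algebra sR" using assms(1) by (simp add: hopf_algebra_def)
  fix x' \<sigma>' \<delta>' \<beta> w \<chi>
  assume *: "ore_extension sR sT \<iota> x' \<sigma>' \<delta>' \<and> hopf_ore_data sR \<Delta> \<epsilon> S \<sigma>' \<delta>' \<beta> w \<chi>"
  interpret hopf_ore_datum sR sT \<iota> x' \<sigma>' \<delta>' \<Delta> \<epsilon> S \<beta> w \<chi>
    using assms * alg
    by (auto intro!: hopf_ore_datum.intro hopf_ore.intro ore.intro hopf_ore_datum_axioms.intro)
  show "\<exists>\<Delta>T \<epsilon>T ST. hopf_extends \<iota> \<Delta> \<epsilon> S sT \<Delta>T \<epsilon>T ST \<and>
      \<Delta>T x' = ore_comult sT \<iota> x' \<beta> w \<and> (\<epsilon>T x' = 0 \<longrightarrow> ST x' = ore_antipode \<iota> S x' \<beta> w)"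
    by (rule sufficiency)
qed

end
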